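(* Let $T>0$ and let $a\in L^\infty([0,T])$ satisfy (HLoc), (HGlob) and be even, i.e. $a(T-t)=a(t)$ for a.e. $t\in[0,T]$. Then, for each $k\in\mathbb{N}$, $k\ge 1$, the following hold. (a) The connected component $\mathscr{C}_{\mathrm{ev},k}$ is unbounded in $\mathbb{R}\times H^2_{\mathrm{ev}}(\mathbb{T})$ and $\mathcal{P}_\lambda(\mathscr{C}_{\mathrm{ev},k})=(-\infty,\sigma_k]$. In particular, the problem $$-u''=\lambda u+a(t)u^3 \text{ in } (0,T),\qquad u(0)=u(T),\quad u'(0)=u'(T)$$ admits at least two even solutions with exactly $2k$ zeros in $[0,T)$ for each $\lambda<\sigma_k$. (b) The connected component $\mathscr{C}_{\mathrm{odd},k}$ is unbounded in $\mathbb{R}\times H^2_{\mathrm{odd}}(\mathbb{T})$ and $\mathcal{P}_\lambda(\mathscr{C}_{\mathrm{odd},k})=(-\infty,\sigma_k]$. In particular, the same problem admits at least two odd solutions with exactly $2k$ zeros in $[0,T)$ for each $\lambda<\sigma_k$.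
   Context: (HLoc): $a\in L^\infty([0,T])$, $a(t)\ge 0$ for a.e. $t$, and $a\not\equiv 0$. (HGlob): there exist $0=t_0<t_1<\dots<t_N=T$ such that for every $i\in\{0,\dots,N-1\}$, $a\in\mathcal{C}((t_i,t_{i+1}))$ and either $\inf_{(t_i,t_{i+1})}a>0$ or $a(t)=0$ for all $t\in(t_i,t_{i+1})$. $\mathbb{T}=\mathbb{R}/(T\mathbb{Z})$; $H^s(\mathbb{T})$ ($s\in\mathbb{N}\cup\{0\}$) is the space of real functions $u\in H^s([0,T])$ with $D^\alpha u(0)=D^\alpha u(T)$ for integers $0\le\alpha<s$, and $L^2(\mathbb{T})=H^0(\mathbb{T})$. $H^s_{\mathrm{ev}}(\mathbb{T})$ (resp. $H^s_{\mathrm{odd}}(\mathbb{T})$) is the subspace of $u\in H^s(\mathbb{T})$ with $u(T-t)=u(t)$ (resp. $u(T-t)=-u(t)$) for a.e. $t\in[0,T]$; its elements are called even (resp. odd). Solutions of the problem are functions of $H^2(\mathbb{T})$ solving the equation a.e. $\sigma_k=(2\pi k/T)^2$. For $\ast\in\{\mathrm{ev},\mathrm{odd}\}$, $\mathfrak{F}_\ast:\mathbb{R}\times H^2_\ast(\mathbb{T})\to L^2_\ast(\mathbb{T})$, $\mathfrak{F}_\ast(\lambda,u)=u''+\lambda u+a(t)u^3$ (here $L^2_\ast=H^0_\ast$). $\mathcal{T}=\{(\lambda,0):\lambda\in\mathbb{R}\}$. The sets of nontrivial even/odd solutions are $\mathfrak{S}_{\mathrm{ev}}=(\mathfrak{F}_{\mathrm{ev}}^{-1}(0)\setminus\mathcal{T})\cup\{(\sigma_k,0):k\ge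 0\}$ and $\mathfrak{S}_{\mathrm{odd}}=(\mathfrak{F}_{\mathrm{odd}}^{-1}(0)\setminus\mathcal{T})\cup\{(\sigma_k,0):k\ge 1\}$. $\mathscr{C}_{\mathrm{ev},k}$ (resp. $\mathscr{C}_{\mathrm{odd},k}$) is the connected component of $\mathfrak{S}_{\mathrm{ev}}$ (resp. $\mathfrak{S}_{\mathrm{odd}}$) containing $(\sigma_k,0)$. $\mathcal{P}_\lambda(\lambda,u)=\lambda$. *)

theory Defs
  imports "HOL-Analysis.Analysis"
begin

section \<open>Sobolev spaces on an interval and on the circle\<close>

definition square_integrable :: "real \<Rightarrow> (real \<Rightarrow> real) \<Rightarrow> bool" where
  "square_integrable T u \<longleftrightarrow>
     u \<in> borel_measurable (lebesgue_on {0..T}) \<and>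
     integrable (lebesgue_on {0..T}) (\<lambda>t. (u t)\<^sup>2)"

text \<open>Test functions are of class \<open>C\<^sup>1\<close> with compact support in the open interval.\<close>

definition test_function :: "real \<Rightarrow> (real \<Rightarrow> real) \<Rightarrow> bool" where
  "test_function T \<phi> \<longleftrightarrow>
     \<phi> C1_differentiable_on UNIV \<and> closure {t. \<phi> t \<noteq> 0} \<subseteq> {0<..<T}"

definition weak_derivative :: "real \<Rightarrow> (real \<Rightarrow> real) \<Rightarrow> (real \<Rightarrow> real) \<Rightarrow> bool" where
  "weak_derivative T u v \<longleftrightarrow>
     square_integrable T u \<and> square_integrable T v \<and>
     (\<forall>\<phi>. test_function T \<phi> \<longrightarrow>
        (LINT t|lebesgue_on {0..T}. u t * deriv \<phi> t) =
        - (LINT t|lebesgue_on {0..T}. v t * \<phi> t))"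

text \<open>Some representative of the weak derivative; it is determined up to equality almost
  everywhere and is used below only where this ambiguity is irrelevant.\<close>

definition wD :: "real \<Rightarrow> (real \<Rightarrow> real) \<Rightarrow> real \<Rightarrow> real" where
  "wD T u = (SOME v. weak_derivative T u v)"

text \<open>\<open>w \<alpha>\<close> represents \<open>D\<^sup>\<alpha> (w 0)\<close> for \<open>\<alpha> \<le> s\<close>; for \<open>\<alpha> < s\<close> it is the continuous
  representative, so that its values at the end points make sense.\<close>

definition sobolev_jet :: "real \<Rightarrow> nat \<Rightarrow> (nat \<Rightarrow> real \<Rightarrow> real) \<Rightarrow> bool" where
  "sobolev_jet T s w \<longleftrightarrow>
     (\<forall>\<alpha>\<le>s. square_integrable T (w \<alpha>)) \<and>
     (\<forall>\<alpha><s. weak_derivative T (w \<alpha>) (w (Suc \<alpha>)) \<and> continuous_on {0..T} (w \<alpha>))"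

text \<open>\<open>H\<^sup>s(\<real>/T\<int>)\<close>. For \<open>s \<ge> 1\<close> a class is represented by its unique member that is continuous on
  \<open>[0,T]\<close> and vanishes outside \<open>[0,T]\<close>. For \<open>s = 0\<close> there is no such choice, and functions
  equal almost everywhere on \<open>[0,T]\<close> have to be identified.\<close>

definition sobolev_per :: "real \<Rightarrow> nat \<Rightarrow> (real \<Rightarrow> real) set" where
  "sobolev_per T s =
     {u. (\<forall>t. t \<notin> {0..T} \<longrightarrow> u t = 0) \<and>
         (\<exists>w. w 0 = u \<and> sobolev_jet T s w \<and> (\<forall>\<alpha><s. w \<alpha> 0 = w \<alpha> T))}"

definition sobolev_norm :: "real \<Rightarrow> nat \<Rightarrow> (real \<Rightarrow> real) \<Rightarrow> real" where
  "sobolev_norm T s u =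
     sqrt (\<Sum>\<alpha>\<le>s. LINT t|lebesgue_on {0..T}. (((wD T ^^ \<alpha>) u) t)\<^sup>2)"

definition sobolev_dist :: "real \<Rightarrow> nat \<Rightarrow> (real \<Rightarrow> real) \<Rightarrow> (real \<Rightarrow> real) \<Rightarrow> real" where
  "sobolev_dist T s u v = sobolev_norm T s (\<lambda>t. u t - v t)"

datatype symmetry = Ev | Odd

fun has_symmetry :: "symmetry \<Rightarrow> real \<Rightarrow> (real \<Rightarrow> real) \<Rightarrow> bool" where
  "has_symmetry Ev T u \<longleftrightarrow> (AE t in lebesgue_on {0..T}. u (T - t) = u t)"
| "has_symmetry Odd T u \<longleftrightarrow> (AE t in lebesgue_on {0..T}. u (T - t) = - u t)"

definition sobolev_sym :: "symmetry \<Rightarrow> real \<Rightarrow> nat \<Rightarrow> (real \<Rightarrow> real) set" where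
  "sobolev_sym p T s = {u \<in> sobolev_per T s. has_symmetry p T u}"

text \<open>The ambient space \<open>\<real> \<times> H\<^sup>2\<close> with the given symmetry.\<close>

abbreviation ambient :: "symmetry \<Rightarrow> real \<Rightarrow> (real \<times> (real \<Rightarrow> real)) set" where
  "ambient p T \<equiv> UNIV \<times> sobolev_sym p T 2"

abbreviation ambient_dist ::
  "real \<Rightarrow> real \<times> (real \<Rightarrow> real) \<Rightarrow> real \<times> (real \<Rightarrow> real) \<Rightarrow> real" where
  "ambient_dist T \<equiv> prod_dist dist (sobolev_dist T 2)"

definition ambient_topology :: "symmetry \<Rightarrow> real \<Rightarrow> (real \<times> (real \<Rightarrow> real)) topology" where
  "ambient_topology p T = Metric_space.mtopology (ambient p T) (ambient_dist T)"

definition ambient_bounded :: "symmetry \<Rightarrow> real \<Rightarrow> (real \<times> (real \<Rightarrow> real)) set \<Rightarrow> bool" where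
  "ambient_bounded p T C = Metric_space.mbounded (ambient p T) (ambient_dist T) C"


section \<open>The weight\<close>

definition L_infinity :: "real \<Rightarrow> (real \<Rightarrow> real) \<Rightarrow> bool" where
  "L_infinity T a \<longleftrightarrow>
     a \<in> borel_measurable (lebesgue_on {0..T}) \<and>
     (\<exists>C. AE t in lebesgue_on {0..T}. \<bar>a t\<bar> \<le> C)"

definition HLoc :: "real \<Rightarrow> (real \<Rightarrow> real) \<Rightarrow> bool" where
  "HLoc T a \<longleftrightarrow>
     L_infinity T a \<and>
     (AE t in lebesgue_on {0..T}. 0 \<le> a t) \<and>
     \<not> (AE t in lebesgue_on {0..T}. a t = 0)"

text \<open>The requirement \<open>bdd_below\<close> guards against the unspecified value of \<open>Inf\<close> on sets of reals
  that are not bounded below.\<close>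

definition HGlob :: "real \<Rightarrow> (real \<Rightarrow> real) \<Rightarrow> bool" where
  "HGlob T a \<longleftrightarrow>
     (\<exists>N t. t 0 = 0 \<and> t N = T \<and> (\<forall>i<N. t i < t (Suc i)) \<and>
        (\<forall>i<N. continuous_on {t i<..<t (Suc i)} a \<and>
           ((bdd_below (a ` {t i<..<t (Suc i)}) \<and> 0 < (INF x\<in>{t i<..<t (Suc i)}. a x)) \<or>
            (\<forall>x\<in>{t i<..<t (Suc i)}. a x = 0))))"


section \<open>Solutions and components\<close>

definition \<sigma> :: "real \<Rightarrow> nat \<Rightarrow> real" where
  "\<sigma> T k = (2 * pi * real k / T)\<^sup>2"

definition \<FF> :: "real \<Rightarrow> (real \<Rightarrow> real) \<Rightarrow> real \<times> (real \<Rightarrow> real) \<Rightarrow> real \<Rightarrow> real" where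
  "\<FF> T a = (\<lambda>(l, u) t. wD T (wD T u) t + l * u t + a t * (u t) ^ 3)"

text \<open>The zero set of \<open>\<FF>\<close> on \<open>\<real> \<times> H\<^sup>2\<close>; values of \<open>\<FF>\<close> are elements of \<open>L\<^sup>2\<close>, so vanishing
  is understood almost everywhere.\<close>

definition \<FF>_zeros :: "symmetry \<Rightarrow> real \<Rightarrow> (real \<Rightarrow> real) \<Rightarrow> (real \<times> (real \<Rightarrow> real)) set" where
  "\<FF>_zeros p T a = {x \<in> ambient p T. AE t in lebesgue_on {0..T}. \<FF> T a x t = 0}"

definition trivial_solutions :: "(real \<times> (real \<Rightarrow> real)) set" where
  "trivial_solutions = {(l, \<lambda>_. 0) |l. True}"

fun first_index :: "symmetry \<Rightarrow> nat" where
  "first_index Ev = 0"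
| "first_index Odd = 1"

definition \<SS> :: "symmetry \<Rightarrow> real \<Rightarrow> (real \<Rightarrow> real) \<Rightarrow> (real \<times> (real \<Rightarrow> real)) set" where
  "\<SS> p T a =
     (\<FF>_zeros p T a - trivial_solutions) \<union> {(\<sigma> T k, \<lambda>_. 0) |k. first_index p \<le> k}"

definition \<C> ::
  "symmetry \<Rightarrow> real \<Rightarrow> (real \<Rightarrow> real) \<Rightarrow> nat \<Rightarrow> (real \<times> (real \<Rightarrow> real)) set" where
  "\<C> p T a k =
     connected_component_of_set (subtopology (ambient_topology p T) (\<SS> p T a)) (\<sigma> T k, \<lambda>_. 0)"

text \<open>The periodic boundary conditions are part of membership in \<open>H\<^sup>2(\<real>/T\<int>)\<close>.\<close>

definition is_solution :: "real \<Rightarrow> (real \<Rightarrow> real) \<Rightarrow> real \<Rightarrow> (real \<Rightarrow> real) \<Rightarrow> bool" where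
  "is_solution T a l u \<longleftrightarrow>
     u \<in> sobolev_per T 2 \<and>
     (AE t in lebesgue_on {0..T}. - wD T (wD T u) t = l * u t + a t * (u t) ^ 3)"

text \<open>For \<open>n > 0\<close> the condition on \<open>card\<close> includes finiteness of the set of zeros.\<close>

definition nodal_solutions ::
  "symmetry \<Rightarrow> real \<Rightarrow> (real \<Rightarrow> real) \<Rightarrow> real \<Rightarrow> nat \<Rightarrow> (real \<Rightarrow> real) set" where
  "nodal_solutions p T a l n =
     {u. is_solution T a l u \<and> has_symmetry p T u \<and> card {t \<in> {0..<T}. u t = 0} = n}"

end

theory Submission
  imports Defs
begin

text \<open>By symmetry about \<open>T/2\<close>, even and odd solutions are the solutions of a shooting problem with one
  parameter \<open>A\<close>, and the number of zeros is read off the Pruefer angle \<open>\<theta>\<close>, given by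
  \<open>\<theta>' = cos\<^sup>2 \<theta> + q sin\<^sup>2 \<theta>\<close> with \<open>q = \<lambda> + a u\<^sup>2\<close>. The angle at \<open>T/2\<close> depends continuously on
  \<open>(\<lambda>, u)\<close> and takes discrete values on the set of solutions, so it is constant on a component;
  comparison with the linear equation then confines the component to \<open>\<lambda> \<le> \<sigma>\<^sub>k\<close>.

  Conversely, the \<open>k\<close>-nodal solutions correspond to the zero set of a continuous function of \<open>(\<lambda>, A)\<close>
  in a plane rectangle, of known sign on its horizontal sides and with the single zero \<open>(\<sigma>\<^sub>k, 0)\<close> on the
  right side. By the Poincare--Miranda theorem a connected set of zeros leads from there to the left
  side, which is at an arbitrary \<open>\<lambda>\<close>. Since the equation may have solutions that blow up, the cubic
  term is truncated at a level \<open>R\<close>; a bound for the \<open>k\<close>-nodal solutions that does not depend on \<open>R\<close>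
  shows that the truncation does not matter.\<close>

section \<open>Differential inequalities and initial value problems\<close>

text \<open>The equation is read as a linear one, u'' = - q u, with the potential q = \<lambda> + a
  u^2 frozen along the solution. Then q \<ge> \<lambda>, and the angle is governed by q alone, so it
  makes sense for u = 0 as well; this is why one continuous function sees both the nontrivial
  solutions and the points (\<sigma>_k, 0). (HGlob) makes a continuous off a finite set, so every
  H^2 solution is classical off that set, and all inequalities below tolerate finitely many
  exceptional points. The obstacle is the bound for nodal solutions: where a vanishes the equation
  is linear and does not limit the size of u. The number of zeros supplies the bound. On an interval
  with a \<ge> c > 0 it forces a subinterval without sign change, where Harnack and Riccati
  estimates bound a u^2 at one point. From there the bound travels through the remaining sign
  changes, since q \<ge> \<lambda> forbids more than exponential growth on a nodal interval;
  reflection about T/2 covers the part to the left. None of these estimates involves R.\<close>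

lemma nondecreasing_off_finite:
  fixes f f' :: "real \<Rightarrow> real"
  assumes "finite S" "s \<le> t" "continuous_on {s..t} f"
    and "\<And>x. x \<in> {s<..<t} - S \<Longrightarrow> (f has_real_derivative f' x) (at x)"
    and "\<And>x. x \<in> {s<..<t} - S \<Longrightarrow> 0 \<le> f' x"
  shows "f s \<le> f t"
proof -
  let ?g = "\<lambda>x. if x \<in> {s<..<t} - S then f' x else 0"
  have "(?g has_integral (f t - f s)) {s..t}"
    by (rule fundamental_theorem_of_calculus_interior_strong[OF assms(1,2)])
       (use assms in \<open>auto simp: has_real_derivative_iff_has_vector_derivative\<close>)
  then have "0 \<le> f t - f s"
    by (rule has_integral_nonneg) (use assms(5) in auto)
  then show ?thesis by simp
qed

lemma increment_bound_off_finite: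
  fixes f :: "real \<Rightarrow> 'a::banach"
  assumes "finite S" "s \<le> t" "continuous_on {s..t} f" "0 \<le> B"
    and "\<And>x. x \<in> {s<..<t} - S \<Longrightarrow> (f has_vector_derivative f' x) (at x)"
    and "\<And>x. x \<in> {s<..<t} - S \<Longrightarrow> norm (f' x) \<le> B"
  shows "norm (f t - f s) \<le> B * (t - s)"
proof -
  let ?g = "\<lambda>x. if x \<in> {s<..<t} - S then f' x else 0"
  have "(?g has_integral (f t - f s)) {s..t}"
    by (rule fundamental_theorem_of_calculus_interior_strong[OF assms(1,2)])
       (use assms in auto)
  then have "norm (f t - f s) \<le> B * measure lborel {s..t}"
    by (rule has_integral_bound_real[OF \<open>0 \<le> B\<close> finite.emptyI]) (use assms in auto)
  then show ?thesis using assms by simp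
qed

text \<open>After the last point \<open>r\<close> with \<open>0 \<le> z r\<close> the function is
  negative, so the hypothesis reads z' \<ge> B z there and z exp(- B x) is nondecreasing from
  \<open>r\<close> on. The form with the absolute value is the one that Lipschitz right-hand sides
  produce.\<close>

lemma linear_differential_inequality_nonneg:
  fixes z z' :: "real \<Rightarrow> real"
  assumes S: "finite S" and st: "s \<le> t" and cont: "continuous_on {s..t} z"
    and der: "\<And>x. x \<in> {s<..<t} - S \<Longrightarrow> (z has_real_derivative z' x) (at x)"
    and ge: "\<And>x. x \<in> {s<..<t} - S \<Longrightarrow> - B * \<bar>z x\<bar> \<le> z' x"
    and init: "0 \<le> z s"
  shows "0 \<le> z t"
proof (rule ccontr)
  assume neg: "\<not> 0 \<le> z t"
  define P where "P = {x \<in> {s..t}. 0 \<le> z x}"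
  have "closed P"
    unfolding P_def using continuous_on_closed_Collect_le[of "{s..t}" "\<lambda>_. 0" z] cont by auto
  have ne: "P \<noteq> {}" using st init by (auto simp: P_def)
  have bdd: "bdd_above P" by (rule bdd_aboveI[of _ t]) (auto simp: P_def)
  define r where "r = Sup P"
  have "r \<in> P" unfolding r_def by (rule closed_contains_Sup[OF ne bdd \<open>closed P\<close>])
  then have r: "s \<le> r" "r \<le> t" "0 \<le> z r" by (auto simp: P_def)
  have after: "z x < 0" if "r < x" "x \<le> t" for x
  proof (rule ccontr)
    assume "\<not> z x < 0"
    then have "x \<in> P" using that r by (auto simp: P_def)
    then have "x \<le> r" unfolding r_def by (rule cSup_upper[OF _ bdd])
    then show False using that by simp
  qed
  have "z r * exp (- B * r) \<le> z t * exp (- B * t)"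
  proof (rule nondecreasing_off_finite[OF S r(2), where f' = "\<lambda>x. (z' x - B * z x) * exp (- B * x)"])
    show "continuous_on {r..t} (\<lambda>x. z x * exp (- B * x))"
      by (intro continuous_intros continuous_on_subset[OF cont]) (use r in auto)
    show "((\<lambda>x. z x * exp (- B * x)) has_real_derivative (z' x - B * z x) * exp (- B * x)) (at x)"
      if "x \<in> {r<..<t} - S" for x
      by (rule derivative_eq_intros der refl | use that r in \<open>force simp: algebra_simps\<close>)+
    show "0 \<le> (z' x - B * z x) * exp (- B * x)" if "x \<in> {r<..<t} - S" for x
      using ge[of x] after[of x] that r by (simp add: zero_le_mult_iff)
  qed
  then have "0 \<le> z t * exp (- B * t)" using r by (smt (verit) exp_ge_zero mult_nonneg_nonneg)
  then show False using neg by (simp add: zero_le_mult_iff)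
qed

text \<open>Positivity turns the hypothesis into z' \<ge> - B z, so z exp(B x) is nondecreasing.
  This form permits a conclusion backwards from the right end.\<close>

lemma linear_differential_inequality_mono:
  fixes z z' :: "real \<Rightarrow> real"
  assumes S: "finite S" and st: "s \<le> t" and cont: "continuous_on {s..t} z"
    and der: "\<And>x. x \<in> {s<..<t} - S \<Longrightarrow> (z has_real_derivative z' x) (at x)"
    and ge: "\<And>x. x \<in> {s<..<t} - S \<Longrightarrow> - B * \<bar>z x\<bar> \<le> z' x"
    and init: "0 \<le> z s"
  shows "z s * exp (B * s) \<le> z t * exp (B * t)"
proof (rule nondecreasing_off_finite[OF S st, where f' = "\<lambda>x. (z' x + B * z x) * exp (B * x)"])
  have nn: "0 \<le> z x" if "x \<in> {s..t}" for x
    by (rule linear_differential_inequality_nonneg[where z = z and z' = z' and B = B, OF S _ _ _ _ init])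
       (use that der ge in \<open>auto intro: continuous_on_subset[OF cont]\<close>)
  show "continuous_on {s..t} (\<lambda>x. z x * exp (B * x))"
    by (intro continuous_intros cont)
  show "((\<lambda>x. z x * exp (B * x)) has_real_derivative (z' x + B * z x) * exp (B * x)) (at x)"
    if "x \<in> {s<..<t} - S" for x
    by (rule derivative_eq_intros der refl | use that in \<open>force simp: algebra_simps\<close>)+
  show "0 \<le> (z' x + B * z x) * exp (B * x)" if "x \<in> {s<..<t} - S" for x
    using ge[of x] nn[of x] that by (simp add: zero_le_mult_iff)
qed

text \<open>The function is squeezed: it is nonnegative from the left end on, and monotonicity of z
  exp(B x) carries \<open>z t \<le> 0\<close> back to \<open>x\<close>. Applied to differences of
  angles it turns equality at the right end into an identity, which is the source of the strict
  comparisons below.\<close>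

lemma linear_differential_inequality_zero:
  fixes z z' :: "real \<Rightarrow> real"
  assumes S: "finite S" and cont: "continuous_on {s..t} z"
    and der: "\<And>x. x \<in> {s<..<t} - S \<Longrightarrow> (z has_real_derivative z' x) (at x)"
    and ge: "\<And>x. x \<in> {s<..<t} - S \<Longrightarrow> - B * \<bar>z x\<bar> \<le> z' x"
    and init: "0 \<le> z s" and fin: "z t \<le> 0" and x: "x \<in> {s..t}"
  shows "z x = 0"
proof -
  have "0 \<le> z x"
    by (rule linear_differential_inequality_nonneg[where z = z and z' = z' and B = B, OF S _ _ _ _ init])
       (use x der ge in \<open>auto intro: continuous_on_subset[OF cont]\<close>)
  moreover have "z x * exp (B * x) \<le> z t * exp (B * t)"
    by (rule linear_differential_inequality_mono[OF S, where z' = z'])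
       (use x der ge \<open>0 \<le> z x\<close> in \<open>auto intro: continuous_on_subset[OF cont]\<close>)
  then have "z x * exp (B * x) \<le> 0" using fin by (smt (verit) exp_ge_zero mult_nonpos_nonneg)
  then have "z x \<le> 0" by (simp add: mult_le_0_iff)
  ultimately show ?thesis by simp
qed

text \<open>The perturbation \<open>e\<close> enters through its integral only. Angles therefore
  depend continuously on the potential in the L^1 sense, and an L^2 estimate of the difference of
  two solutions is enough later on.\<close>

lemma gronwall_difference:
  fixes x y :: "real \<Rightarrow> 'a::euclidean_space"
  assumes S: "finite S" and contx: "continuous_on {a..b} x" and conty: "continuous_on {a..b} y"
    and derx: "\<And>t. t \<in> {a<..<b} - S \<Longrightarrow> (x has_vector_derivative x' t) (at t)"
    and dery: "\<And>t. t \<in> {a<..<b} - S \<Longrightarrow> (y has_vector_derivative y' t) (at t)"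
    and le: "\<And>t. t \<in> {a<..<b} - S \<Longrightarrow> norm (x' t - y' t) \<le> L * norm (x t - y t) + e t"
    and L: "0 \<le> L" and e: "\<And>t. t \<in> {a..b} \<Longrightarrow> 0 \<le> e t" and eint: "e integrable_on {a..b}"
    and t: "t \<in> {a..b}"
  shows "norm (x t - y t) \<le> (norm (x a - y a) + integral {a..b} e) * exp (L * (t - a))"
proof -
  define n where "n t = norm (x t - y t)" for t
  define E where "E = n a + integral {a..b} e"
  have contn: "continuous_on {a..b} n" unfolding n_def by (intro continuous_intros contx conty)
  have intn: "(\<lambda>s. L * n s) integrable_on {a..t}" if "t \<in> {a..b}" for t
    by (intro integrable_continuous_real continuous_intros continuous_on_subset[OF contn])
       (use that in auto)
  have einta: "e integrable_on {a..t}" if "t \<in> {a..b}" for t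
    by (rule integrable_subinterval_real[OF eint]) (use that in auto)
  have step: "n t \<le> E + integral {a..t} (\<lambda>s. L * n s)" if t: "t \<in> {a..b}" for t
  proof -
    let ?d = "\<lambda>s. if s \<in> {a<..<b} - S then x' s - y' s else 0"
    have I: "(?d has_integral ((x t - y t) - (x a - y a))) {a..t}"
    proof (rule fundamental_theorem_of_calculus_interior_strong[OF S])
      show "a \<le> t" using t by auto
      show "((\<lambda>s. x s - y s) has_vector_derivative ?d s) (at s)" if "s \<in> {a<..<t} - S" for s
        using that t by (auto intro!: has_vector_derivative_diff derx dery)
      show "continuous_on {a..t} (\<lambda>s. x s - y s)"
        by (intro continuous_intros continuous_on_subset[OF contx] continuous_on_subset[OF conty])
           (use t in auto)
    qed
    have "norm (integral {a..t} ?d) \<le> integral {a..t} (\<lambda>s. L * n s + e s)"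
    proof (rule integral_norm_bound_integral)
      show "?d integrable_on {a..t}" using I by blast
      show "(\<lambda>s. L * n s + e s) integrable_on {a..t}"
        by (intro integrable_add intn einta t)
      show "norm (?d s) \<le> L * n s + e s" if "s \<in> {a..t}" for s
        using that t L e[of s] le[of s] by (auto simp: n_def)
    qed
    also have "\<dots> = integral {a..t} (\<lambda>s. L * n s) + integral {a..t} e"
      by (intro integral_add intn einta t)
    also have "integral {a..t} e \<le> integral {a..b} e"
      by (intro integral_subset_le einta eint) (use t e in auto)
    finally have "norm ((x t - y t) - (x a - y a)) \<le> integral {a..t} (\<lambda>s. L * n s) + integral {a..b} e"
      using I by (simp add: integral_unique)
    moreover have "n t \<le> n a + norm ((x t - y t) - (x a - y a))"
      unfolding n_def by (metis norm_triangle_sub)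
    ultimately show ?thesis by (simp add: E_def)
  qed
  \<comment> \<open>The majorant \<open>m\<close> is differentiable with m' = L n \<le> L m, whereas
    \<open>n\<close>, being a norm, is merely continuous; the exponential factor is therefore
    applied to \<open>m\<close>.\<close>
  define m where "m t = E + integral {a..t} (\<lambda>s. L * n s)" for t
  have derm: "(m has_real_derivative L * n s) (at s)" if s: "s \<in> {a<..<b}" for s
  proof -
    have "((\<lambda>t. integral {a..t} (\<lambda>s. L * n s)) has_vector_derivative L * n s) (at s within {a..b})"
      by (rule integral_has_vector_derivative) (use s in \<open>auto intro!: continuous_intros contn\<close>)
    then have "((\<lambda>t. integral {a..t} (\<lambda>s. L * n s)) has_real_derivative L * n s) (at s)"
      using s by (simp add: has_real_derivative_iff_has_vector_derivative
          at_within_interior[of s "{a..b}"] interior_atLeastAtMost_real)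
    from DERIV_add[OF DERIV_const[of E] this] show ?thesis unfolding m_def by simp
  qed
  have contm: "continuous_on {a..b} m"
    unfolding m_def
    by (intro continuous_intros indefinite_integral_continuous_1 intn) (use t in auto)
  have "- (m a * exp (- L * a)) \<le> - (m t * exp (- L * t))"
  proof (rule nondecreasing_off_finite[where S = "{}" and f = "\<lambda>s. - (m s * exp (- L * s))"
        and f' = "\<lambda>s. L * (m s - n s) * exp (- L * s)"], simp)
    show "a \<le> t" using t by auto
    show "continuous_on {a..t} (\<lambda>s. - (m s * exp (- L * s)))"
      by (intro continuous_intros continuous_on_subset[OF contm]) (use t in auto)
    show "((\<lambda>s. - (m s * exp (- L * s))) has_real_derivative L * (m s - n s) * exp (- L * s)) (at s)"
      if "s \<in> {a<..<t} - {}" for s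
      by (rule derivative_eq_intros derm refl | use that t in \<open>force simp: algebra_simps\<close>)+
    show "0 \<le> L * (m s - n s) * exp (- L * s)" if "s \<in> {a<..<t} - {}" for s
      using step[of s] that t L by (auto simp: m_def)
  qed
  then have "m t * exp (- L * t) \<le> E * exp (- L * a)" by (simp add: m_def)
  then have "m t * exp (- L * t) * exp (L * t) \<le> E * exp (- L * a) * exp (L * t)"
    by (rule mult_right_mono) simp
  then have "m t \<le> E * exp (L * (t - a))"
    by (simp add: mult.assoc flip: exp_add) (simp add: algebra_simps)
  then show ?thesis using step[OF t] by (simp add: m_def E_def n_def)
qed

section \<open>Integrability off a finite set and global existence\<close>

lemma integrable_continuous_off_finite:
  fixes f :: "real \<Rightarrow> 'a::euclidean_space"
  assumes S: "finite S" and cont: "continuous_on ({a<..<b} - S) f"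
    and B: "\<And>x. x \<in> {a<..<b} - S \<Longrightarrow> norm (f x) \<le> B"
  shows "f absolutely_integrable_on {a..b}"
proof -
  let ?A = "{a<..<b} - S"
  have op: "open ?A" using S by (intro open_Diff finite_imp_closed) auto
  have meas: "?A \<in> lmeasurable"
    by (rule lmeasurable_open[OF _ op]) (rule bounded_subset[of "{a..b}"], auto)
  have "f absolutely_integrable_on ?A"
  proof (rule measurable_bounded_by_integrable_imp_absolutely_integrable)
    show "f \<in> borel_measurable (lebesgue_on ?A)"
      by (rule continuous_imp_measurable_on_sets_lebesgue[OF cont]) (use meas in \<open>auto simp: fmeasurable_def\<close>)
    show "?A \<in> sets lebesgue" using meas by (auto simp: fmeasurable_def)
    show "(\<lambda>_. B) integrable_on ?A" by (rule integrable_on_const[OF meas])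
  qed (use B in auto)
  moreover have "negligible (S \<union> {a,b})" using S by (auto intro: negligible_finite)
  then have "negligible {x \<in> {a..b} - ?A. f x \<noteq> 0}" "negligible {x \<in> ?A - {a..b}. f x \<noteq> 0}"
    by (rule negligible_subset, force)+
  ultimately show ?thesis
    using absolutely_integrable_spike_set_eq[of "{a..b}" ?A f] by blast
qed

text \<open>The integral operator is a contraction on the whole interval at once in the weighted
  norm sup exp(- K t) |y t|, so no local solutions have to be continued. The linear growth that
  \<open>lip\<close> and \<open>bd\<close> allow keeps the integrand bounded along a continuous
  function.\<close>

lemma picard_existence:
  fixes F :: "real \<Rightarrow> 'a::euclidean_space \<Rightarrow> 'a"
  assumes S: "finite S" and b: "0 \<le> b" and L: "0 \<le> L"
    and cont: "continuous_on (({0<..<b} - S) \<times> UNIV) (\<lambda>(t, y). F t y)"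
    and lip: "\<And>t x y. t \<in> {0<..<b} - S \<Longrightarrow> norm (F t x - F t y) \<le> L * norm (x - y)"
    and bd: "\<And>t. t \<in> {0<..<b} - S \<Longrightarrow> norm (F t 0) \<le> B"
  shows "\<exists>y. continuous_on {0..b} y \<and> y 0 = y0 \<and>
    (\<forall>t\<in>{0<..<b} - S. (y has_vector_derivative F t (y t)) (at t))"
proof -
  let ?A = "{0<..<b} - S"
  have op: "open ?A" using S by (intro open_Diff finite_imp_closed) auto
  define F' where "F' t y = (if t \<in> ?A then F t y else 0)" for t y
  \<comment> \<open>The contraction factor is L / K \<le> 1/2; the summand 1 keeps K positive when L
    = 0.\<close>
  define K where "K = 2 * L + 1"
  have K: "K > 0" "L / K \<le> 1/2" using L by (auto simp: K_def field_simps)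
  \<comment> \<open>Clamping the time to the interval lets bounded continuous functions on the whole
    line serve as the complete space.\<close>
  define cl where "cl t = max 0 (min b t)" for t :: real
  have clI: "cl t \<in> {0..b}" for t using b by (auto simp: cl_def)
  have contF': "continuous_on ?A (\<lambda>s. F' s (y s))" if "continuous_on {0..b} y" for y
  proof -
    have "continuous_on ?A (\<lambda>s. case (s, y s) of (t, y) \<Rightarrow> F t y)"
      by (rule continuous_on_compose2[OF cont])
         (auto intro!: continuous_intros continuous_on_subset[OF that])
    then show ?thesis by (rule continuous_on_eq) (auto simp: F'_def)
  qed
  have intF': "(\<lambda>s. F' s (y s)) integrable_on {0..b}" if y: "continuous_on {0..b} y" for y
  proof -
    have "bounded (y ` {0..b})" by (intro compact_imp_bounded compact_continuous_image y) auto
    then obtain M where M: "\<And>s. s \<in> {0..b} \<Longrightarrow> norm (y s) \<le> M"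
      unfolding bounded_iff by blast
    have "norm (F' s (y s)) \<le> L * M + B" if s: "s \<in> ?A" for s
    proof -
      have "norm (F s (y s)) \<le> norm (F s (y s) - F s 0) + norm (F s 0)" 
        using norm_triangle_sub[of "F s (y s)" "F s 0"] by simp
      also have "\<dots> \<le> L * norm (y s - 0) + B" by (intro add_mono lip bd s)
      also have "\<dots> \<le> L * M + B" using M[of s] s L by (auto intro: mult_left_mono)
      finally show ?thesis using s by (simp add: F'_def)
    qed
    then show ?thesis
      using integrable_continuous_off_finite[OF S contF'[OF y]] by (metis absolutely_integrable_on_def)
  qed
  have intF'_sub: "(\<lambda>s. F' s (y s)) integrable_on {0..t}" if "continuous_on {0..b} y" "t \<in> {0..b}" for y t
    by (rule integrable_subinterval_real[OF intF'[OF that(1)]]) (use that in auto)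
  \<comment> \<open>\<open>Y\<close> stands for exp(- K t) y, so that the weighted norm of y is the
    plain supremum norm of \<open>Y\<close>.\<close>
  define G where "G Y t = exp (- K * cl t) *\<^sub>R (y0 + integral {0..cl t} (\<lambda>s. F' s (exp (K * s) *\<^sub>R apply_bcontfun Y s)))"
    for Y :: "real \<Rightarrow>\<^sub>C 'a" and t
  have contE: "continuous_on {0..b} (\<lambda>s. exp (K * s) *\<^sub>R apply_bcontfun Y s)" for Y :: "real \<Rightarrow>\<^sub>C 'a"
    by (intro continuous_intros) auto
  have Gb: "G Y \<in> bcontfun" for Y
  proof -
    let ?g = "\<lambda>t. exp (- K * t) *\<^sub>R (y0 + integral {0..t} (\<lambda>s. F' s (exp (K * s) *\<^sub>R apply_bcontfun Y s)))"
    have cg: "continuous_on {0..b} ?g"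
      by (intro continuous_intros indefinite_integral_continuous_1 intF' contE)
    have c: "continuous_on UNIV (\<lambda>t. ?g (cl t))"
      by (rule continuous_on_compose2[OF cg]) (use clI in \<open>auto simp: cl_def intro!: continuous_intros\<close>)
    have "bounded (range (\<lambda>t. ?g (cl t)))"
      by (rule bounded_subset[OF compact_imp_bounded[OF compact_continuous_image[OF cg compact_Icc]]])
         (use clI in blast)
    then show ?thesis using c by (simp add: bcontfun_def G_def)
  qed
  define H where "H Y = Bcontfun (G Y)" for Y
  have H: "apply_bcontfun (H Y) = G Y" for Y
    unfolding H_def by (rule Bcontfun_inverse[OF Gb])
  have "\<exists>!Y. H Y = Y"
  proof (rule banach_fix_type[of "1/2"], simp, simp, intro allI)
    fix Y Z
    show "dist (H Y) (H Z) \<le> 1/2 * dist Y Z"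
    proof (rule dist_bound)
      fix t
      let ?y = "\<lambda>s. exp (K * s) *\<^sub>R apply_bcontfun Y s" and ?z = "\<lambda>s. exp (K * s) *\<^sub>R apply_bcontfun Z s"
      let ?t = "cl t" and ?D = "dist Y Z"
      have assoc: "u * (L * ?D / K * v) = (u * v) * (L / K * ?D)" for u v by simp
      have E: "((\<lambda>s. L * ?D * exp (K * s)) has_integral (L * ?D / K * exp (K * ?t) - L * ?D / K * exp (K * 0))) {0..?t}"
        by (rule fundamental_theorem_of_calculus)
           (use clI[of t] K in \<open>auto intro!: derivative_eq_intros
              simp flip: has_real_derivative_iff_has_vector_derivative\<close>)
      have "norm (integral {0..?t} (\<lambda>s. F' s (?y s) - F' s (?z s))) \<le> integral {0..?t} (\<lambda>s. L * ?D * exp (K * s))"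
      proof (rule integral_norm_bound_integral)
        show "(\<lambda>s. F' s (?y s) - F' s (?z s)) integrable_on {0..?t}"
          by (intro integrable_diff intF'_sub contE clI)
        show "(\<lambda>s. L * ?D * exp (K * s)) integrable_on {0..?t}" using E by blast
        fix s assume s: "s \<in> {0..?t}"
        have "norm (F' s (?y s) - F' s (?z s)) \<le> L * norm (?y s - ?z s)"
          using lip[of s "?y s" "?z s"] L by (auto simp: F'_def)
        also have "norm (?y s - ?z s) = exp (K * s) * dist (apply_bcontfun Y s) (apply_bcontfun Z s)"
          by (simp add: dist_norm flip: scaleR_diff_right)
        also have "L * \<dots> \<le> L * (exp (K * s) * ?D)"
          by (intro mult_left_mono L dist_bounded) auto
        finally show "norm (F' s (?y s) - F' s (?z s)) \<le> L * ?D * exp (K * s)" by (simp add: algebra_simps)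
      qed
      also have "\<dots> = L * ?D / K * exp (K * ?t) - L * ?D / K * exp (K * 0)"
        by (rule integral_unique[OF E])
      also have "\<dots> = L * ?D / K * (exp (K * ?t) - 1)"
        by (simp add: right_diff_distrib)
      also have "\<dots> \<le> L * ?D / K * exp (K * ?t)"
        using K L by (intro mult_left_mono) auto
      finally have *: "norm (integral {0..?t} (\<lambda>s. F' s (?y s) - F' s (?z s))) \<le> L * ?D / K * exp (K * ?t)" .
      have "G Y t - G Z t = exp (- K * ?t) *\<^sub>R integral {0..?t} (\<lambda>s. F' s (?y s) - F' s (?z s))"
        unfolding G_def Henstock_Kurzweil_Integration.integral_diff[OF intF'_sub[OF contE clI] intF'_sub[OF contE clI]]
        by (simp add: scaleR_right_diff_distrib scaleR_add_right)
      then have "dist (G Y t) (G Z t) = exp (- K * ?t) * norm (integral {0..?t} (\<lambda>s. F' s (?y s) - F' s (?z s)))"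
        by (simp add: dist_norm)
      also have "\<dots> \<le> exp (- K * ?t) * (L * ?D / K * exp (K * ?t))"
        by (rule mult_left_mono[OF *]) simp
      also have "\<dots> = (exp (- K * ?t) * exp (K * ?t)) * (L / K * ?D)" 
        by (rule assoc)
      also have "\<dots> = L / K * ?D" by (simp flip: exp_add)
      also have "\<dots> \<le> 1/2 * ?D" using K by (intro mult_right_mono) auto
      finally show "dist (apply_bcontfun (H Y) t) (apply_bcontfun (H Z) t) \<le> 1/2 * ?D" by (simp add: H)
    qed
  qed
  then obtain Y where Y: "H Y = Y" by auto
  define y where "y t = exp (K * t) *\<^sub>R apply_bcontfun Y t" for t
  have cy: "continuous_on {0..b} y" unfolding y_def by (rule contE)
  have yint: "y t = y0 + integral {0..t} (\<lambda>s. F' s (y s))" if "t \<in> {0..b}" for t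
  proof -
    have "cl t = t" using that by (auto simp: cl_def)
    then have "apply_bcontfun Y t = exp (- K * t) *\<^sub>R (y0 + integral {0..t} (\<lambda>s. F' s (y s)))"
      using arg_cong[OF Y, of "\<lambda>Y. apply_bcontfun Y t"] by (simp add: H G_def y_def)
    then have "y t = exp (K * t) *\<^sub>R exp (- K * t) *\<^sub>R (y0 + integral {0..t} (\<lambda>s. F' s (y s)))"
      unfolding y_def by simp
    then show ?thesis by (simp flip: exp_add)
  qed
  have "(y has_vector_derivative F t (y t)) (at t)" if t: "t \<in> ?A" for t
  proof -
    have A: "{0..b} - (S \<union> {0,b}) = ?A" by auto
    have "continuous (at t within ?A) (\<lambda>s. F' s (y s))"
      using contF'[OF cy] t by (simp add: continuous_on_eq_continuous_within)
    then have "((\<lambda>u. integral {0..u} (\<lambda>s. F' s (y s))) has_vector_derivative F' t (y t)) (at t within ?A)"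
      using integral_has_vector_derivative_continuous_at[OF intF'[OF cy], of t "S \<union> {0,b}"] S t
      unfolding A by auto
    then have "((\<lambda>u. integral {0..u} (\<lambda>s. F' s (y s))) has_vector_derivative F t (y t)) (at t)"
      using t by (simp add: at_within_open[OF t op] F'_def)
    then have "((\<lambda>u. y0 + integral {0..u} (\<lambda>s. F' s (y s))) has_vector_derivative F t (y t)) (at t)"
      by (auto intro!: derivative_eq_intros)
    then show ?thesis
      by (rule has_vector_derivative_transform_within_open[OF _ op t]) (simp add: yint)
  qed
  then show ?thesis using cy yint[of 0] b by (intro exI[of _ y]) auto
qed

section \<open>The Pruefer angle\<close>

text \<open>The equation u'' = - q u as a first-order system with v = u'. The derivatives are asked
  for off \<open>S\<close> only, because the potential may jump there, while u and v stay continuous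
  up to the end points. A nonlinear equation takes this form once its solution is inserted into
  q.\<close>

definition linear_ode :: "real set \<Rightarrow> real \<Rightarrow> real \<Rightarrow> (real \<Rightarrow> real) \<Rightarrow> (real \<Rightarrow> real) \<Rightarrow> (real \<Rightarrow> real) \<Rightarrow> bool" where
  "linear_ode S s t q u v \<longleftrightarrow> continuous_on {s..t} u \<and> continuous_on {s..t} v \<and>
     (\<forall>x\<in>{s<..<t} - S. (u has_real_derivative v x) (at x) \<and> (v has_real_derivative - q x * u x) (at x))"

text \<open>The angle is characterised by its own equation, not as an argument of the vector (v, u).
  It thus depends on q and its initial value alone, needs no choice of a branch, and exists for the
  zero solution too.\<close>

definition pruefer_angle :: "real set \<Rightarrow> real \<Rightarrow> real \<Rightarrow> (real \<Rightarrow> real) \<Rightarrow> (real \<Rightarrow> real) \<Rightarrow> bool" where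
  "pruefer_angle S s t q \<theta> \<longleftrightarrow> continuous_on {s..t} \<theta> \<and>
     (\<forall>x\<in>{s<..<t} - S. (\<theta> has_real_derivative (cos (\<theta> x))\<^sup>2 + q x * (sin (\<theta> x))\<^sup>2) (at x))"

section \<open>Invariances of the system and of the angle\<close>

lemma linear_ode_subset:
  "linear_ode S s t q u v \<Longrightarrow> s \<le> s' \<Longrightarrow> t' \<le> t \<Longrightarrow> linear_ode S s' t' q u v"
  unfolding linear_ode_def by (auto elim: continuous_on_subset)

lemma pruefer_angle_subset:
  "pruefer_angle S s t q \<theta> \<Longrightarrow> s \<le> s' \<Longrightarrow> t' \<le> t \<Longrightarrow> pruefer_angle S s' t' q \<theta>"
  unfolding pruefer_angle_def by (auto elim: continuous_on_subset)

lemma linear_ode_uminus: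
  "linear_ode S s t q u v \<Longrightarrow> linear_ode S s t q (\<lambda>x. - u x) (\<lambda>x. - v x)"
  unfolding linear_ode_def by (auto intro!: continuous_intros derivative_eq_intros)

lemma linear_ode_reflect:
  assumes "linear_ode S s t q u v"
  shows "linear_ode ((\<lambda>x. c - x) ` S) (c - t) (c - s) (\<lambda>x. q (c - x)) (\<lambda>x. u (c - x)) (\<lambda>x. - v (c - x))"
proof -
  have S: "c - x \<in> {s<..<t} - S" if "x \<in> {c - t<..<c - s} - (\<lambda>x. c - x) ` S" for x
    using that by (auto simp: image_iff)
  have u: "((\<lambda>x. u (c - x)) has_real_derivative v (c - x) * (- 1)) (at x)"
    and v: "((\<lambda>x. v (c - x)) has_real_derivative (- q (c - x) * u (c - x)) * (- 1)) (at x)"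
    if "x \<in> {c - t<..<c - s} - (\<lambda>x. c - x) ` S" for x
  proof -
    have d: "((\<lambda>x. c - x) has_real_derivative - 1) (at x)" by (auto intro!: derivative_eq_intros)
    have "(u has_real_derivative v (c - x)) (at (c - x))"
      "(v has_real_derivative - q (c - x) * u (c - x)) (at (c - x))"
      using assms S[OF that] by (auto simp: linear_ode_def)
    from DERIV_chain2[OF this(1) d] DERIV_chain2[OF this(2) d]
    show "((\<lambda>x. u (c - x)) has_real_derivative v (c - x) * (- 1)) (at x)"
      "((\<lambda>x. v (c - x)) has_real_derivative (- q (c - x) * u (c - x)) * (- 1)) (at x)" by auto
  qed
  have "continuous_on {c - t..c - s} (\<lambda>x. u (c - x))" "continuous_on {c - t..c - s} (\<lambda>x. v (c - x))"
    using assms unfolding linear_ode_def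
    by (auto intro!: continuous_on_compose2[where g = u and t = "{s..t}"]
        continuous_on_compose2[where g = v and t = "{s..t}"] continuous_intros)
  then show ?thesis
    unfolding linear_ode_def
    using u DERIV_minus[OF v] by (auto intro!: continuous_intros)
qed

section \<open>Existence, stability and comparison of angles\<close>

lemma sin_squared_diff_le: "\<bar>(sin x)\<^sup>2 - (sin y)\<^sup>2\<bar> \<le> \<bar>x - y\<bar>" for x y :: real
proof -
  have "(sin x)\<^sup>2 - (sin y)\<^sup>2 = sin (x + y) * sin (x - y)"
    by (simp add: sin_add sin_diff power2_eq_square algebra_simps)
       (simp add: mult.assoc[symmetric] cos_squared_eq power2_eq_square[symmetric] algebra_simps)
  then have "\<bar>(sin x)\<^sup>2 - (sin y)\<^sup>2\<bar> = \<bar>sin (x + y)\<bar> * \<bar>sin (x - y)\<bar>" by (simp add: abs_mult)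
  also have "\<dots> \<le> 1 * \<bar>x - y\<bar>"
    by (intro mult_mono abs_sin_x_le_abs_x) auto
  finally show ?thesis by simp
qed

text \<open>Writing cos^2 as 1 - sin^2 leaves \<open>p - 1\<close> as the factor of the angular
  difference; this is the origin of the Lipschitz constant \<open>B + 1\<close> in the estimates for
  angles.\<close>

lemma pruefer_rhs_diff:
  fixes p q x y :: real
  shows "((cos x)\<^sup>2 + p * (sin x)\<^sup>2) - ((cos y)\<^sup>2 + q * (sin y)\<^sup>2)
    = (p - 1) * ((sin x)\<^sup>2 - (sin y)\<^sup>2) + (p - q) * (sin y)\<^sup>2"
  by (simp add: cos_squared_eq algebra_simps)

lemma pruefer_angle_exists:
  assumes S: "finite S" and b: "0 \<le> b" and cont: "continuous_on ({0<..<b} - S) q"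
    and B: "\<And>x. x \<in> {0<..<b} - S \<Longrightarrow> \<bar>q x\<bar> \<le> B"
  shows "\<exists>\<theta>. pruefer_angle S 0 b q \<theta> \<and> \<theta> 0 = \<theta>0"
proof -
  let ?F = "\<lambda>t y. (cos y)\<^sup>2 + q t * (sin y)\<^sup>2"
  have "\<exists>y. continuous_on {0..b} y \<and> y 0 = \<theta>0 \<and>
      (\<forall>t\<in>{0<..<b} - S. (y has_vector_derivative ?F t (y t)) (at t))"
  proof (rule picard_existence[OF S b, where L = "\<bar>B\<bar> + 1" and B = 1])
    have "continuous_on (({0<..<b} - S) \<times> UNIV) (\<lambda>x. q (fst x))"
      by (rule continuous_on_compose2[OF cont]) (auto intro!: continuous_intros)
    then show "continuous_on (({0<..<b} - S) \<times> UNIV) (\<lambda>(t, y). ?F t y)"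
      unfolding case_prod_unfold by (intro continuous_intros)
    show "norm (?F t x - ?F t y) \<le> (\<bar>B\<bar> + 1) * norm (x - y)" if "t \<in> {0<..<b} - S" for t x y
    proof -
      have "norm (?F t x - ?F t y) = \<bar>q t - 1\<bar> * \<bar>(sin x)\<^sup>2 - (sin y)\<^sup>2\<bar>"
        by (simp add: pruefer_rhs_diff abs_mult)
      also have "\<dots> \<le> (\<bar>B\<bar> + 1) * \<bar>x - y\<bar>"
        using B[OF that] by (intro mult_mono sin_squared_diff_le) auto
      finally show ?thesis by simp
    qed
  qed auto
  then show ?thesis
    unfolding pruefer_angle_def has_real_derivative_iff_has_vector_derivative by metis
qed

text \<open>The bound \<open>B\<close> is asked of the first potential, so that the exponential
  factor stays fixed while the second potential approaches the first.\<close>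

lemma pruefer_angle_diff_bound:
  assumes S: "finite S" and 1: "pruefer_angle S s t q1 \<theta>1" and 2: "pruefer_angle S s t q2 \<theta>2"
    and B: "\<And>x. x \<in> {s<..<t} - S \<Longrightarrow> \<bar>q1 x\<bar> \<le> B" "0 \<le> B"
    and e: "\<And>x. x \<in> {s<..<t} - S \<Longrightarrow> \<bar>q1 x - q2 x\<bar> \<le> e x"
      "\<And>x. x \<in> {s..t} \<Longrightarrow> 0 \<le> e x" "e integrable_on {s..t}"
    and x: "x \<in> {s..t}"
  shows "\<bar>\<theta>1 x - \<theta>2 x\<bar> \<le> (\<bar>\<theta>1 s - \<theta>2 s\<bar> + integral {s..t} e) * exp ((B + 1) * (x - s))"
proof -
  let ?F = "\<lambda>q \<theta> t. (cos (\<theta> t))\<^sup>2 + q t * (sin (\<theta> t))\<^sup>2"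
  have "norm (\<theta>1 x - \<theta>2 x) \<le> (norm (\<theta>1 s - \<theta>2 s) + integral {s..t} e) * exp ((B + 1) * (x - s))"
  proof (rule gronwall_difference[OF S _ _ _ _ _ _ e(2,3) x, where x' = "?F q1 \<theta>1" and y' = "?F q2 \<theta>2"])
    show "continuous_on {s..t} \<theta>1" "continuous_on {s..t} \<theta>2" using 1 2 by (auto simp: pruefer_angle_def)
    show "(\<theta>1 has_vector_derivative ?F q1 \<theta>1 x) (at x)" "(\<theta>2 has_vector_derivative ?F q2 \<theta>2 x) (at x)"
      if "x \<in> {s<..<t} - S" for x
      using 1 2 that unfolding pruefer_angle_def has_real_derivative_iff_has_vector_derivative by auto
    show "norm (?F q1 \<theta>1 x - ?F q2 \<theta>2 x) \<le> (B + 1) * norm (\<theta>1 x - \<theta>2 x) + e x"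
      if x: "x \<in> {s<..<t} - S" for x
    proof -
      have "norm (?F q1 \<theta>1 x - ?F q2 \<theta>2 x) \<le> \<bar>q1 x - 1\<bar> * \<bar>(sin (\<theta>1 x))\<^sup>2 - (sin (\<theta>2 x))\<^sup>2\<bar>
          + \<bar>q1 x - q2 x\<bar> * (sin (\<theta>2 x))\<^sup>2"
        by (simp add: pruefer_rhs_diff) (metis abs_mult abs_power2 abs_triangle_ineq)
      also have "\<dots> \<le> (B + 1) * \<bar>\<theta>1 x - \<theta>2 x\<bar> + e x * 1"
        using B(1)[OF x] B(2) e(1)[OF x]
        by (intro add_mono mult_mono sin_squared_diff_le) (auto simp: power2_le_iff_abs_le abs_square_le_1)
      finally show ?thesis by simp
    qed
  qed (use B in auto)
  then show ?thesis by simp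
qed

lemma pruefer_angle_unique:
  assumes "finite S" and "pruefer_angle S s t q \<theta>1" and "pruefer_angle S s t q \<theta>2"
    and "\<And>x. x \<in> {s<..<t} - S \<Longrightarrow> \<bar>q x\<bar> \<le> B" and "\<theta>1 s = \<theta>2 s" and "x \<in> {s..t}"
  shows "\<theta>1 x = \<theta>2 x"
  using pruefer_angle_diff_bound[OF assms(1-3), where B = "\<bar>B\<bar>" and e = "\<lambda>_. 0" and x = x] assms(4-6)
  by fastforce

lemma sin_minus_pi_int_squared: "(sin (x - of_int j * pi))\<^sup>2 = (sin x)\<^sup>2" for x :: real
proof -
  have "sin (of_int j * pi) = 0" by (simp add: sin_zero_iff_int2)
  moreover from this have "(cos (of_int j * pi))\<^sup>2 = 1" by (simp add: cos_squared_eq)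
  ultimately show ?thesis by (simp add: sin_diff power_mult_distrib)
qed

lemma open_interval_minus_finite_nonempty:
  fixes s t :: real
  assumes "s < t" "finite S"
  obtains x where "x \<in> {s<..<t} - S"
  using assms infinite_Ioo[OF assms(1)] by (metis finite_Diff2 finite.emptyI all_not_in_conv)

lemma derivative_of_locally_zero:
  fixes f :: "real \<Rightarrow> real"
  assumes "(f has_real_derivative d) (at x)" "x \<in> {s<..<t}" "\<And>y. y \<in> {s<..<t} \<Longrightarrow> f y = c"
  shows "d = 0"
proof -
  have "((\<lambda>_. c) has_real_derivative d) (at x)"
    by (rule DERIV_cong_ev[THEN iffD1, OF refl _ refl assms(1)])
       (use assms(2,3) in \<open>auto intro!: eventually_nhds_in_open[of "{s<..<t}", THEN eventually_mono]\<close>)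
  then show ?thesis using DERIV_unique DERIV_const by blast
qed

text \<open>At a multiple of \<open>\<pi>\<close> the angle moves with speed 1, whatever the potential is.\<close>

lemma pruefer_angle_crossing:
  assumes S: "finite S" and P: "pruefer_angle S s t q \<theta>"
    and B: "\<And>x. x \<in> {s<..<t} - S \<Longrightarrow> \<bar>q x\<bar> \<le> B" and st: "s < t" and ge: "of_int j * pi \<le> \<theta> s"
  shows "of_int j * pi < \<theta> t"
proof (rule ccontr)
  assume "\<not> of_int j * pi < \<theta> t"
  define z where "z x = \<theta> x - of_int j * pi" for x
  have der: "(z has_real_derivative (cos (\<theta> x))\<^sup>2 + q x * (sin (\<theta> x))\<^sup>2) (at x)" if "x \<in> {s<..<t} - S" for x
    using P that unfolding pruefer_angle_def z_def by (auto intro!: derivative_eq_intros)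
  \<comment> \<open>Since sin^2 has period pi and Lipschitz constant 1, sin^2 theta \<le> |z|, so
    theta' = 1 + (q - 1) sin^2 theta is at least - (|B| + 1) |z|. If theta ended at or below the
    multiple of pi, z would vanish identically, although theta' = 1 there.\<close>
  have zero: "z x = 0" if "x \<in> {s..t}" for x
  proof (rule linear_differential_inequality_zero[OF S _ der _ _ _ that, where B = "\<bar>B\<bar> + 1"])
    show "continuous_on {s..t} z"
      using P unfolding pruefer_angle_def z_def by (auto intro!: continuous_intros)
    fix x assume x: "x \<in> {s<..<t} - S"
    have "(sin (\<theta> x))\<^sup>2 \<le> \<bar>z x\<bar>"
      using sin_squared_diff_le[of "z x" 0] by (simp add: z_def sin_minus_pi_int_squared)
    then have "\<bar>q x - 1\<bar> * (sin (\<theta> x))\<^sup>2 \<le> (\<bar>B\<bar> + 1) * \<bar>z x\<bar>"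
      using B[OF x] by (intro mult_mono) auto
    moreover have "- (\<bar>q x - 1\<bar> * (sin (\<theta> x))\<^sup>2) \<le> (q x - 1) * (sin (\<theta> x))\<^sup>2"
      using mult_right_mono[of "- \<bar>q x - 1\<bar>" "q x - 1" "(sin (\<theta> x))\<^sup>2"] by simp
    ultimately show "- (\<bar>B\<bar> + 1) * \<bar>z x\<bar> \<le> (cos (\<theta> x))\<^sup>2 + q x * (sin (\<theta> x))\<^sup>2"
      by (simp add: cos_squared_eq algebra_simps)
  qed (use ge \<open>\<not> _\<close> in \<open>auto simp: z_def\<close>)
  obtain x where x: "x \<in> {s<..<t} - S" using open_interval_minus_finite_nonempty[OF st S] by blast
  have "(cos (\<theta> x))\<^sup>2 + q x * (sin (\<theta> x))\<^sup>2 = 0"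
    by (rule derivative_of_locally_zero[OF der[OF x], of s t 0]) (use x zero in auto)
  moreover have "(sin (\<theta> x))\<^sup>2 = 0"
    using zero[of x] x sin_minus_pi_int_squared[of "\<theta> x" j] by (simp add: z_def)
  ultimately show False by (simp add: cos_squared_eq)
qed

text \<open>Sturm comparison with its rigidity part. The derivative of the difference consists of a
  term of Lipschitz type and the nonnegative term (q2 - q1) sin^2 theta1, so equality at the right
  end forces equality throughout.\<close>

lemma pruefer_angle_mono:
  assumes S: "finite S" and 1: "pruefer_angle S s t q1 \<theta>1" and 2: "pruefer_angle S s t q2 \<theta>2"
    and B: "\<And>x. x \<in> {s<..<t} - S \<Longrightarrow> \<bar>q2 x\<bar> \<le> B"
    and le: "\<And>x. x \<in> {s<..<t} - S \<Longrightarrow> q1 x \<le> q2 x" and init: "\<theta>1 s \<le> \<theta>2 s"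
  shows "s \<le> t \<Longrightarrow> \<theta>1 t \<le> \<theta>2 t"
    and "\<theta>2 t \<le> \<theta>1 t \<Longrightarrow> x \<in> {s..t} \<Longrightarrow> \<theta>1 x = \<theta>2 x"
proof -
  define z where "z x = \<theta>2 x - \<theta>1 x" for x
  let ?z' = "\<lambda>x. ((cos (\<theta>2 x))\<^sup>2 + q2 x * (sin (\<theta>2 x))\<^sup>2) - ((cos (\<theta>1 x))\<^sup>2 + q1 x * (sin (\<theta>1 x))\<^sup>2)"
  have der: "(z has_real_derivative ?z' x) (at x)" if "x \<in> {s<..<t} - S" for x
    using 1 2 that unfolding pruefer_angle_def z_def by (auto intro!: DERIV_diff)
  have cont: "continuous_on {s..t} z"
    using 1 2 unfolding pruefer_angle_def z_def by (auto intro!: continuous_intros)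
  have ge: "- (\<bar>B\<bar> + 1) * \<bar>z x\<bar> \<le> ?z' x" if x: "x \<in> {s<..<t} - S" for x
  proof -
    have "\<bar>(q2 x - 1) * ((sin (\<theta>2 x))\<^sup>2 - (sin (\<theta>1 x))\<^sup>2)\<bar> \<le> (\<bar>B\<bar> + 1) * \<bar>z x\<bar>"
      unfolding abs_mult z_def using B[OF x] by (intro mult_mono sin_squared_diff_le) auto
    moreover have "0 \<le> (q2 x - q1 x) * (sin (\<theta>1 x))\<^sup>2" using le[OF x] by simp
    ultimately show ?thesis unfolding pruefer_rhs_diff by linarith
  qed
  have init': "0 \<le> z s" using init by (simp add: z_def)
  show "\<theta>1 t \<le> \<theta>2 t" if "s \<le> t"
    using linear_differential_inequality_nonneg[OF S that cont der ge init'] by (simp add: z_def)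
  show "\<theta>1 x = \<theta>2 x" if "\<theta>2 t \<le> \<theta>1 t" "x \<in> {s..t}"
    using linear_differential_inequality_zero[OF S cont der ge init' _ that(2)] that(1) by (simp add: z_def)
qed

text \<open>Subtracting the two equations gives (q1 - q2) sin^2 theta = 0. Potentials that differ at
  a point differ on an interval by continuity; theta would rest at a multiple of pi there, where its
  speed is 1.\<close>

lemma pruefer_angle_eq_imp_potential_eq:
  assumes S: "finite S" and 1: "pruefer_angle S s t q1 \<theta>" and 2: "pruefer_angle S s t q2 \<theta>"
    and c: "continuous_on ({s<..<t} - S) q1" "continuous_on ({s<..<t} - S) q2"
    and x: "x \<in> {s<..<t} - S"
  shows "q1 x = q2 x"
proof (rule ccontr)
  assume ne: "q1 x \<noteq> q2 x"
  have eq: "(q1 y - q2 y) * (sin (\<theta> y))\<^sup>2 = 0" if "y \<in> {s<..<t} - S" for y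
    using 1 2 that DERIV_unique unfolding pruefer_angle_def by (fastforce simp: algebra_simps)
  have op: "open ({s<..<t} - S)" using S by (intro open_Diff finite_imp_closed) auto
  have "continuous_on ({s<..<t} - S) (\<lambda>y. q1 y - q2 y)" by (intro continuous_intros c)
  then have "open (({s<..<t} - S) \<inter> (\<lambda>y. q1 y - q2 y) -` (- {0}))"
    by (rule continuous_open_preimage[OF _ op]) auto
  moreover have "x \<in> ({s<..<t} - S) \<inter> (\<lambda>y. q1 y - q2 y) -` (- {0})" using x ne by auto
  ultimately obtain e where e: "e > 0" "ball x e \<subseteq> ({s<..<t} - S) \<inter> (\<lambda>y. q1 y - q2 y) -` (- {0})"
    by (meson open_contains_ball_eq)
  let ?I = "{x - e<..<x + e}"
  have I: "y \<in> {s<..<t} - S" "sin (\<theta> y) = 0" if "y \<in> ?I" for y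
  proof -
    have "y \<in> ball x e" using that by (auto simp: dist_real_def)
    then show "y \<in> {s<..<t} - S" using e by auto
    with \<open>y \<in> ball x e\<close> show "sin (\<theta> y) = 0" using e eq[of y] by auto
  qed
  have der: "((\<lambda>y. sin (\<theta> y)) has_real_derivative cos (\<theta> x) * ((cos (\<theta> x))\<^sup>2 + q1 x * (sin (\<theta> x))\<^sup>2)) (at x)"
    using 1 x unfolding pruefer_angle_def by (auto intro!: derivative_eq_intros)
  have "cos (\<theta> x) * ((cos (\<theta> x))\<^sup>2 + q1 x * (sin (\<theta> x))\<^sup>2) = 0"
    by (rule derivative_of_locally_zero[OF der, of "x - e" "x + e" 0]) (use e I in auto)
  moreover have "sin (\<theta> x) = 0" using I(2)[of x] e by auto
  ultimately show False using sin_cos_squared_add[of "\<theta> x"] by auto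
qed

text \<open>The quantity w = u cos theta - v sin theta measures the failure of (v, u) to be parallel
  to (cos theta, sin theta). It solves a homogeneous linear equation, so it stays 0 if it starts at
  0.\<close>

lemma pruefer_polar:
  assumes S: "finite S" and L: "linear_ode S s t q u v" and P: "pruefer_angle S s t q \<theta>"
    and B: "\<And>x. x \<in> {s<..<t} - S \<Longrightarrow> \<bar>q x\<bar> \<le> B" and x: "x \<in> {s..t}"
    and init: "u s * cos (\<theta> s) = v s * sin (\<theta> s)"
  shows "u x * cos (\<theta> x) = v x * sin (\<theta> x)"
proof -
  define w where "w x = u x * cos (\<theta> x) - v x * sin (\<theta> x)" for x
  \<comment> \<open>Vanishing of w is obtained as nonnegativity of - w^2, to which the one-sided
    inequality applies.\<close>
  define z where "z x = - (w x)\<^sup>2" for x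
  let ?z' = "\<lambda>x. 2 * (1 - q x) * sin (\<theta> x) * cos (\<theta> x) * (w x)\<^sup>2"
  have derw: "(w has_real_derivative - (1 - q x) * sin (\<theta> x) * cos (\<theta> x) * w x) (at x)"
    if x: "x \<in> {s<..<t} - S" for x
  proof -
    let ?s = "sin (\<theta> x)" and ?c = "cos (\<theta> x)"
    let ?d = "?c\<^sup>2 + q x * ?s\<^sup>2"
    have d: "(w has_real_derivative
      (v x * ?c + - ?s * ?d * u x) - ((- q x * u x) * ?s + ?c * ?d * v x)) (at x)"
      using L P x unfolding linear_ode_def pruefer_angle_def w_def
      by (auto intro!: derivative_eq_intros)
    have c2: "?c\<^sup>2 = 1 - ?s\<^sup>2" by (rule cos_squared_eq)
    have "(v x * ?c + - ?s * ?d * u x) - ((- q x * u x) * ?s + ?c * ?d * v x)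
      = v x * ?c * (1 - ?d) + u x * ?s * (q x - ?d)" by (simp add: algebra_simps)
    also have "1 - ?d = (1 - q x) * ?s\<^sup>2" by (simp add: c2 algebra_simps)
    also have "q x - ?d = - (1 - q x) * ?c\<^sup>2" by (simp add: c2 algebra_simps)
    finally show ?thesis using d by (simp add: w_def power2_eq_square algebra_simps)
  qed
  have "0 \<le> z x"
  proof (rule linear_differential_inequality_nonneg[where z = z and z' = ?z' and S = S and B = "2 * (\<bar>B\<bar> + 1)"])
    show "s \<le> x" using x by simp
    show "continuous_on {s..x} z"
      unfolding z_def w_def using L P x unfolding linear_ode_def pruefer_angle_def
      by (auto intro!: continuous_intros elim: continuous_on_subset)
    fix y assume y: "y \<in> {s<..<x} - S"
    then have y': "y \<in> {s<..<t} - S" using x by auto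
    show "(z has_real_derivative ?z' y) (at y)"
      unfolding z_def by (rule derivative_eq_intros derw[OF y'] refl | simp add: power2_eq_square algebra_simps)+
    have "\<bar>?z' y\<bar> = 2 * (\<bar>1 - q y\<bar> * \<bar>sin (\<theta> y) * cos (\<theta> y)\<bar>) * \<bar>z y\<bar>"
      by (simp only: abs_mult z_def abs_minus_cancel abs_power2 abs_numeral mult.assoc)
    also have "\<dots> \<le> 2 * ((\<bar>B\<bar> + 1) * 1) * \<bar>z y\<bar>"
    proof (intro mult_mono mult_left_mono)
      show "\<bar>sin (\<theta> y) * cos (\<theta> y)\<bar> \<le> 1"
        using mult_mono[of "\<bar>sin (\<theta> y)\<bar>" 1 "\<bar>cos (\<theta> y)\<bar>" 1] by (simp add: abs_mult)
    qed (use B[OF y'] in auto)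
    finally have "\<bar>?z' y\<bar> \<le> 2 * ((\<bar>B\<bar> + 1) * 1) * \<bar>z y\<bar>" .
    then show "- (2 * (\<bar>B\<bar> + 1)) * \<bar>z y\<bar> \<le> ?z' y"
      unfolding minus_mult_left[symmetric] mult_1_right by linarith
  qed (use S init in \<open>auto simp: z_def w_def\<close>)
  then show ?thesis by (simp add: z_def w_def)
qed

text \<open>Uniqueness of the zero solution in both directions of time: the energy z = u^2 + v^2
  satisfies |z'| \<le> (|B| + 1) z. Before \<open>y\<close> it is squeezed to 0 by its zero at
  \<open>y\<close>; after \<open>y\<close> the inequality is applied to - z.\<close>

lemma linear_ode_vanishing:
  assumes S: "finite S" and L: "linear_ode S s t q u v"
    and B: "\<And>x. x \<in> {s<..<t} - S \<Longrightarrow> \<bar>q x\<bar> \<le> B"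
    and y: "y \<in> {s..t}" "u y = 0" "v y = 0" and x: "x \<in> {s..t}"
  shows "u x = 0 \<and> v x = 0"
proof -
  define z where "z x = (u x)\<^sup>2 + (v x)\<^sup>2" for x
  let ?z' = "\<lambda>x. 2 * (1 - q x) * u x * v x"
  have cont: "continuous_on {s..t} z"
    using L unfolding z_def linear_ode_def by (auto intro!: continuous_intros)
  have der: "(z has_real_derivative ?z' x) (at x)" if "x \<in> {s<..<t} - S" for x
  proof -
    have "(u has_real_derivative v x) (at x)" "(v has_real_derivative - q x * u x) (at x)"
      using L that by (auto simp: linear_ode_def)
    then show ?thesis unfolding z_def
      by (auto intro!: derivative_eq_intros simp: algebra_simps)
  qed
  have bd: "\<bar>?z' x\<bar> \<le> (\<bar>B\<bar> + 1) * \<bar>z x\<bar>" if "x \<in> {s<..<t} - S" for x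
  proof -
    have "\<bar>?z' x\<bar> = \<bar>1 - q x\<bar> * (2 * \<bar>u x\<bar> * \<bar>v x\<bar>)"
      by (simp only: abs_mult) 
    also have "\<dots> \<le> (\<bar>B\<bar> + 1) * z x"
    proof (rule mult_mono)
      show "2 * \<bar>u x\<bar> * \<bar>v x\<bar> \<le> z x"
        using sum_squares_bound[of "\<bar>u x\<bar>" "\<bar>v x\<bar>"] by (simp add: z_def)
    qed (use B[OF that] in auto)
    finally show ?thesis by (simp add: z_def)
  qed
  have bd': "- (\<bar>B\<bar> + 1) * \<bar>z x\<bar> \<le> ?z' x" "- (\<bar>B\<bar> + 1) * \<bar>- z x\<bar> \<le> - ?z' x"
    if "x \<in> {s<..<t} - S" for x
    using bd[OF that] unfolding minus_mult_left[symmetric] abs_minus_cancel by linarith+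
  have "z x = 0"
  proof (cases "x \<le> y")
    case True
    show ?thesis
    proof (rule linear_differential_inequality_zero[where z = z and z' = ?z' and S = S and s = x and t = y and B = "\<bar>B\<bar> + 1"])
      show "continuous_on {x..y} z" by (rule continuous_on_subset[OF cont]) (use x y in auto)
      show "(z has_real_derivative ?z' a) (at a)" "- (\<bar>B\<bar> + 1) * \<bar>z a\<bar> \<le> ?z' a"
        if "a \<in> {x<..<y} - S" for a 
      proof -
        have "a \<in> {s<..<t} - S" using that x y by auto
        then show "(z has_real_derivative ?z' a) (at a)" "- (\<bar>B\<bar> + 1) * \<bar>z a\<bar> \<le> ?z' a"
          using der bd' by blast+
      qed
    qed (use S x y True in \<open>auto simp: z_def\<close>)
  next
    case False
    have "0 \<le> - z x"
    proof (rule linear_differential_inequality_nonneg[where z = "\<lambda>x. - z x" and z' = "\<lambda>x. - ?z' x" and S = S and s = y and t = x and B = "\<bar>B\<bar> + 1"])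
      show "continuous_on {y..x} (\<lambda>x. - z x)"
        by (intro continuous_intros continuous_on_subset[OF cont]) (use x y in auto)
      show "((\<lambda>x. - z x) has_real_derivative - ?z' a) (at a)" "- (\<bar>B\<bar> + 1) * \<bar>- z a\<bar> \<le> - ?z' a"
        if "a \<in> {y<..<x} - S" for a 
      proof -
        have "a \<in> {s<..<t} - S" using that x y by auto
        then show "((\<lambda>x. - z x) has_real_derivative - ?z' a) (at a)" "- (\<bar>B\<bar> + 1) * \<bar>- z a\<bar> \<le> - ?z' a"
          using DERIV_minus[OF der] bd' by blast+
      qed
    qed (use S x y False in \<open>auto simp: z_def\<close>)
    moreover have "0 \<le> z x" by (simp add: z_def)
    ultimately show ?thesis by linarith
  qed
  then show ?thesis unfolding z_def sum_power2_eq_zero_iff .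
qed

lemma polar_representation:
  fixes u v \<theta> :: real
  assumes "u * cos \<theta> = v * sin \<theta>"
  shows "u = (u * sin \<theta> + v * cos \<theta>) * sin \<theta>" "v = (u * sin \<theta> + v * cos \<theta>) * cos \<theta>"
proof -
  have "(u * sin \<theta> + v * cos \<theta>) * sin \<theta> = u * (sin \<theta>)\<^sup>2 + (v * sin \<theta>) * cos \<theta>"
    by (simp add: power2_eq_square algebra_simps)
  also have "\<dots> = u * ((sin \<theta>)\<^sup>2 + (cos \<theta>)\<^sup>2)"
    unfolding assms[symmetric] by (simp only: distrib_left power2_eq_square mult.assoc)
  finally show "u = (u * sin \<theta> + v * cos \<theta>) * sin \<theta>" by simp
  have "(u * sin \<theta> + v * cos \<theta>) * cos \<theta> = (u * cos \<theta>) * sin \<theta> + v * (cos \<theta>)\<^sup>2"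
    by (simp add: power2_eq_square algebra_simps)
  also have "\<dots> = v * ((sin \<theta>)\<^sup>2 + (cos \<theta>)\<^sup>2)"
    unfolding assms by (simp only: distrib_left power2_eq_square mult.assoc)
  finally show "v = (u * sin \<theta> + v * cos \<theta>) * cos \<theta>" by simp
qed

text \<open>The range is half open: the indices are 0, ..., 2k - 1 for the phase 0 and 1, ..., 2k
  for the phase pi/2. For the phase 0 the excluded end is the zero that a periodic solution repeats
  after one period.\<close>

lemma card_multiples_of_pi:
  fixes \<phi> :: real
  assumes "\<phi> = 0 \<or> \<phi> = pi / 2"
  shows "card {j::int. \<phi> \<le> of_int j * pi \<and> of_int j * pi < \<phi> + 2 * real k * pi} = 2 * k"
proof -
  consider "\<phi> = 0" | "\<phi> = pi / 2" using assms by blast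
  then show ?thesis
  proof cases
    case 1
    have "{j::int. \<phi> \<le> of_int j * pi \<and> of_int j * pi < \<phi> + 2 * real k * pi} = {0..<2 * int k}"
    proof safe
      fix j :: int
      assume "\<phi> \<le> of_int j * pi" "of_int j * pi < \<phi> + 2 * real k * pi"
      then have "0 * pi \<le> of_int j * pi" "of_int j * pi < (2 * real k) * pi" using 1 by auto
      then have "0 \<le> real_of_int j" "real_of_int j < 2 * real k"
        by (blast intro: mult_right_le_imp_le[OF _ pi_gt_zero] mult_right_less_imp_less[OF _ pi_ge_zero])+
      then show "j \<in> {0..<2 * int k}" by auto
    next
      fix j :: int
      assume j: "j \<in> {0..<2 * int k}"
      then show "\<phi> \<le> of_int j * pi" using 1 by auto
      have "real_of_int j < 2 * real k" using j by auto
      then show "of_int j * pi < \<phi> + 2 * real k * pi" using 1 by simp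
    qed
    then show ?thesis by simp
  next
    case 2
    have "{j::int. \<phi> \<le> of_int j * pi \<and> of_int j * pi < \<phi> + 2 * real k * pi} = {1..2 * int k}"
    proof safe
      fix j :: int
      assume "\<phi> \<le> of_int j * pi" "of_int j * pi < \<phi> + 2 * real k * pi"
      then have "1/2 * pi \<le> of_int j * pi" "of_int j * pi < (1/2 + 2 * real k) * pi"
        using 2 by (auto simp: algebra_simps)
      then have "1/2 \<le> real_of_int j" "real_of_int j < 1/2 + 2 * real k"
        by (blast intro: mult_right_le_imp_le[OF _ pi_gt_zero] mult_right_less_imp_less[OF _ pi_ge_zero])+
      then show "j \<in> {1..2 * int k}" by (auto; linarith)
    next
      fix j :: int
      assume j: "j \<in> {1..2 * int k}"
      then have "1 \<le> real_of_int j" "real_of_int j \<le> 2 * real k" by auto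
      then have "1 * pi \<le> of_int j * pi" "of_int j * pi \<le> 2 * real k * pi" by (auto intro!: mult_right_mono)
      then show "\<phi> \<le> of_int j * pi" "of_int j * pi < \<phi> + 2 * real k * pi" using 2 pi_gt_zero by linarith+
    qed
    then show ?thesis by simp
  qed
qed

text \<open>The angle crosses multiples of pi upwards only, so each one in the half-open range from
  \<open>\<theta> 0\<close> to \<open>\<theta> b\<close> is attained exactly once. Zeros of the sine
  thus correspond one to one to these multiples.\<close>

lemma card_pruefer_zeros:
  assumes S: "finite S" and P: "pruefer_angle S 0 b q \<theta>" and b: "0 < b"
    and B: "\<And>x. x \<in> {0<..<b} - S \<Longrightarrow> \<bar>q x\<bar> \<le> B"
    and \<phi>: "\<theta> 0 = 0 \<or> \<theta> 0 = pi / 2" and fin: "\<theta> b = \<theta> 0 + 2 * real k * pi"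
  shows "card {x \<in> {0..<b}. sin (\<theta> x) = 0} = 2 * k"
proof -
  let ?J = "{j::int. \<theta> 0 \<le> of_int j * pi \<and> of_int j * pi < \<theta> 0 + 2 * real k * pi}"
  let ?Z = "{x \<in> {0..<b}. sin (\<theta> x) = 0}"
  have cross: "of_int j * pi < \<theta> t" if "0 \<le> s" "s < t" "t \<le> b" "of_int j * pi \<le> \<theta> s" for s t j
    by (rule pruefer_angle_crossing[OF S pruefer_angle_subset[OF P] B _ that(4)]) (use that in auto)
  have ex: "\<exists>x. x \<in> {0..<b} \<and> \<theta> x = of_int j * pi" if j: "j \<in> ?J" for j :: int
  proof -
    have "\<exists>x\<ge>0. x \<le> b \<and> \<theta> x = of_int j * pi"
      by (rule IVT') (use j fin b P in \<open>auto simp: pruefer_angle_def\<close>)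
    then obtain x where x: "0 \<le> x" "x \<le> b" "\<theta> x = of_int j * pi" by blast
    then have "x \<noteq> b" using j fin by auto
    then show ?thesis using x by force
  qed
  define g where "g j = (SOME x. x \<in> {0..<b} \<and> \<theta> x = of_int j * pi)" for j :: int
  have g: "g j \<in> {0..<b} \<and> \<theta> (g j) = of_int j * pi" if "j \<in> ?J" for j
    unfolding g_def by (rule someI_ex[OF ex[OF that]])
  have inj: "inj_on g ?J"
  proof (rule inj_onI)
    fix i j assume ij: "i \<in> ?J" "j \<in> ?J" "g i = g j"
    have "real_of_int i * pi = \<theta> (g i)" using g[OF ij(1)] by metis
    also have "\<dots> = of_int j * pi" using g[OF ij(2)] ij(3) by metis
    finally show "i = j" by simp
  qed
  have "g ` ?J = ?Z"
  proof (intro equalityI subsetI)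
    fix x assume "x \<in> g ` ?J"
    then obtain j where "j \<in> ?J" "x = g j" by blast
    with g[of j] have "x \<in> {0..<b}" "\<theta> x = of_int j * pi" by blast+
    then show "x \<in> ?Z" by (auto simp: sin_zero_iff_int2)
  next
    fix x assume x: "x \<in> ?Z"
    then obtain j :: int where j: "\<theta> x = of_int j * pi" by (auto simp: sin_zero_iff_int2)
    have "of_int j * pi < \<theta> b" using cross[of x b j] x j by auto
    \<comment> \<open>A multiple of pi attained later cannot lie below the start: the angle is
      positive after 0, so such a multiple would be at least pi, whereas the start is at most
      pi/2.\<close>
    moreover have "\<theta> 0 \<le> of_int j * pi"
    proof (rule ccontr)
      assume "\<not> \<theta> 0 \<le> of_int j * pi"
      then have lt: "of_int j * pi < \<theta> 0" by simp
      have "x \<noteq> 0" using lt j by auto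
      moreover have "0 \<le> \<theta> 0" using \<phi> pi_gt_zero by (elim disjE) linarith+
      ultimately have "of_int 0 * pi < \<theta> x" using cross[of 0 x 0] x by auto
      then have "0 < j" using j by (simp add: zero_less_mult_iff)
      then have "1 * pi \<le> of_int j * pi" by (intro mult_right_mono) auto
      with \<phi> show False using lt pi_gt_zero by (elim disjE) linarith+
    qed
    ultimately have jJ: "j \<in> ?J" using fin by auto
    have "g j = x"
    proof (rule ccontr)
      assume "g j \<noteq> x"
      then consider "g j < x" | "x < g j" by linarith
      moreover have "0 \<le> g j" "g j < b" "\<theta> (g j) = of_int j * pi" "0 \<le> x" "x < b"
        using g[OF jJ] x by auto
      ultimately show False using cross[of "g j" x j] cross[of x "g j" j] j by cases linarith+
    qed
    then show "x \<in> g ` ?J" using jJ by blast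
  qed
  then have "card ?Z = card ?J" using card_image[OF inj] by simp
  then show ?thesis using card_multiples_of_pi[OF \<phi>] by simp
qed

text \<open>This is the angle of the solution u = sin phi, v = omega cos phi. Its tangent is tan phi
  / omega, and the addition formula turns tan (theta - phi) into the quotient under
  \<open>arctan\<close>. The denominator is always positive, so a single formula is smooth for all
  times, with no change of branch.\<close>

lemma pruefer_angle_constant_potential:
  fixes \<omega> \<phi>0 :: real
  assumes \<omega>: "0 < \<omega>"
  defines "\<phi> \<equiv> \<lambda>t. \<phi>0 + \<omega> * t"
  defines "\<theta> \<equiv> \<lambda>t. \<phi> t + arctan ((1 - \<omega>) * sin (\<phi> t) * cos (\<phi> t) / (\<omega> * (cos (\<phi> t))\<^sup>2 + (sin (\<phi> t))\<^sup>2))"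
  shows "(\<theta> has_real_derivative (cos (\<theta> t))\<^sup>2 + \<omega>\<^sup>2 * (sin (\<theta> t))\<^sup>2) (at t)"
proof -
  let ?s = "\<lambda>t. sin (\<phi> t)" and ?c = "\<lambda>t. cos (\<phi> t)"
  define N where "N t = (1 - \<omega>) * ?s t * ?c t" for t
  define D where "D t = \<omega> * (?c t)\<^sup>2 + (?s t)\<^sup>2" for t
  define N' where "N' = (1 - \<omega>) * \<omega> * ((?c t)\<^sup>2 - (?s t)\<^sup>2)"
  define D' where "D' = 2 * (1 - \<omega>) * \<omega> * ?s t * ?c t"
  have sc: "(?c t)\<^sup>2 = 1 - (?s t)\<^sup>2" for t by (rule cos_squared_eq)
  have Dpos: "0 < D t" for t
  proof (cases "?c t = 0")
    case True then show ?thesis using sc[of t] by (simp add: D_def)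
  next
    case False then show ?thesis using \<omega> by (simp add: D_def add_pos_nonneg)
  qed
  have d\<phi>: "(\<phi> has_real_derivative \<omega>) (at t)" unfolding \<phi>_def by (auto intro!: derivative_eq_intros)
  have dN: "(N has_real_derivative N') (at t)"
    unfolding N_def N'_def
    by (rule derivative_eq_intros d\<phi> refl | simp add: power2_eq_square algebra_simps)+
  have dD: "(D has_real_derivative D') (at t)"
    unfolding D_def D'_def
    by (rule derivative_eq_intros d\<phi> refl | simp add: power2_eq_square algebra_simps)+
  define x where "x = N t / D t"
  have dx: "((\<lambda>t. N t / D t) has_real_derivative (N' * D t - N t * D') / (D t * D t)) (at t)"
    by (rule DERIV_divide[OF dN dD]) (use Dpos[of t] in simp)
  have dth: "(\<theta> has_real_derivative \<omega> + inverse (1 + x\<^sup>2) * ((N' * D t - N t * D') / (D t * D t))) (at t)"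
    unfolding \<theta>_def N_def[symmetric] D_def[symmetric] x_def
    by (rule DERIV_add[OF d\<phi> DERIV_chain2[OF DERIV_arctan dx]])
  have sc1: "(?c t)\<^sup>2 + (?s t)\<^sup>2 = 1" by simp
  \<comment> \<open>The two identities say that turning the vector (D, N) by phi gives (omega cos
    phi, sin phi); hence cos theta and sin theta are these entries divided by sqrt (D^2 +
    N^2).\<close>
  have r1: "?c t * D t - ?s t * N t = \<omega> * ?c t"
    unfolding D_def N_def using sc1 by algebra
  have r2: "?s t * D t + ?c t * N t = ?s t"
    unfolding D_def N_def using sc1 by algebra
  have ND: "(D t)\<^sup>2 + (N t)\<^sup>2 = \<omega>\<^sup>2 * (?c t)\<^sup>2 + (?s t)\<^sup>2"
    using r1 r2 sc1 by algebra
  have W: "N' * D t - N t * D' = \<omega> * ((1 - \<omega>) * (\<omega> * (?c t)\<^sup>2 - (?s t)\<^sup>2))"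
    unfolding N'_def D'_def N_def D_def using sc1 by algebra
  have D0: "D t \<noteq> 0" using Dpos[of t] by simp
  have pos: "(D t)\<^sup>2 + (N t)\<^sup>2 > 0" using D0 by (simp add: sum_power2_gt_zero_iff)
  have E0: "(D t)\<^sup>2 + (N t)\<^sup>2 \<noteq> 0" using pos by linarith
  have sq: "(p / D t)\<^sup>2 / (1 + x\<^sup>2) = p\<^sup>2 / ((D t)\<^sup>2 + (N t)\<^sup>2)" if "1 + x\<^sup>2 = ((D t)\<^sup>2 + (N t)\<^sup>2) / (D t)\<^sup>2" for p
    unfolding that power_divide using D0 by simp
  have r: "0 < 1 + x\<^sup>2" by (rule add_pos_nonneg) auto
  have x2: "1 + x\<^sup>2 = ((D t)\<^sup>2 + (N t)\<^sup>2) / (D t)\<^sup>2" using D0 by (simp add: x_def power_divide field_simps)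
  have "\<omega> + inverse (1 + x\<^sup>2) * ((N' * D t - N t * D') / (D t * D t))
    = \<omega> + (N' * D t - N t * D') / ((D t)\<^sup>2 + (N t)\<^sup>2)"
    unfolding x2 using D0 by (simp add: power2_eq_square)
  also have "\<dots> = (\<omega> * ((D t)\<^sup>2 + (N t)\<^sup>2) + (N' * D t - N t * D')) / ((D t)\<^sup>2 + (N t)\<^sup>2)"
    unfolding add_divide_distrib using E0 by simp
  also have "\<omega> * ((D t)\<^sup>2 + (N t)\<^sup>2) + (N' * D t - N t * D') = \<omega>\<^sup>2"
    unfolding ND W using sc1 by algebra
  finally have 1: "\<omega> + inverse (1 + x\<^sup>2) * ((N' * D t - N t * D') / (D t * D t)) = \<omega>\<^sup>2 / ((D t)\<^sup>2 + (N t)\<^sup>2)" .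
  have th: "\<theta> t = \<phi> t + arctan x" by (simp add: \<theta>_def x_def N_def D_def)
  have "cos (\<theta> t) = (?c t - ?s t * x) / sqrt (1 + x\<^sup>2)"
    unfolding th cos_add cos_arctan sin_arctan by (simp add: diff_divide_distrib)
  also have "?c t - ?s t * x = (?c t * D t - ?s t * N t) / D t"
    unfolding x_def using D0 by (simp add: diff_divide_distrib)
  finally have e: "cos (\<theta> t) = (\<omega> * ?c t / D t) / sqrt (1 + x\<^sup>2)" unfolding r1 .
  have "(cos (\<theta> t))\<^sup>2 = (\<omega> * ?c t / D t)\<^sup>2 / (1 + x\<^sup>2)"
    unfolding e power_divide[of _ "sqrt (1 + x\<^sup>2)"] using r by simp
  then have c: "(cos (\<theta> t))\<^sup>2 = \<omega>\<^sup>2 * (?c t)\<^sup>2 / ((D t)\<^sup>2 + (N t)\<^sup>2)"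
    unfolding sq[OF x2] by (simp add: power_mult_distrib)
  have "sin (\<theta> t) = (?s t + ?c t * x) / sqrt (1 + x\<^sup>2)"
    unfolding th sin_add cos_arctan sin_arctan by (simp add: add_divide_distrib)
  also have "?s t + ?c t * x = (?s t * D t + ?c t * N t) / D t"
    unfolding x_def using D0 by (simp add: add_divide_distrib)
  finally have e: "sin (\<theta> t) = (?s t / D t) / sqrt (1 + x\<^sup>2)" unfolding r2 .
  have "(sin (\<theta> t))\<^sup>2 = (?s t / D t)\<^sup>2 / (1 + x\<^sup>2)"
    unfolding e power_divide[of _ "sqrt (1 + x\<^sup>2)"] using r by simp
  then have s: "(sin (\<theta> t))\<^sup>2 = (?s t)\<^sup>2 / ((D t)\<^sup>2 + (N t)\<^sup>2)"
    unfolding sq[OF x2] .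
  have "(cos (\<theta> t))\<^sup>2 + \<omega>\<^sup>2 * (sin (\<theta> t))\<^sup>2 = \<omega>\<^sup>2 * ((?c t)\<^sup>2 + (?s t)\<^sup>2) / ((D t)\<^sup>2 + (N t)\<^sup>2)"
    unfolding c s times_divide_eq_right add_divide_distrib[symmetric] distrib_left ..
  also have "\<dots> = \<omega>\<^sup>2 / ((D t)\<^sup>2 + (N t)\<^sup>2)" by simp
  finally show ?thesis using dth unfolding 1 by simp
qed

text \<open>After an advance of k pi the product sin cos is the same as at the start, namely 0 for
  both phases. The \<open>arctan\<close> correction therefore vanishes at both ends, and theta
  advances by exactly omega b.\<close>

lemma pruefer_angle_constant_potential_end:
  assumes S: "finite S" and \<omega>: "0 < \<omega>" and b: "\<omega> * b = real k * pi" "0 \<le> b"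
    and \<phi>: "\<phi> = 0 \<or> \<phi> = pi / 2"
    and P: "pruefer_angle S 0 b (\<lambda>_. \<omega>\<^sup>2) \<theta>" and init: "\<theta> 0 = \<phi>"
  shows "\<theta> b = \<phi> + real k * pi"
proof -
  define \<psi> where "\<psi> t = \<phi> + \<omega> * t" for t
  let ?\<theta> = "\<lambda>t. \<psi> t + arctan ((1 - \<omega>) * sin (\<psi> t) * cos (\<psi> t) / (\<omega> * (cos (\<psi> t))\<^sup>2 + (sin (\<psi> t))\<^sup>2))"
  have d: "(?\<theta> has_real_derivative (cos (?\<theta> t))\<^sup>2 + \<omega>\<^sup>2 * (sin (?\<theta> t))\<^sup>2) (at t)" for t
    using pruefer_angle_constant_potential[OF \<omega>, of \<phi> t] by (simp add: \<psi>_def)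
  then have P': "pruefer_angle S 0 b (\<lambda>_. \<omega>\<^sup>2) ?\<theta>"
    unfolding pruefer_angle_def using DERIV_isCont by (blast intro: continuous_at_imp_continuous_on)
  have sc: "sin \<phi> * cos \<phi> = 0" by (rule disjE[OF \<phi>]; erule ssubst; simp)
  have "sin (\<psi> b) * cos (\<psi> b) = sin (2 * \<psi> b) / 2" by (simp add: sin_double)
  also have "2 * \<psi> b = 2 * \<phi> + 2 * real k * pi" using b by (simp add: \<psi>_def algebra_simps)
  also have "sin \<dots> = sin (2 * \<phi>)" unfolding sin_add sin_2npi cos_2npi by simp
  finally have sc': "sin (\<psi> b) * cos (\<psi> b) = 0" using sc by (simp add: sin_double)
  have "\<theta> b = ?\<theta> b"
    by (rule pruefer_angle_unique[OF S P P', where B = "\<omega>\<^sup>2"]) (use init sc b in \<open>auto simp: \<psi>_def\<close>)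
  also have "\<dots> = \<psi> b" using sc' by (simp add: mult.assoc)
  finally show ?thesis using b by (simp add: \<psi>_def)
qed

section \<open>The truncated shooting problem\<close>

lemma linear_ode_cong:
  assumes "linear_ode S s t q u v" and "\<And>x. x \<in> {s<..<t} - S \<Longrightarrow> q x = q' x"
  shows "linear_ode S s t q' u v"
  using assms unfolding linear_ode_def by auto

lemma pruefer_angle_cong:
  assumes "pruefer_angle S s t q \<theta>" and "\<And>x. x \<in> {s<..<t} - S \<Longrightarrow> q x = q' x"
  shows "pruefer_angle S s t q' \<theta>"
  using assms unfolding pruefer_angle_def by auto

text \<open>The cube u^3 is replaced by u times this truncated square. The product is globally
  Lipschitz, so shots exist on the whole interval, and the equation keeps the form u'' = - q u with
  q still bounded below by the parameter.\<close>

definition trunc_square :: "real \<Rightarrow> real \<Rightarrow> real" where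
  "trunc_square R u = (min \<bar>u\<bar> R)\<^sup>2"

lemma trunc_square_eq: "\<bar>u\<bar> \<le> R \<Longrightarrow> trunc_square R u = u\<^sup>2"
  by (simp add: trunc_square_def min_def)

lemma trunc_square_uminus [simp]: "trunc_square R (- u) = trunc_square R u"
  by (simp add: trunc_square_def)

lemma trunc_square_nonneg [simp]: "0 \<le> trunc_square R u"
  by (simp add: trunc_square_def)

lemma trunc_square_le: "0 \<le> R \<Longrightarrow> trunc_square R u \<le> R\<^sup>2"
  unfolding trunc_square_def by (intro power_mono) auto

lemma trunc_square_le_square: "0 \<le> R \<Longrightarrow> trunc_square R u \<le> u\<^sup>2"
  unfolding trunc_square_def by (metis abs_ge_zero min.bounded_iff min.cobounded1 power2_abs power_mono)

lemma continuous_on_trunc_square [continuous_intros]: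
  "continuous_on A f \<Longrightarrow> continuous_on A (\<lambda>x. trunc_square R (f x))"
  unfolding trunc_square_def by (intro continuous_intros)

lemma trunc_square_lipschitz:
  assumes "0 \<le> R"
  shows "\<bar>trunc_square R x - trunc_square R y\<bar> \<le> 2 * R * \<bar>x - y\<bar>"
proof -
  let ?a = "min \<bar>x\<bar> R" and ?b = "min \<bar>y\<bar> R"
  have "\<bar>trunc_square R x - trunc_square R y\<bar> = \<bar>?a + ?b\<bar> * \<bar>?a - ?b\<bar>"
    by (simp add: trunc_square_def power2_eq_square square_diff_square_factored flip: abs_mult)
  also have "\<dots> \<le> 2 * R * \<bar>x - y\<bar>"
    using assms by (intro mult_mono) (auto simp: min_def)
  finally show ?thesis .
qed

lemma mult_trunc_square_lipschitz:
  assumes "0 \<le> R"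
  shows "\<bar>x * trunc_square R x - y * trunc_square R y\<bar> \<le> 3 * R\<^sup>2 * \<bar>x - y\<bar>"
proof -
  \<comment> \<open>The constant 3 R^2 is R^2 from the truncated square plus 2 R times the factor
    |y| \<le> R. One argument inside [- R, R] suffices for this; when both lie outside, each is
    merely multiplied by R^2.\<close>
  have *: "\<bar>x * trunc_square R x - y * trunc_square R y\<bar> \<le> 3 * R\<^sup>2 * \<bar>x - y\<bar>" if "\<bar>y\<bar> \<le> R" for x y
  proof -
    have "x * trunc_square R x - y * trunc_square R y
        = (x - y) * trunc_square R x + y * (trunc_square R x - trunc_square R y)" by (simp add: algebra_simps)
    also have "\<bar>\<dots>\<bar> \<le> \<bar>x - y\<bar> * trunc_square R x + \<bar>y\<bar> * \<bar>trunc_square R x - trunc_square R y\<bar>"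
      by (rule order_trans[OF abs_triangle_ineq]) (simp add: abs_mult)
    also have "\<dots> \<le> \<bar>x - y\<bar> * R\<^sup>2 + R * (2 * R * \<bar>x - y\<bar>)"
      using that assms by (intro add_mono mult_mono trunc_square_lipschitz trunc_square_le) auto
    finally show ?thesis by (simp add: power2_eq_square algebra_simps)
  qed
  consider "\<bar>y\<bar> \<le> R" | "\<bar>x\<bar> \<le> R" | "R < \<bar>x\<bar>" "R < \<bar>y\<bar>" by linarith
  then show ?thesis
  proof cases
    case 1 then show ?thesis by (rule *)
  next
    case 2 then show ?thesis using *[of x y] by (simp add: abs_minus_commute)
  next
    case 3
    then have "trunc_square R x = R\<^sup>2" "trunc_square R y = R\<^sup>2" by (auto simp: trunc_square_def)
    then have "\<bar>x * trunc_square R x - y * trunc_square R y\<bar> = R\<^sup>2 * \<bar>x - y\<bar>"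
      by (simp flip: left_diff_distrib add: abs_mult)
    also have "\<dots> \<le> (3 * R\<^sup>2) * \<bar>x - y\<bar>" by (rule mult_right_mono) auto
    finally show ?thesis .
  qed
qed

lemma continuous_on_Icc_bounded:
  fixes u :: "real \<Rightarrow> real"
  assumes "continuous_on {s..t} u"
  obtains M where "0 \<le> M" "\<And>x. x \<in> {s..t} \<Longrightarrow> \<bar>u x\<bar> \<le> M"
proof -
  have "bounded (u ` {s..t})" by (intro compact_imp_bounded compact_continuous_image assms) auto
  then obtain M where M: "\<forall>y\<in>u ` {s..t}. norm y \<le> M" unfolding bounded_iff by blast
  show ?thesis
  proof (rule that[of "\<bar>M\<bar>"])
    show "\<bar>u x\<bar> \<le> \<bar>M\<bar>" if "x \<in> {s..t}" for x using M that by force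
  qed simp
qed

text \<open>The pointwise data extracted from (HLoc), (HGlob) and evenness. \<open>S\<close> is
  symmetric about T/2 so that reflected solutions have the same exceptional points; positivity of
  the weight is located in the left half because angles are compared on [0, T/2].\<close>

locale piecewise_weight =
  fixes T :: real and S :: "real set" and a :: "real \<Rightarrow> real" and Ca :: real
  assumes T_pos: "0 < T" and fin_S: "finite S"
    and S_reflect: "\<And>x. x \<in> S \<Longrightarrow> T - x \<in> S"
    and a_cont: "continuous_on ({0<..<T} - S) a"
    and a_nonneg: "\<And>x. x \<in> {0<..<T} - S \<Longrightarrow> 0 \<le> a x"
    and a_le: "\<And>x. x \<in> {0<..<T} - S \<Longrightarrow> a x \<le> Ca" and Ca_nonneg: "0 \<le> Ca"
    and a_reflect: "\<And>x. x \<in> {0<..<T} - S \<Longrightarrow> a (T - x) = a x"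
    and a_nontrivial: "\<exists>x\<in>{0<..<T/2} - S. 0 < a x"
begin

lemma reflect_image_S: "(\<lambda>x. T - x) ` S = S"
proof
  show "(\<lambda>x. T - x) ` S \<subseteq> S" using S_reflect by auto
  show "S \<subseteq> (\<lambda>x. T - x) ` S"
  proof
    fix x assume "x \<in> S"
    then show "x \<in> (\<lambda>x. T - x) ` S" by (intro image_eqI[of _ _ "T - x"] S_reflect) auto
  qed
qed

definition pot :: "real \<Rightarrow> real \<Rightarrow> (real \<Rightarrow> real) \<Rightarrow> real \<Rightarrow> real" where
  "pot R l u t = l + a t * trunc_square R (u t)"

lemma pot_cont:
  assumes "continuous_on {0..T} u"
  shows "continuous_on ({0<..<T} - S) (pot R l u)"
proof -
  have "continuous_on ({0<..<T} - S) u" by (rule continuous_on_subset[OF assms]) auto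
  then show ?thesis unfolding pot_def by (intro continuous_intros a_cont)
qed

lemma pot_bound:
  assumes "0 \<le> R" "x \<in> {0<..<T} - S"
  shows "\<bar>pot R l u x\<bar> \<le> \<bar>l\<bar> + Ca * R\<^sup>2" "l \<le> pot R l u x"
proof -
  have "0 \<le> a x * trunc_square R (u x)" using a_nonneg[OF assms(2)] by simp
  moreover have "a x * trunc_square R (u x) \<le> Ca * R\<^sup>2"
    using a_nonneg[OF assms(2)] a_le[OF assms(2)] assms(1) Ca_nonneg
    by (intro mult_mono trunc_square_le) auto
  ultimately show "\<bar>pot R l u x\<bar> \<le> \<bar>l\<bar> + Ca * R\<^sup>2" "l \<le> pot R l u x"
    by (auto simp: pot_def)
qed

lemma pot_diff:
  assumes "0 \<le> R" "x \<in> {0<..<T} - S"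
  shows "\<bar>pot R l u x - pot R l' u' x\<bar> \<le> \<bar>l - l'\<bar> + Ca * (2 * R * \<bar>u x - u' x\<bar>)"
proof -
  have "pot R l u x - pot R l' u' x = (l - l') + a x * (trunc_square R (u x) - trunc_square R (u' x))"
    by (simp add: pot_def algebra_simps)
  also have "\<bar>\<dots>\<bar> \<le> \<bar>l - l'\<bar> + \<bar>a x\<bar> * \<bar>trunc_square R (u x) - trunc_square R (u' x)\<bar>"
    by (metis abs_mult abs_triangle_ineq)
  also have "\<dots> \<le> \<bar>l - l'\<bar> + Ca * (2 * R * \<bar>u x - u' x\<bar>)"
    using a_nonneg[OF assms(2)] a_le[OF assms(2)] assms(1) Ca_nonneg
    by (intro add_mono mult_mono trunc_square_lipschitz) auto
  finally show ?thesis .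
qed

definition rhs :: "real \<Rightarrow> real \<Rightarrow> real \<Rightarrow> real \<times> real \<Rightarrow> real \<times> real" where
  "rhs R l t y = (snd y, - (l * fst y + a t * (fst y * trunc_square R (fst y))))"

text \<open>With equal parameters this is the Lipschitz bound behind existence; in general the last
  term is the perturbation that Gronwall's inequality turns into continuous dependence on
  \<open>l\<close>.\<close>

lemma rhs_diff:
  assumes "0 \<le> R" "t \<in> {0<..<T} - S"
  shows "norm (rhs R l t y - rhs R l' t z) \<le> (1 + \<bar>l\<bar> + 3 * R\<^sup>2 * Ca) * norm (y - z) + \<bar>l - l'\<bar> * \<bar>fst z\<bar>"
proof -
  let ?g = "\<lambda>x. x * trunc_square R x"
  have eq: "y - z = (fst y - fst z, snd y - snd z)" by (simp add: prod_eq_iff)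
  have n1: "\<bar>fst y - fst z\<bar> \<le> norm (y - z)" and n2: "\<bar>snd y - snd z\<bar> \<le> norm (y - z)"
    unfolding eq using norm_fst_le[of "fst y - fst z" "snd y - snd z"]
      norm_snd_le[of "snd y - snd z" "fst y - fst z"] by auto
  have "rhs R l t y - rhs R l' t z = (snd y - snd z,
      - (l * (fst y - fst z) + (l - l') * fst z + a t * (?g (fst y) - ?g (fst z))))"
    by (simp add: rhs_def algebra_simps)
  also have "norm \<dots> \<le> \<bar>snd y - snd z\<bar>
      + \<bar>l * (fst y - fst z) + (l - l') * fst z + a t * (?g (fst y) - ?g (fst z))\<bar>"
    by (rule order_trans[OF norm_Pair_le]) simp
  also have "\<dots> \<le> \<bar>snd y - snd z\<bar> + (\<bar>l\<bar> * \<bar>fst y - fst z\<bar> + \<bar>l - l'\<bar> * \<bar>fst z\<bar>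
      + \<bar>a t\<bar> * \<bar>?g (fst y) - ?g (fst z)\<bar>)"
    unfolding abs_mult[symmetric] by linarith
  also have "\<dots> \<le> norm (y - z) + (\<bar>l\<bar> * norm (y - z) + \<bar>l - l'\<bar> * \<bar>fst z\<bar>
      + Ca * (3 * R\<^sup>2 * norm (y - z)))"
  proof (intro add_mono n2 mult_left_mono n1 mult_mono)
    show "\<bar>?g (fst y) - ?g (fst z)\<bar> \<le> 3 * R\<^sup>2 * norm (y - z)"
      by (rule order_trans[OF mult_trunc_square_lipschitz[OF assms(1)] mult_left_mono[OF n1]]) simp
  qed (use a_nonneg[OF assms(2)] a_le[OF assms(2)] Ca_nonneg in auto)
  finally show ?thesis by (simp add: algebra_simps)
qed

section \<open>The initial value problem of the truncated equation\<close>

lemma linear_ode_pot_iff: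
  "linear_ode S s t (pot R l u) u v \<longleftrightarrow> continuous_on {s..t} u \<and> continuous_on {s..t} v \<and>
     (\<forall>x\<in>{s<..<t} - S. ((\<lambda>x. (u x, v x)) has_vector_derivative rhs R l x (u x, v x)) (at x))"
proof -
  have r: "rhs R l x (u x, v x) = (v x, - pot R l u x * u x)" for x
    by (simp add: rhs_def pot_def algebra_simps)
  have "((\<lambda>x. (u x, v x)) has_vector_derivative (d, e)) (at x) \<longleftrightarrow>
      (u has_real_derivative d) (at x) \<and> (v has_real_derivative e) (at x)" for d e x
  proof
    assume *: "((\<lambda>x. (u x, v x)) has_vector_derivative (d, e)) (at x)"
    show "(u has_real_derivative d) (at x) \<and> (v has_real_derivative e) (at x)"
      using bounded_linear.has_vector_derivative[OF bounded_linear_fst *]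
        bounded_linear.has_vector_derivative[OF bounded_linear_snd *]
      by (simp add: has_real_derivative_iff_has_vector_derivative)
  next
    assume "(u has_real_derivative d) (at x) \<and> (v has_real_derivative e) (at x)"
    then show "((\<lambda>x. (u x, v x)) has_vector_derivative (d, e)) (at x)"
      by (auto intro!: has_vector_derivative_Pair simp: has_real_derivative_iff_has_vector_derivative)
  qed
  then show ?thesis unfolding linear_ode_def r by auto
qed

lemma initial_value_problem:
  assumes "0 \<le> R"
  shows "\<exists>u v. linear_ode S 0 T (pot R l u) u v \<and> u 0 = u0 \<and> v 0 = v0"
proof -
  have "\<exists>y. continuous_on {0..T} y \<and> y 0 = (u0, v0) \<and>
      (\<forall>t\<in>{0<..<T} - S. (y has_vector_derivative rhs R l t (y t)) (at t))"
  proof (rule picard_existence[OF fin_S, where L = "1 + \<bar>l\<bar> + 3 * R\<^sup>2 * Ca" and B = 0])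
    have "continuous_on (({0<..<T} - S) \<times> UNIV) (\<lambda>x. a (fst x))"
      by (rule continuous_on_compose2[OF a_cont]) (auto intro!: continuous_intros)
    then show "continuous_on (({0<..<T} - S) \<times> UNIV) (\<lambda>(t, y). rhs R l t y)"
      unfolding rhs_def case_prod_unfold by (intro continuous_intros)
    show "norm (rhs R l t x - rhs R l t y) \<le> (1 + \<bar>l\<bar> + 3 * R\<^sup>2 * Ca) * norm (x - y)"
      if "t \<in> {0<..<T} - S" for t x y
      using rhs_diff[OF assms that, of l x l y] by simp
    show "norm (rhs R l t 0) \<le> 0" for t by (simp add: rhs_def)
  qed (use T_pos Ca_nonneg in auto)
  then obtain y where y: "continuous_on {0..T} y" "y 0 = (u0, v0)"
    "\<forall>t\<in>{0<..<T} - S. (y has_vector_derivative rhs R l t (y t)) (at t)" by blast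
  have "linear_ode S 0 T (pot R l (\<lambda>t. fst (y t))) (\<lambda>t. fst (y t)) (\<lambda>t. snd (y t))"
    unfolding linear_ode_pot_iff using y by (auto intro!: continuous_intros)
  then show ?thesis using y(2) by (intro exI[of _ "\<lambda>t. fst (y t)"] exI[of _ "\<lambda>t. snd (y t)"]) simp
qed

lemma solution_dependence:
  assumes R: "0 \<le> R" and s: "0 \<le> s"
    and 1: "linear_ode S s T (pot R l1 u1) u1 v1" and 2: "linear_ode S s T (pot R l2 u2) u2 v2"
    and M: "\<And>x. x \<in> {s..T} \<Longrightarrow> \<bar>u2 x\<bar> \<le> M" and t: "t \<in> {s..T}"
  shows "norm (u1 t - u2 t, v1 t - v2 t) \<le> (norm (u1 s - u2 s, v1 s - v2 s) + \<bar>l1 - l2\<bar> * M * (T - s))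
    * exp ((1 + \<bar>l1\<bar> + 3 * R\<^sup>2 * Ca) * (t - s))"
proof -
  have "norm ((u1 t, v1 t) - (u2 t, v2 t)) \<le> (norm ((u1 s, v1 s) - (u2 s, v2 s))
      + integral {s..T} (\<lambda>_. \<bar>l1 - l2\<bar> * M)) * exp ((1 + \<bar>l1\<bar> + 3 * R\<^sup>2 * Ca) * (t - s))"
  proof (rule gronwall_difference[OF fin_S, where x' = "\<lambda>t. rhs R l1 t (u1 t, v1 t)" and y' = "\<lambda>t. rhs R l2 t (u2 t, v2 t)"])
    fix t assume t: "t \<in> {s<..<T} - S"
    then have t': "t \<in> {0<..<T} - S" using s by auto
    show "norm (rhs R l1 t (u1 t, v1 t) - rhs R l2 t (u2 t, v2 t))
      \<le> (1 + \<bar>l1\<bar> + 3 * R\<^sup>2 * Ca) * norm ((u1 t, v1 t) - (u2 t, v2 t)) + \<bar>l1 - l2\<bar> * M"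
      by (rule order_trans[OF rhs_diff[OF R t']]) (use M[of t] t in \<open>auto intro!: mult_left_mono\<close>)
  next
    have "0 \<le> M" using M[OF t] by linarith
    then show "0 \<le> \<bar>l1 - l2\<bar> * M" by simp
  qed (use 1 2 t Ca_nonneg in \<open>auto simp: linear_ode_pot_iff intro!: continuous_intros\<close>)
  then show ?thesis using t by (simp add: mult_ac)
qed

lemma solution_unique:
  assumes R: "0 \<le> R" and s: "0 \<le> s"
    and 1: "linear_ode S s T (pot R l u1) u1 v1" and 2: "linear_ode S s T (pot R l u2) u2 v2"
    and init: "u1 s = u2 s" "v1 s = v2 s" and t: "t \<in> {s..T}"
  shows "u1 t = u2 t" "v1 t = v2 t"
proof -
  have "continuous_on {s..T} u2" using 2 by (simp add: linear_ode_def)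
  then obtain M where "\<And>x. x \<in> {s..T} \<Longrightarrow> \<bar>u2 x\<bar> \<le> M" using continuous_on_Icc_bounded by metis
  from solution_dependence[OF R s 1 2 this t] init
  have "norm (u1 t - u2 t, v1 t - v2 t) \<le> 0" by (simp flip: zero_prod_def)
  then have "(u1 t - u2 t, v1 t - v2 t) = 0" by (simp only: norm_le_zero_iff)
  then show "u1 t = u2 t" "v1 t = v2 t" by (auto simp: zero_prod_def)
qed

text \<open>The initial vector (u, v) = A (sin phi, cos phi) has angle phi: phi = pi/2 starts with
  slope 0, as even solutions do, and phi = 0 starts with value 0, as odd ones do.
  \<open>SOME\<close> is harmless, the solution being unique on [0, T].\<close>

definition shot :: "real \<Rightarrow> real \<Rightarrow> real \<Rightarrow> real \<Rightarrow> (real \<Rightarrow> real) \<times> (real \<Rightarrow> real)" where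
  "shot R \<phi> l A = (SOME p. linear_ode S 0 T (pot R l (fst p)) (fst p) (snd p) \<and>
     fst p 0 = A * sin \<phi> \<and> snd p 0 = A * cos \<phi>)"

definition shot_u where "shot_u R \<phi> l A = fst (shot R \<phi> l A)"
definition shot_v where "shot_v R \<phi> l A = snd (shot R \<phi> l A)"

lemma shot:
  assumes "0 \<le> R"
  shows "linear_ode S 0 T (pot R l (shot_u R \<phi> l A)) (shot_u R \<phi> l A) (shot_v R \<phi> l A)"
    "shot_u R \<phi> l A 0 = A * sin \<phi>" "shot_v R \<phi> l A 0 = A * cos \<phi>"
proof -
  obtain u v where "linear_ode S 0 T (pot R l u) u v" "u 0 = A * sin \<phi>" "v 0 = A * cos \<phi>"
    using initial_value_problem[OF assms] by blast
  then have "\<exists>p. linear_ode S 0 T (pot R l (fst p)) (fst p) (snd p) \<and>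
     fst p 0 = A * sin \<phi> \<and> snd p 0 = A * cos \<phi>" by (intro exI[of _ "(u, v)"]) auto
  from someI_ex[OF this]
  show "linear_ode S 0 T (pot R l (shot_u R \<phi> l A)) (shot_u R \<phi> l A) (shot_v R \<phi> l A)"
    "shot_u R \<phi> l A 0 = A * sin \<phi>" "shot_v R \<phi> l A 0 = A * cos \<phi>"
    unfolding shot_u_def shot_v_def shot_def by blast+
qed

lemma shot_cont:
  assumes "0 \<le> R"
  shows "continuous_on {0..T} (shot_u R \<phi> l A)" "continuous_on {0..T} (shot_v R \<phi> l A)"
  using shot(1)[OF assms] by (auto simp: linear_ode_def)

lemma shot_continuous:
  assumes R: "0 \<le> R" and e: "0 < e"
  obtains d where "0 < d" "\<And>l' A' t. \<bar>l' - l\<bar> < d \<Longrightarrow> \<bar>A' - A\<bar> < d \<Longrightarrow> t \<in> {0..T} \<Longrightarrow>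
    \<bar>shot_u R \<phi> l' A' t - shot_u R \<phi> l A t\<bar> \<le> e \<and> \<bar>shot_v R \<phi> l' A' t - shot_v R \<phi> l A t\<bar> \<le> e"
proof -
  obtain M where M: "0 \<le> M" "\<And>x. x \<in> {0..T} \<Longrightarrow> \<bar>shot_u R \<phi> l A x\<bar> \<le> M"
    using continuous_on_Icc_bounded[OF shot_cont(1)[OF R]] by metis
  \<comment> \<open>The cap d \<le> 1 below bounds |l'| by 1 + |l|, which explains the 2 in the
    exponent; the factor 1 + M T collects the change of the initial vector and that of the
    parameter.\<close>
  define E where "E = exp ((2 + \<bar>l\<bar> + 3 * R\<^sup>2 * Ca) * T)"
  define d where "d = min 1 (e / ((1 + M * T) * E))"
  have pos: "0 < (1 + M * T) * E" using M(1) T_pos by (simp add: E_def add_pos_nonneg)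
  have d: "0 < d" using e pos by (simp add: d_def)
  show ?thesis
  proof (rule that[OF d])
    fix l' A' t assume l': "\<bar>l' - l\<bar> < d" and A': "\<bar>A' - A\<bar> < d" and t: "t \<in> {0..T}"
    let ?u = "shot_u R \<phi> l A" and ?v = "shot_v R \<phi> l A"
    let ?u' = "shot_u R \<phi> l' A'" and ?v' = "shot_v R \<phi> l' A'"
    have init: "norm (?u' 0 - ?u 0, ?v' 0 - ?v 0) = \<bar>A' - A\<bar>"
    proof -
      have "(?u' 0 - ?u 0, ?v' 0 - ?v 0) = (A' - A) *\<^sub>R (sin \<phi>, cos \<phi>)"
        by (simp add: shot[OF R] algebra_simps)
      also have "norm \<dots> = \<bar>A' - A\<bar>" unfolding norm_scaleR by (simp add: norm_Pair)
      finally show ?thesis .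
    qed
    have "norm (?u' t - ?u t, ?v' t - ?v t)
      \<le> (\<bar>A' - A\<bar> + \<bar>l' - l\<bar> * M * (T - 0)) * exp ((1 + \<bar>l'\<bar> + 3 * R\<^sup>2 * Ca) * (t - 0))"
      using solution_dependence[OF R order_refl shot(1)[OF R, where l = l' and A = A' and \<phi> = \<phi>]
          shot(1)[OF R, where l = l and A = A and \<phi> = \<phi>] M(2) t] unfolding init .
    also have "\<dots> \<le> (d + d * M * T) * E"
    proof (intro mult_mono)
      show "\<bar>A' - A\<bar> + \<bar>l' - l\<bar> * M * (T - 0) \<le> d + d * M * T"
        using l' A' M(1) T_pos by (intro add_mono) (auto intro!: mult_right_mono)
      have "\<bar>l' - l\<bar> < 1" using l' by (simp add: d_def)
      then have "\<bar>l'\<bar> \<le> 1 + \<bar>l\<bar>" by linarith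
      then show "exp ((1 + \<bar>l'\<bar> + 3 * R\<^sup>2 * Ca) * (t - 0)) \<le> E"
        unfolding E_def exp_le_cancel_iff using t Ca_nonneg by (intro mult_mono) auto
    qed (use d M(1) T_pos in auto)
    also have "\<dots> = d * ((1 + M * T) * E)" by (simp add: algebra_simps)
    also have "\<dots> \<le> e / ((1 + M * T) * E) * ((1 + M * T) * E)"
      using pos by (intro mult_right_mono) (auto simp: d_def)
    also have "\<dots> = e"
    proof -
      have "e / x * x = e" if "x \<noteq> 0" for x :: real using that by simp
      then show ?thesis using pos by (metis less_irrefl)
    qed
    finally have "norm (?u' t - ?u t, ?v' t - ?v t) \<le> e" .
    then show "\<bar>?u' t - ?u t\<bar> \<le> e \<and> \<bar>?v' t - ?v t\<bar> \<le> e"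
      using norm_fst_le[of "?u' t - ?u t" "?v' t - ?v t"] norm_snd_le[of "?v' t - ?v t" "?u' t - ?u t"] by auto
  qed
qed

definition angle :: "real \<Rightarrow> (real \<Rightarrow> real) \<Rightarrow> real \<Rightarrow> real" where
  "angle \<phi> q = (SOME \<theta>. pruefer_angle S 0 T q \<theta> \<and> \<theta> 0 = \<phi>)"

lemma angle:
  assumes "continuous_on ({0<..<T} - S) q" "\<And>x. x \<in> {0<..<T} - S \<Longrightarrow> \<bar>q x\<bar> \<le> B"
  shows "pruefer_angle S 0 T q (angle \<phi> q)" "angle \<phi> q 0 = \<phi>"
proof -
  have "\<exists>\<theta>. pruefer_angle S 0 T q \<theta> \<and> \<theta> 0 = \<phi>"
    by (rule pruefer_angle_exists[OF fin_S _ assms]) (use T_pos in auto)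
  from someI_ex[OF this] show "pruefer_angle S 0 T q (angle \<phi> q)" "angle \<phi> q 0 = \<phi>"
    unfolding angle_def by blast+
qed

text \<open>The initial angle is the same for every A, including A = 0, where the potential is the
  constant \<open>l\<close>. The angle is thus continuous across the trivial solutions, which makes
  A = 0 usable as an edge of the parameter rectangle.\<close>

definition shot_angle where "shot_angle R \<phi> l A = angle \<phi> (pot R l (shot_u R \<phi> l A))"

lemma shot_angle:
  assumes "0 \<le> R"
  shows "pruefer_angle S 0 T (pot R l (shot_u R \<phi> l A)) (shot_angle R \<phi> l A)" "shot_angle R \<phi> l A 0 = \<phi>"
  unfolding shot_angle_def
  by (rule angle[OF pot_cont[OF shot_cont(1)[OF assms]] pot_bound(1)[OF assms]]; simp)+

lemma shot_angle_continuous: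
  assumes R: "0 \<le> R" and t: "t \<in> {0..T}"
  shows "continuous_on UNIV (\<lambda>p. shot_angle R \<phi> (fst p) (snd p) t)"
  unfolding continuous_on_iff
proof (intro ballI allI impI)
  fix p :: "real \<times> real" and e :: real
  assume e: "0 < e"
  obtain l A where p: "p = (l, A)" by (cases p)
  define E where "E = exp ((\<bar>l\<bar> + Ca * R\<^sup>2 + 1) * (t - 0))"
  \<comment> \<open>The tolerance is divided by the factor with which the stability estimate
    multiplies it, and by 2 for a strict bound at the end.\<close>
  define e' where "e' = e / (2 * (1 + Ca * (2 * R)) * (T * E))"
  have nn: "0 \<le> Ca * (2 * R)" using Ca_nonneg R by simp
  have pos: "0 < 2 * (1 + Ca * (2 * R)) * (T * E)" using nn T_pos by (simp add: E_def)
  have e': "0 < e'" using e pos by (simp add: e'_def)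
  obtain d where d: "0 < d" "\<And>l' A' t. \<bar>l' - l\<bar> < d \<Longrightarrow> \<bar>A' - A\<bar> < d \<Longrightarrow> t \<in> {0..T} \<Longrightarrow>
    \<bar>shot_u R \<phi> l' A' t - shot_u R \<phi> l A t\<bar> \<le> e' \<and> \<bar>shot_v R \<phi> l' A' t - shot_v R \<phi> l A t\<bar> \<le> e'"
    using shot_continuous[OF R e'] by metis
  show "\<exists>d>0. \<forall>p'\<in>UNIV. dist p' p < d \<longrightarrow>
    dist (shot_angle R \<phi> (fst p') (snd p') t) (shot_angle R \<phi> (fst p) (snd p) t) < e"
  proof (intro exI[of _ "min d e'"] conjI ballI impI)
    show "0 < min d e'" using d(1) e' by simp
    fix p' :: "real \<times> real" assume lt: "dist p' p < min d e'"
    obtain l' A' where p': "p' = (l', A')" by (cases p')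
    have l': "\<bar>l' - l\<bar> < min d e'" and A': "\<bar>A' - A\<bar> < min d e'"
      using lt dist_fst_le[of p' p] dist_snd_le[of p' p] by (auto simp: p p' dist_real_def)
    let ?e = "(1 + Ca * (2 * R)) * e'"
    have "\<bar>shot_angle R \<phi> l A t - shot_angle R \<phi> l' A' t\<bar>
      \<le> (\<bar>shot_angle R \<phi> l A 0 - shot_angle R \<phi> l' A' 0\<bar> + integral {0..T} (\<lambda>_. ?e)) * exp ((\<bar>l\<bar> + Ca * R\<^sup>2 + 1) * (t - 0))"
    proof (rule pruefer_angle_diff_bound[OF fin_S shot_angle(1)[OF R] shot_angle(1)[OF R]])
      show "\<bar>pot R l (shot_u R \<phi> l A) x - pot R l' (shot_u R \<phi> l' A') x\<bar> \<le> ?e"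
        if x: "x \<in> {0<..<T} - S" for x
      proof -
        have "\<bar>shot_u R \<phi> l A x - shot_u R \<phi> l' A' x\<bar> \<le> e'"
          using d(2)[of l' A' x] l' A' x by (auto simp: abs_minus_commute)
        then have "Ca * (2 * R * \<bar>shot_u R \<phi> l A x - shot_u R \<phi> l' A' x\<bar>) \<le> Ca * (2 * R * e')"
          using Ca_nonneg R by (intro mult_left_mono) auto
        moreover have "?e = e' + Ca * (2 * R * e')" by (simp add: algebra_simps)
        ultimately show ?thesis
          using pot_diff[OF R x, of l "shot_u R \<phi> l A" l' "shot_u R \<phi> l' A'"] l' by linarith
      qed
      show "\<bar>pot R l (shot_u R \<phi> l A) x\<bar> \<le> \<bar>l\<bar> + Ca * R\<^sup>2" if "x \<in> {0<..<T} - S" for x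
        by (rule pot_bound(1)[OF R that])
      show "0 \<le> ?e" using nn e' by simp
    qed (use t Ca_nonneg in auto)
    also have "\<dots> = ?e * (T * E)" using T_pos by (simp add: shot_angle[OF R] E_def)
    also have "\<dots> = e / 2"
    proof -
      have "x * (e / (2 * x * y)) * y = e / 2" if "x \<noteq> 0" "y \<noteq> 0" for x y :: real using that by simp
      note this[of "1 + Ca * (2 * R)" "T * E"]
      moreover have "1 + Ca * (2 * R) \<noteq> 0" using nn by linarith
      moreover have "T * E \<noteq> 0" using T_pos by (simp add: E_def)
      ultimately show ?thesis unfolding e'_def by blast
    qed
    finally show "dist (shot_angle R \<phi> (fst p') (snd p') t) (shot_angle R \<phi> (fst p) (snd p) t) < e"
      using e by (simp add: p p' dist_real_def abs_minus_commute)
  qed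
qed

end

section \<open>A priori bounds\<close>

text \<open>For u \<ge> 0 and q \<ge> - mu^2 one has (v - mu u)' \<le> - mu (v - mu u), so a very
  negative slope persists and would drive u below 0 before t. This bounds v/u at s from below by a
  constant that depends only on mu and the length of the interval.\<close>

lemma harnack_right:
  assumes S: "finite S" and L: "linear_ode S s t q u v" and st: "s < t" and \<mu>: "0 \<le> \<mu>"
    and q: "\<And>x. x \<in> {s<..<t} - S \<Longrightarrow> - \<mu>\<^sup>2 \<le> q x" and u: "\<And>x. x \<in> {s..t} \<Longrightarrow> 0 \<le> u x"
  shows "\<And>x. x \<in> {s..t} \<Longrightarrow> v x - \<mu> * u x \<le> (v s - \<mu> * u s) * exp (- \<mu> * (x - s))"
    and "- (\<mu> + exp (2 * \<mu> * (t - s)) / (t - s)) * u s \<le> v s"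
proof -
  have du: "(u has_real_derivative v x) (at x)" and dv: "(v has_real_derivative - q x * u x) (at x)"
    if "x \<in> {s<..<t} - S" for x using L that by (auto simp: linear_ode_def)
  have cu: "continuous_on {s..t} u" and cv: "continuous_on {s..t} v" using L by (auto simp: linear_ode_def)
  show decay: "v x - \<mu> * u x \<le> (v s - \<mu> * u s) * exp (- \<mu> * (x - s))" if x: "x \<in> {s..t}" for x
  proof -
    have "- ((v s - \<mu> * u s) * exp (\<mu> * (s - s))) \<le> - ((v x - \<mu> * u x) * exp (\<mu> * (x - s)))"
    proof (rule nondecreasing_off_finite[where S = S and s = s and t = x
          and f = "\<lambda>x. - ((v x - \<mu> * u x) * exp (\<mu> * (x - s)))"
          and f' = "\<lambda>x. (q x + \<mu>\<^sup>2) * u x * exp (\<mu> * (x - s))"])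
      show "continuous_on {s..x} (\<lambda>x. - ((v x - \<mu> * u x) * exp (\<mu> * (x - s))))"
        by (intro continuous_intros continuous_on_subset[OF cu] continuous_on_subset[OF cv]) (use x in auto)
      fix y assume y: "y \<in> {s<..<x} - S"
      then have y': "y \<in> {s<..<t} - S" using x by auto
      show "((\<lambda>x. - ((v x - \<mu> * u x) * exp (\<mu> * (x - s)))) has_real_derivative
          (q y + \<mu>\<^sup>2) * u y * exp (\<mu> * (y - s))) (at y)"
        by (rule derivative_eq_intros du[OF y'] dv[OF y'] refl | simp add: power2_eq_square algebra_simps)+
      show "0 \<le> (q y + \<mu>\<^sup>2) * u y * exp (\<mu> * (y - s))"
        using q[OF y'] u[of y] y' by auto
    qed (use S x in auto)
    then have "(v x - \<mu> * u x) * exp (\<mu> * (x - s)) \<le> v s - \<mu> * u s" by simp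
    then have "(v x - \<mu> * u x) * exp (\<mu> * (x - s)) * exp (- \<mu> * (x - s)) \<le> (v s - \<mu> * u s) * exp (- \<mu> * (x - s))"
      by (rule mult_right_mono) simp
    then show ?thesis by (simp add: mult.assoc flip: exp_add)
  qed
  define D where "D = - (v s - \<mu> * u s)"
  have u0: "0 \<le> u s" using u st by auto
  show "- (\<mu> + exp (2 * \<mu> * (t - s)) / (t - s)) * u s \<le> v s"
  proof (cases "D \<le> 0")
    case True
    have "0 \<le> (\<mu> + exp (2 * \<mu> * (t - s)) / (t - s)) * u s" using \<mu> st u0 by (intro mult_nonneg_nonneg add_nonneg_nonneg) auto
    moreover have "0 \<le> \<mu> * u s" using \<mu> u0 by simp
    ultimately show ?thesis using True unfolding D_def minus_mult_left[symmetric] by linarith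
  next
    case False
    \<comment> \<open>Two factors exp(- mu (t - s)): one for the decay of v - mu u, the other for
      the weight with which u is differentiated.\<close>
    define \<kappa> where "\<kappa> = exp (- (2 * \<mu> * (t - s)))"
    have "- (u s * exp (- \<mu> * (s - s)) + D * \<kappa> * s) \<le> - (u t * exp (- \<mu> * (t - s)) + D * \<kappa> * t)"
    proof (rule nondecreasing_off_finite[where S = S and s = s and t = t
          and f = "\<lambda>x. - (u x * exp (- \<mu> * (x - s)) + D * \<kappa> * x)"
          and f' = "\<lambda>x. - (v x - \<mu> * u x) * exp (- \<mu> * (x - s)) - D * \<kappa>"])
      show "continuous_on {s..t} (\<lambda>x. - (u x * exp (- \<mu> * (x - s)) + D * \<kappa> * x))"
        by (intro continuous_intros cu)
      fix y assume y: "y \<in> {s<..<t} - S"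
      show "((\<lambda>x. - (u x * exp (- \<mu> * (x - s)) + D * \<kappa> * x)) has_real_derivative
          - (v y - \<mu> * u y) * exp (- \<mu> * (y - s)) - D * \<kappa>) (at y)"
        by (rule derivative_eq_intros du[OF y] refl | simp add: algebra_simps)+
      have "D * exp (- \<mu> * (y - s)) * exp (- \<mu> * (y - s)) \<le> - (v y - \<mu> * u y) * exp (- \<mu> * (y - s))"
      proof (rule mult_right_mono)
        have "v y - \<mu> * u y \<le> (v s - \<mu> * u s) * exp (- \<mu> * (y - s))" using decay[of y] y by auto
        then show "D * exp (- \<mu> * (y - s)) \<le> - (v y - \<mu> * u y)"
          unfolding D_def minus_mult_left[symmetric] by linarith
      qed simp
      moreover have "D * \<kappa> \<le> D * exp (- \<mu> * (y - s)) * exp (- \<mu> * (y - s))"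
      proof -
        have "\<mu> * (y - s) \<le> \<mu> * (t - s)" using \<mu> y by (intro mult_left_mono) auto
        then have "\<kappa> \<le> exp (- \<mu> * (y - s)) * exp (- \<mu> * (y - s))"
          unfolding \<kappa>_def exp_add[symmetric] by simp
        then show ?thesis using False by (simp add: mult.assoc)
      qed
      ultimately show "0 \<le> - (v y - \<mu> * u y) * exp (- \<mu> * (y - s)) - D * \<kappa>" by linarith
    qed (use S st in auto)
    moreover have "0 \<le> u t * exp (- \<mu> * (t - s))" using u[of t] st by simp
    ultimately have "D * \<kappa> * (t - s) \<le> u s" by (simp add: algebra_simps)
    then have "D * \<kappa> * (t - s) * (exp (2 * \<mu> * (t - s)) / (t - s)) \<le> u s * (exp (2 * \<mu> * (t - s)) / (t - s))"
      using st by (intro mult_right_mono) auto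
    moreover have "D * \<kappa> * (t - s) * (exp (2 * \<mu> * (t - s)) / (t - s)) = D"
    proof -
      have "D * \<kappa> * (t - s) * (exp (2 * \<mu> * (t - s)) / (t - s)) = D * (\<kappa> * exp (2 * \<mu> * (t - s)))" using st by simp
      also have "\<kappa> * exp (2 * \<mu> * (t - s)) = 1" unfolding \<kappa>_def by (simp flip: exp_add)
      finally show ?thesis by simp
    qed
    ultimately have "D \<le> exp (2 * \<mu> * (t - s)) / (t - s) * u s" by (simp add: mult.commute)
    moreover have "0 \<le> \<mu> * u s" using \<mu> u0 by simp
    ultimately show ?thesis unfolding D_def minus_mult_left[symmetric] distrib_right by linarith
  qed
qed

text \<open>Reversal of time, here reflection about 0, exchanges the two ends and the sign of
  v.\<close>

lemma harnack_left:
  assumes S: "finite S" and L: "linear_ode S s t q u v" and st: "s < t" and \<mu>: "0 \<le> \<mu>"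
    and q: "\<And>x. x \<in> {s<..<t} - S \<Longrightarrow> - \<mu>\<^sup>2 \<le> q x" and u: "\<And>x. x \<in> {s..t} \<Longrightarrow> 0 \<le> u x"
  shows "v t \<le> (\<mu> + exp (2 * \<mu> * (t - s)) / (t - s)) * u t"
proof -
  have "- (\<mu> + exp (2 * \<mu> * ((0 - s) - (0 - t))) / ((0 - s) - (0 - t))) * u (0 - (0 - t)) \<le> - v (0 - (0 - t))"
  proof (rule harnack_right(2)[OF _ linear_ode_reflect[OF L, of 0]])
    show "- \<mu>\<^sup>2 \<le> q (0 - x)" if "x \<in> {0 - t<..<0 - s} - (\<lambda>x. 0 - x) ` S" for x
      by (rule q) (use that in \<open>auto simp: image_iff\<close>)
  qed (use S st \<mu> u in auto)
  then show ?thesis unfolding minus_mult_left[symmetric] by simp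
qed

text \<open>\<open>K'\<close> bounds u on an interval of length at most L without sign change, and
  the last summand bounds the increment of v over it. The truncation level does not occur; several
  sign changes are handled by iterating this function.\<close>

definition growth :: "real \<Rightarrow> real \<Rightarrow> real \<Rightarrow> real \<Rightarrow> real \<Rightarrow> real" where
  "growth \<mu> \<Lambda> C L K = (let K' = exp (\<mu> * L) * (1 + L) * K in K' + K + L * ((\<mu>\<^sup>2 + \<Lambda> + C * K'\<^sup>2) * K'))"

lemma growth_ge:
  assumes "0 \<le> \<mu>" "0 \<le> \<Lambda>" "0 \<le> C" "0 \<le> L" "0 \<le> K"
  shows "K \<le> growth \<mu> \<Lambda> C L K"
  using assms unfolding growth_def Let_def by (simp add: add_nonneg_nonneg)

text \<open>The estimate for u rests on q \<ge> - mu^2: a large q only pulls a nonnegative solution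
  down. The quadratic upper bound for q enters afterwards, when u is already controlled, to bound v'
  = - q u.\<close>

lemma growth_bound:
  assumes S: "finite S" and L: "linear_ode S s t q u v" and st: "s \<le> t" and \<mu>: "0 \<le> \<mu>"
    and q: "\<And>x. x \<in> {s<..<t} - S \<Longrightarrow> - \<mu>\<^sup>2 \<le> q x" "\<And>x. x \<in> {s<..<t} - S \<Longrightarrow> q x \<le> \<Lambda> + C * (u x)\<^sup>2"
    and u: "\<And>x. x \<in> {s..t} \<Longrightarrow> 0 \<le> u x"
    and len: "t - s \<le> len" and C: "0 \<le> C" "0 \<le> \<Lambda>" and K: "\<bar>u s\<bar> \<le> K" "\<bar>v s\<bar> \<le> K"
  shows "\<bar>u t\<bar> \<le> growth \<mu> \<Lambda> C len K \<and> \<bar>v t\<bar> \<le> growth \<mu> \<Lambda> C len K"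
proof -
  have len0: "0 \<le> len" and K0: "0 \<le> K" using len st K by auto
  define K' where "K' = exp (\<mu> * len) * (1 + len) * K"
  have K'0: "0 \<le> K'" using len0 K0 by (simp add: K'_def)
  have du: "(u has_real_derivative v x) (at x)" and dv: "(v has_real_derivative - q x * u x) (at x)"
    if "x \<in> {s<..<t} - S" for x using L that by (auto simp: linear_ode_def)
  have cu: "continuous_on {s..t} u" and cv: "continuous_on {s..t} v" using L by (auto simp: linear_ode_def)
  have ub: "u x \<le> K'" if x: "x \<in> {s..t}" for x
  proof -
    have "K * s - u s * exp (- \<mu> * (s - s)) \<le> K * x - u x * exp (- \<mu> * (x - s))"
    proof (rule nondecreasing_off_finite[where S = S and s = s and t = x
          and f = "\<lambda>x. K * x - u x * exp (- \<mu> * (x - s))"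
          and f' = "\<lambda>x. K - (v x - \<mu> * u x) * exp (- \<mu> * (x - s))"])
      show "continuous_on {s..x} (\<lambda>x. K * x - u x * exp (- \<mu> * (x - s)))"
        by (intro continuous_intros continuous_on_subset[OF cu]) (use x in auto)
      fix y assume y: "y \<in> {s<..<x} - S"
      then have y': "y \<in> {s<..<t} - S" using x by auto
      show "((\<lambda>x. K * x - u x * exp (- \<mu> * (x - s))) has_real_derivative
          K - (v y - \<mu> * u y) * exp (- \<mu> * (y - s))) (at y)"
        by (rule derivative_eq_intros du[OF y'] refl | simp add: algebra_simps)+
      have e1: "exp (- \<mu> * (y - s)) \<le> 1" using \<mu> y' by simp
      have "v y - \<mu> * u y \<le> (v s - \<mu> * u s) * exp (- \<mu> * (y - s))"
        by (rule harnack_right(1)[OF S L _ \<mu> q(1) u]) (use y' in auto)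
      also have "\<dots> \<le> K * exp (- \<mu> * (y - s))"
      proof (rule mult_right_mono)
        have "0 \<le> \<mu> * u s" using \<mu> u[of s] st by simp
        then show "v s - \<mu> * u s \<le> K" using K by linarith
      qed simp
      also have "\<dots> \<le> K * 1" by (rule mult_left_mono[OF e1 K0])
      finally have "(v y - \<mu> * u y) * exp (- \<mu> * (y - s)) \<le> K * exp (- \<mu> * (y - s))"
        by (intro mult_right_mono) auto
      also have "\<dots> \<le> K * 1" by (rule mult_left_mono[OF e1 K0])
      finally show "0 \<le> K - (v y - \<mu> * u y) * exp (- \<mu> * (y - s))" by simp
    qed (use S x in auto)
    then have "u x * exp (- \<mu> * (x - s)) \<le> u s + K * (x - s)" by (simp add: algebra_simps)
    also have "\<dots> \<le> K + K * len" using K x len K0 by (intro add_mono mult_left_mono) auto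
    finally have "u x * exp (- \<mu> * (x - s)) * exp (\<mu> * (x - s)) \<le> (1 + len) * K * exp (\<mu> * (x - s))"
      by (intro mult_right_mono) (auto simp: algebra_simps)
    also have "u x * exp (- \<mu> * (x - s)) * exp (\<mu> * (x - s)) = u x"
      by (simp add: mult.assoc flip: exp_add)
    also have "(1 + len) * K * exp (\<mu> * (x - s)) \<le> (1 + len) * K * exp (\<mu> * len)"
      using len0 K0 x len \<mu> by (intro mult_left_mono) (auto intro!: mult_left_mono)
    finally show ?thesis by (simp add: K'_def mult_ac)
  qed
  define B where "B = (\<mu>\<^sup>2 + \<Lambda> + C * K'\<^sup>2) * K'"
  have B0: "0 \<le> B" unfolding B_def using K'0 C by auto
  have "norm (v t - v s) \<le> B * (t - s)"
  proof (rule increment_bound_off_finite[OF S st cv B0])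
    fix x assume x: "x \<in> {s<..<t} - S"
    show "(v has_vector_derivative - q x * u x) (at x)"
      using dv[OF x] by (simp add: has_real_derivative_iff_has_vector_derivative)
    have ux: "0 \<le> u x" "u x \<le> K'" using u[of x] ub[of x] x by auto
    have "C * (u x)\<^sup>2 \<le> C * K'\<^sup>2" using ux C by (intro mult_left_mono power_mono) auto
    moreover have "0 \<le> C * K'\<^sup>2" using C by simp
    moreover have "0 \<le> \<mu>\<^sup>2" by simp
    ultimately have "\<bar>q x\<bar> \<le> \<mu>\<^sup>2 + \<Lambda> + C * K'\<^sup>2"
      using q(1)[OF x] q(2)[OF x] C by (simp only: abs_le_iff) linarith
    then show "norm (- q x * u x) \<le> B"
      unfolding B_def using ux by (auto simp: abs_mult intro!: mult_mono)
  qed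
  also have "\<dots> \<le> len * B" using len B0 by (simp add: mult.commute mult_left_mono)
  finally have "\<bar>v t - v s\<bar> \<le> len * B" by simp
  then have "\<bar>v t\<bar> \<le> K + len * B" using K by linarith
  moreover have "0 \<le> len * B" using len0 B0 by simp
  moreover have "\<bar>u t\<bar> \<le> K'" using ub[of t] u[of t] st by simp
  ultimately show ?thesis
    unfolding growth_def Let_def K'_def[symmetric] B_def[symmetric] using K0 K'0 by (intro conjI; linarith)
qed

text \<open>On an interval without sign changes the logarithmic derivative \<open>v/u\<close> is bounded away from the
  ends, whereas it decreases at least at the rate \<open>q\<close>.\<close>

lemma potential_bound_without_sign_change:
  assumes S: "finite S" and L: "linear_ode S s t q u v" and st: "s < t" and \<mu>: "0 \<le> \<mu>"
    and q: "\<And>x. x \<in> {s<..<t} - S \<Longrightarrow> - \<mu>\<^sup>2 \<le> q x" and u: "\<And>x. x \<in> {s..t} \<Longrightarrow> 0 \<le> u x"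
    and nz: "\<And>x. x \<in> {s..t} \<Longrightarrow> u x \<noteq> 0 \<or> v x \<noteq> 0"
  defines "K \<equiv> \<mu> + exp (2 * \<mu> * ((t - s) / 4)) / ((t - s) / 4)"
  shows "\<exists>x\<in>{s<..<t} - S. \<bar>v x\<bar> \<le> K * \<bar>u x\<bar> \<and> q x \<le> 4 * K / (t - s) + 1"
proof (rule ccontr)
  assume contra: "\<not> ?thesis"
  \<comment> \<open>The middle half has distance d to both ends, so both Harnack inequalities apply
    with length d and give |v| \<le> K u there.\<close>
  define d where "d = (t - s) / 4"
  define Q where "Q = 4 * K / (t - s) + 1"
  have d: "0 < d" "t - s = 4 * d" using st by (auto simp: d_def)
  have K: "K = \<mu> + exp (2 * \<mu> * d) / d" by (simp add: K_def d_def)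
  have mid: "\<bar>v y\<bar> \<le> K * u y \<and> 0 < u y" if y: "y \<in> {s + d..t - d}" for y
  proof -
    have "- (\<mu> + exp (2 * \<mu> * ((y + d) - y)) / ((y + d) - y)) * u y \<le> v y"
      by (rule harnack_right(2)[OF S linear_ode_subset[OF L] _ \<mu> q u]) (use y d in auto)
    moreover have "v y \<le> (\<mu> + exp (2 * \<mu> * (y - (y - d))) / (y - (y - d))) * u y"
      by (rule harnack_left[OF S linear_ode_subset[OF L] _ \<mu> q u]) (use y d in auto)
    moreover have e: "(y + d) - y = d" "y - (y - d) = d" by auto
    ultimately have "\<bar>v y\<bar> \<le> K * u y" unfolding K e minus_mult_left[symmetric] abs_le_iff by linarith
    moreover have "0 \<le> u y" using u y d by auto
    ultimately show ?thesis using nz[of y] y d by (cases "u y = 0") auto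
  qed
  have du: "(u has_real_derivative v x) (at x)" and dv: "(v has_real_derivative - q x * u x) (at x)"
    if "x \<in> {s<..<t} - S" for x using L that by (auto simp: linear_ode_def)
  have cu: "continuous_on {s..t} u" and cv: "continuous_on {s..t} v" using L by (auto simp: linear_ode_def)
  have Qlt: "Q < q x" if x: "x \<in> {s + d<..<t - d} - S" for x
  proof -
    have "x \<in> {s<..<t} - S" using x d by auto
    moreover have "\<bar>v x\<bar> \<le> K * \<bar>u x\<bar>" using mid[of x] x by auto
    ultimately show ?thesis using contra unfolding Q_def by force
  qed
  \<comment> \<open>By the Riccati equation (v/u)' = - q - (v/u)^2, a potential above Q on the
    middle half lowers v/u by at least 2 d Q = 2 (K + d), more than the length 2 K of the interval
    that contains its values.\<close>
  have "- (v (s + d) / u (s + d)) - Q * (s + d) \<le> - (v (t - d) / u (t - d)) - Q * (t - d)"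
  proof (rule nondecreasing_off_finite[where S = S and s = "s + d" and t = "t - d"
        and f = "\<lambda>x. - (v x / u x) - Q * x" and f' = "\<lambda>x. q x + (v x / u x)\<^sup>2 - Q"])
    show "s + d \<le> t - d" using d by auto
    show "continuous_on {s + d..t - d} (\<lambda>x. - (v x / u x) - Q * x)"
      by (intro continuous_intros continuous_on_subset[OF cu] continuous_on_subset[OF cv])
         (use d mid in force)+
    fix x assume x: "x \<in> {s + d<..<t - d} - S"
    then have x': "x \<in> {s<..<t} - S" using d by auto
    have ux: "u x \<noteq> 0" using mid[of x] x by auto
    have "((\<lambda>x. v x / u x) has_real_derivative ((- q x * u x) * u x - v x * v x) / (u x * u x)) (at x)"
      by (rule DERIV_divide[OF dv[OF x'] du[OF x'] ux])
    also have "((- q x * u x) * u x - v x * v x) / (u x * u x) = - q x - (v x / u x)\<^sup>2"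
      using ux by (simp add: diff_divide_distrib power_divide power2_eq_square)
    finally have dr: "((\<lambda>x. v x / u x) has_real_derivative - q x - (v x / u x)\<^sup>2) (at x)" .
    show "((\<lambda>x. - (v x / u x) - Q * x) has_real_derivative q x + (v x / u x)\<^sup>2 - Q) (at x)"
      by (rule derivative_eq_intros dr refl | simp)+
    have "0 \<le> (v x / u x)\<^sup>2" by simp
    then show "0 \<le> q x + (v x / u x)\<^sup>2 - Q" using Qlt[OF x] by linarith
  qed (rule S)
  moreover have "\<bar>v y / u y\<bar> \<le> K" if "y \<in> {s + d..t - d}" for y
    using mid[OF that] by (simp add: abs_divide pos_divide_le_eq)
  from this[of "s + d"] this[of "t - d"]
  have "\<bar>v (s + d) / u (s + d)\<bar> \<le> K" "\<bar>v (t - d) / u (t - d)\<bar> \<le> K" using d by auto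
  ultimately have "Q * ((t - d) - (s + d)) \<le> 2 * K" unfolding right_diff_distrib abs_le_iff by linarith
  moreover have "(t - d) - (s + d) = 2 * d" using d by simp
  ultimately have "Q * d \<le> K" by simp
  moreover have "Q * d = K + d" unfolding Q_def d(2) using d(1) by (simp add: field_simps)
  ultimately show False using d by simp
qed

section \<open>Signs, nodal intervals and bounds along shots\<close>

lemma sin_sign:
  assumes "real i * pi \<le> y" "y \<le> (real i + 1) * pi"
  shows "0 \<le> (- 1) ^ i * sin y"
proof -
  have "0 \<le> sin (y - real i * pi)"
    using assms by (intro sin_ge_zero) (auto simp: algebra_simps)
  also have "\<dots> = (- 1) ^ i * sin y" by (simp add: sin_diff)
  finally show ?thesis .
qed

lemma linear_ode_scale:
  assumes "linear_ode S s t q u v" shows "linear_ode S s t q (\<lambda>x. c * u x) (\<lambda>x. c * v x)"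
  using assms unfolding linear_ode_def
  by (auto intro!: continuous_intros derivative_eq_intros simp: algebra_simps)

lemma nonzero_continuous_pos:
  fixes f :: "real \<Rightarrow> real"
  assumes "continuous_on {0..t} f" "\<And>x. x \<in> {0..t} \<Longrightarrow> f x \<noteq> 0" "0 < f 0" "x \<in> {0..t}"
  shows "0 < f x"
proof (rule ccontr)
  assume "\<not> 0 < f x"
  then have "\<exists>y\<ge>0. y \<le> x \<and> f y = 0"
    by (intro IVT2') (use assms in \<open>auto elim: continuous_on_subset\<close>)
  then show False using assms by auto
qed

context piecewise_weight
begin

lemma pruefer_crossing:
  assumes P: "pruefer_angle S 0 T q \<theta>" and B: "\<And>x. x \<in> {0<..<T} - S \<Longrightarrow> \<bar>q x\<bar> \<le> B"
    and st: "0 \<le> s" "s < t" "t \<le> T" and ge: "real j * pi \<le> \<theta> s"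
  shows "real j * pi < \<theta> t"
  using pruefer_angle_crossing[OF fin_S pruefer_angle_subset[OF P, of s t], of B "int j"] B st ge by auto

lemma shot_polar:
  assumes "0 \<le> R" "x \<in> {0..T}"
  shows "shot_u R \<phi> l A x * cos (shot_angle R \<phi> l A x) = shot_v R \<phi> l A x * sin (shot_angle R \<phi> l A x)"
  by (rule pruefer_polar[OF fin_S shot(1)[OF assms(1)] shot_angle(1)[OF assms(1)] _ assms(2)])
     (use pot_bound(1)[OF assms(1)] shot[OF assms(1)] shot_angle(2)[OF assms(1)] in \<open>auto simp: mult_ac\<close>)

lemma shot_nonvanishing:
  assumes "0 \<le> R" "A \<noteq> 0" "x \<in> {0..T}"
  shows "shot_u R \<phi> l A x \<noteq> 0 \<or> shot_v R \<phi> l A x \<noteq> 0"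
proof (rule ccontr)
  assume "\<not> ?thesis"
  then have "shot_u R \<phi> l A 0 = 0 \<and> shot_v R \<phi> l A 0 = 0"
    by (intro linear_ode_vanishing[OF fin_S shot(1)[OF assms(1)] pot_bound(1)[OF assms(1)] assms(3)])
       (use T_pos in auto)
  then have "sin \<phi> = 0" "cos \<phi> = 0" using shot(2,3)[OF assms(1)] assms(2) by auto
  then show False using sin_cos_squared_add[of \<phi>] by simp
qed

text \<open>The polar radius is continuous, nowhere zero and equal to A at the start, hence
  positive. So u always has the sign of the sine of the angle.\<close>

lemma shot_radius:
  assumes R: "0 \<le> R" and A: "0 < A" and x: "x \<in> {0..T}"
  shows "\<exists>\<rho>>0. shot_u R \<phi> l A x = \<rho> * sin (shot_angle R \<phi> l A x) \<and>
    shot_v R \<phi> l A x = \<rho> * cos (shot_angle R \<phi> l A x)"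
proof -
  let ?u = "shot_u R \<phi> l A" and ?v = "shot_v R \<phi> l A" and ?\<theta> = "shot_angle R \<phi> l A"
  define \<rho> where "\<rho> x = ?u x * sin (?\<theta> x) + ?v x * cos (?\<theta> x)" for x
  have rep: "?u x = \<rho> x * sin (?\<theta> x)" "?v x = \<rho> x * cos (?\<theta> x)" if "x \<in> {0..T}" for x
    unfolding \<rho>_def using polar_representation[OF shot_polar[OF R that]] by auto
  have "0 < \<rho> x"
  proof (rule nonzero_continuous_pos[OF _ _ _ x])
    have "continuous_on {0..T} ?\<theta>" using shot_angle(1)[OF R] by (auto simp: pruefer_angle_def)
    then show "continuous_on {0..T} \<rho>" unfolding \<rho>_def by (intro continuous_intros shot_cont R)
    show "\<rho> x \<noteq> 0" if "x \<in> {0..T}" for x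
      using shot_nonvanishing[OF R _ that, of A \<phi> l] A rep[OF that] by auto
    have "\<rho> 0 = A * ((sin \<phi>)\<^sup>2 + (cos \<phi>)\<^sup>2)"
      unfolding \<rho>_def shot[OF R] shot_angle(2)[OF R] by (simp only: power2_eq_square distrib_left mult.assoc)
    then show "0 < \<rho> 0" using A by simp
  qed
  then show ?thesis using rep[OF x] by blast
qed

text \<open>The condition at T/2 says that the vector (u, v) is compatible with the reflection
  there, that is v = 0 in the even case and u = 0 in the odd one. Uniqueness for the initial value
  problem started at T/2 gives the symmetry, and the angle gains as much in the right half as in the
  left.\<close>

lemma shot_symmetric:
  assumes R: "0 \<le> R" and \<phi>: "\<phi> = 0 \<or> \<phi> = pi / 2"
    and half: "shot_angle R \<phi> l A (T / 2) = \<phi> + real j * pi"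
  defines "\<epsilon> \<equiv> if \<phi> = 0 then - 1 else 1 :: real"
  shows "\<And>x. x \<in> {0..T} \<Longrightarrow> shot_u R \<phi> l A (T - x) = \<epsilon> * shot_u R \<phi> l A x"
    and "\<And>x. x \<in> {0..T} \<Longrightarrow> shot_v R \<phi> l A (T - x) = - \<epsilon> * shot_v R \<phi> l A x"
    and "shot_angle R \<phi> l A T = \<phi> + 2 * real j * pi"
proof -
  let ?u = "shot_u R \<phi> l A" and ?v = "shot_v R \<phi> l A" and ?\<theta> = "shot_angle R \<phi> l A"
  have \<epsilon>: "\<epsilon> * \<epsilon> = 1" "\<epsilon> = 1 \<or> \<epsilon> = - 1" by (auto simp: \<epsilon>_def)
  have cosj: "cos (real j * pi) \<noteq> 0" by simp
  have mid: "?u (T / 2) = \<epsilon> * ?u (T / 2)" "?v (T / 2) = - \<epsilon> * ?v (T / 2)"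
  proof -
    have p: "?u (T / 2) * cos (?\<theta> (T / 2)) = ?v (T / 2) * sin (?\<theta> (T / 2))"
      by (rule shot_polar[OF R]) (use T_pos in auto)
    have "(sin \<phi> = 0 \<and> cos \<phi> = 1 \<and> \<epsilon> = - 1) \<or> (sin \<phi> = 1 \<and> cos \<phi> = 0 \<and> \<epsilon> = 1)"
      unfolding \<epsilon>_def by (rule disjE[OF \<phi>]; erule ssubst; simp)
    then show "?u (T / 2) = \<epsilon> * ?u (T / 2)" "?v (T / 2) = - \<epsilon> * ?v (T / 2)"
      using p cosj unfolding half by (auto simp: cos_add sin_add)
  qed
  have flip: "x \<in> {T/2<..<T} - S \<Longrightarrow> T - x \<in> {0<..<T} - S \<and> x \<in> {0<..<T} - S" for x
    using S_reflect[of "T - x"] T_pos by auto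
  have refl: "linear_ode S (T - T) (T - 0) (\<lambda>x. pot R l ?u (T - x)) (\<lambda>x. ?u (T - x)) (\<lambda>x. - ?v (T - x))"
    using linear_ode_reflect[OF shot(1)[OF R], of T] unfolding reflect_image_S .
  have refl2: "linear_ode S (T / 2) T (pot R l (\<lambda>x. \<epsilon> * ?u (T - x))) (\<lambda>x. \<epsilon> * ?u (T - x)) (\<lambda>x. \<epsilon> * - ?v (T - x))"
  proof (rule linear_ode_cong[OF linear_ode_scale[OF linear_ode_subset[OF refl]]])
    fix x assume x: "x \<in> {T / 2<..<T} - S"
    show "pot R l ?u (T - x) = pot R l (\<lambda>x. \<epsilon> * ?u (T - x)) x"
      using \<epsilon>(2) a_reflect[of x] flip[OF x] by (auto simp: pot_def)
  qed (use T_pos in auto)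
  have right: "?u x = \<epsilon> * ?u (T - x)" "?v x = \<epsilon> * - ?v (T - x)" if "x \<in> {T/2..T}" for x
    by (rule solution_unique[OF R _ linear_ode_subset[OF shot(1)[OF R]] refl2 _ _ that];
        use T_pos mid in simp)+
  show u: "?u (T - x) = \<epsilon> * ?u x" if "x \<in> {0..T}" for x
  proof (cases "T / 2 \<le> x")
    case True
    then have "\<epsilon> * ?u x = (\<epsilon> * \<epsilon>) * ?u (T - x)" using right(1)[of x] that by simp
    then show ?thesis using \<epsilon> by simp
  next
    case False then show ?thesis using right(1)[of "T - x"] that by simp
  qed
  show "?v (T - x) = - \<epsilon> * ?v x" if "x \<in> {0..T}" for x
  proof (cases "T / 2 \<le> x")
    case True
    then have "- \<epsilon> * ?v x = (\<epsilon> * \<epsilon>) * ?v (T - x)" using right(2)[of x] that by simp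
    then show ?thesis using \<epsilon> by simp
  next
    case False then show ?thesis using right(2)[of "T - x"] that by simp
  qed
  \<comment> \<open>The reflected angle. It agrees with the angle at T/2, and it solves the same
    equation: 2 \<open>\<phi>\<close> is a multiple of pi, so the squares of sine and cosine do not
    notice the shift.\<close>
  define \<psi> where "\<psi> x = 2 * ?\<theta> (T / 2) - ?\<theta> (T - x)" for x
  have sq: "(cos (\<psi> x))\<^sup>2 = (cos (?\<theta> (T - x)))\<^sup>2" "(sin (\<psi> x))\<^sup>2 = (sin (?\<theta> (T - x)))\<^sup>2" for x
  proof -
    have e: "\<psi> x = (2 * \<phi> - ?\<theta> (T - x)) + 2 * real j * pi"
      unfolding \<psi>_def half by (simp add: algebra_simps)
    have c: "cos (\<psi> x) = cos (2 * \<phi> - ?\<theta> (T - x))" and s: "sin (\<psi> x) = sin (2 * \<phi> - ?\<theta> (T - x))"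
      unfolding e cos_add sin_add sin_2npi cos_2npi by auto
    have sc2: "sin (2 * \<phi>) = 0" "(cos (2 * \<phi>))\<^sup>2 = 1"
      by (rule disjE[OF \<phi>]; erule ssubst; simp)+
    show "(cos (\<psi> x))\<^sup>2 = (cos (?\<theta> (T - x)))\<^sup>2"
      unfolding c cos_diff sc2(1) using sc2(2) by (simp add: power_mult_distrib)
    show "(sin (\<psi> x))\<^sup>2 = (sin (?\<theta> (T - x)))\<^sup>2"
      unfolding s sin_diff sc2(1) using sc2(2) by (simp add: power_mult_distrib)
  qed
  have P\<psi>: "pruefer_angle S (T / 2) T (pot R l ?u) \<psi>"
    unfolding pruefer_angle_def
  proof (intro conjI ballI)
    have "continuous_on {0..T} ?\<theta>" using shot_angle(1)[OF R] by (auto simp: pruefer_angle_def)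
    moreover have "continuous_on {T/2..T} (\<lambda>x. T - x)" by (intro continuous_intros)
    moreover have "(\<lambda>x. T - x) ` {T/2..T} \<subseteq> {0..T}" using T_pos by auto
    ultimately have "continuous_on {T/2..T} (\<lambda>x. ?\<theta> (T - x))" by (rule continuous_on_compose2)
    then show "continuous_on {T/2..T} \<psi>" unfolding \<psi>_def by (intro continuous_intros)
    fix x assume x: "x \<in> {T / 2<..<T} - S"
    have d: "((\<lambda>x. T - x) has_real_derivative - 1) (at x)" by (auto intro!: derivative_eq_intros)
    have "(?\<theta> has_real_derivative (cos (?\<theta> (T - x)))\<^sup>2 + pot R l ?u (T - x) * (sin (?\<theta> (T - x)))\<^sup>2) (at (T - x))"
      using shot_angle(1)[OF R] flip[OF x] by (auto simp: pruefer_angle_def)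
    from DERIV_chain2[OF this d]
    have "(\<psi> has_real_derivative (cos (?\<theta> (T - x)))\<^sup>2 + pot R l ?u (T - x) * (sin (?\<theta> (T - x)))\<^sup>2) (at x)"
      unfolding \<psi>_def by (auto intro!: derivative_eq_intros)
    also have "pot R l ?u (T - x) = pot R l ?u x"
      using u[of x] x T_pos \<epsilon>(2) a_reflect[of x] flip[OF x] by (auto simp: pot_def)
    finally show "(\<psi> has_real_derivative (cos (\<psi> x))\<^sup>2 + pot R l ?u x * (sin (\<psi> x))\<^sup>2) (at x)"
      unfolding sq .
  qed
  have "?\<theta> T = \<psi> T"
  proof (rule pruefer_angle_unique[OF fin_S pruefer_angle_subset[OF shot_angle(1)[OF R]] P\<psi>])
    show "\<bar>pot R l ?u x\<bar> \<le> \<bar>l\<bar> + Ca * R\<^sup>2" if "x \<in> {T/2<..<T} - S" for x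
      by (rule pot_bound(1)[OF R]) (use that T_pos in auto)
  qed (use T_pos in \<open>auto simp: \<psi>_def\<close>)
  then show "?\<theta> T = \<phi> + 2 * real j * pi"
    unfolding \<psi>_def half by (simp add: shot_angle[OF R])
qed

text \<open>Forward propagation: on the range where the angle is below \<open>m\<pi>\<close> there are at most \<open>m\<close>
  sign changes, and \<open>growth\<close> bounds the solution between two of them.\<close>

lemma shot_forward_bound:
  assumes R: "0 \<le> R" and A: "0 < A" and \<mu>: "0 \<le> \<mu>" "- \<mu>\<^sup>2 \<le> l" and \<Lambda>: "\<bar>l\<bar> \<le> \<Lambda>"
    and \<tau>: "\<tau> \<in> {0..T}" and pos: "0 \<le> shot_angle R \<phi> l A \<tau>"
    and K: "\<bar>shot_u R \<phi> l A \<tau>\<bar> \<le> K" "\<bar>shot_v R \<phi> l A \<tau>\<bar> \<le> K"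
  shows "t \<in> {\<tau>..T} \<Longrightarrow> shot_angle R \<phi> l A t \<le> real m * pi \<Longrightarrow>
    \<bar>shot_u R \<phi> l A t\<bar> \<le> (growth \<mu> \<Lambda> Ca T ^^ m) K \<and> \<bar>shot_v R \<phi> l A t\<bar> \<le> (growth \<mu> \<Lambda> Ca T ^^ m) K"
proof (induction m arbitrary: t)
  let ?u = "shot_u R \<phi> l A" and ?v = "shot_v R \<phi> l A" and ?\<theta> = "shot_angle R \<phi> l A"
  let ?q = "pot R l ?u" and ?G = "growth \<mu> \<Lambda> Ca T"
  note cross = pruefer_crossing[OF shot_angle(1)[OF R, where l = l and \<phi> = \<phi> and A = A] pot_bound(1)[OF R]]
  case 0
  have "t = \<tau>"
  proof (rule ccontr)
    assume "t \<noteq> \<tau>"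
    then have "real 0 * pi < ?\<theta> t" using cross[of \<tau> t 0] 0 \<tau> pos by auto
    then show False using 0 by simp
  qed
  then show ?case using K by simp
next
  let ?u = "shot_u R \<phi> l A" and ?v = "shot_v R \<phi> l A" and ?\<theta> = "shot_angle R \<phi> l A"
  let ?q = "pot R l ?u" and ?G = "growth \<mu> \<Lambda> Ca T"
  note cross = pruefer_crossing[OF shot_angle(1)[OF R, where l = l and \<phi> = \<phi> and A = A] pot_bound(1)[OF R]]
  have K0: "0 \<le> K" using K(1) by linarith
  have \<Lambda>0: "0 \<le> \<Lambda>" using \<Lambda> by linarith
  have G_ge: "x \<le> ?G x" if "0 \<le> x" for x
    using growth_ge[OF \<mu>(1) \<Lambda>0 Ca_nonneg _ that] T_pos by simp
  have G_it: "K \<le> (?G ^^ i) K" for i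
  proof (induction i)
    case (Suc i)
    then show ?case using G_ge[of "(?G ^^ i) K"] K0 by simp
  qed simp
  case (Suc m)
  show ?case
  proof (cases "?\<theta> t \<le> real m * pi")
    case True
    have "(?G ^^ m) K \<le> (?G ^^ Suc m) K" using G_ge[of "(?G ^^ m) K"] G_it[of m] K0 by simp
    then show ?thesis using Suc.IH[OF Suc.prems(1) True] by linarith
  next
    case False
    \<comment> \<open>The point s is where the angle passes m pi, or \<open>\<tau>\<close> if the
      angle starts beyond that value. Between s and t the angle stays in one interval of length pi,
      so u has constant sign, up to zeros at the ends.\<close>
    have "\<exists>s. \<tau> \<le> s \<and> s \<le> t \<and> real m * pi \<le> ?\<theta> s \<and> \<bar>?u s\<bar> \<le> (?G ^^ m) K \<and> \<bar>?v s\<bar> \<le> (?G ^^ m) K"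
    proof (cases "real m * pi < ?\<theta> \<tau>")
      case True
      then show ?thesis using Suc.prems K G_it[of m] by (intro exI[of _ \<tau>]) auto
    next
      case le: False
      have "continuous_on {0..T} ?\<theta>" using shot_angle(1)[OF R] by (auto simp: pruefer_angle_def)
      then have "continuous_on {\<tau>..t} ?\<theta>"
        by (rule continuous_on_subset) (use Suc.prems \<tau> in auto)
      then have "\<exists>s\<ge>\<tau>. s \<le> t \<and> ?\<theta> s = real m * pi"
        by (intro IVT') (use le False Suc.prems in auto)
      then obtain s where s: "\<tau> \<le> s" "s \<le> t" "?\<theta> s = real m * pi" by blast
      then show ?thesis using Suc.IH[of s] Suc.prems by (intro exI[of _ s]) auto
    qed
    then obtain s where s: "\<tau> \<le> s" "s \<le> t" "real m * pi \<le> ?\<theta> s"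
      and Ks: "\<bar>?u s\<bar> \<le> (?G ^^ m) K" "\<bar>?v s\<bar> \<le> (?G ^^ m) K" by blast
    have tT: "t \<le> T" and \<tau>0: "0 \<le> \<tau>" using Suc.prems \<tau> by auto
    define c :: real where "c = (- 1) ^ m"
    have c: "\<bar>c\<bar> = 1" by (simp add: c_def power_abs)
    have sgn: "0 \<le> c * ?u x" if x: "x \<in> {s..t}" for x
    proof -
      have "real m * pi \<le> ?\<theta> x" using cross[of s x m] s x tT \<tau>0 by (cases "x = s") auto
      moreover have "?\<theta> x \<le> (real m + 1) * pi"
      proof (rule ccontr)
        assume "\<not> ?\<theta> x \<le> (real m + 1) * pi"
        then have *: "real (Suc m) * pi < ?\<theta> x" by (simp add: add.commute)
        then have "real (Suc m) * pi < ?\<theta> t"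
          using cross[of x t "Suc m"] s x tT \<tau>0 by (cases "x = t") auto
        then show False using Suc.prems(2) by linarith
      qed
      ultimately have "0 \<le> c * sin (?\<theta> x)" unfolding c_def by (rule sin_sign)
      moreover obtain \<rho> where "0 < \<rho>" "?u x = \<rho> * sin (?\<theta> x)"
        using shot_radius[OF R A, of x \<phi> l] x s tT \<tau>0 by auto
      ultimately show ?thesis by (metis mult.left_commute mult_nonneg_nonneg less_imp_le)
    qed
    have "\<bar>c * ?u t\<bar> \<le> ?G ((?G ^^ m) K) \<and> \<bar>c * ?v t\<bar> \<le> ?G ((?G ^^ m) K)"
    proof (rule growth_bound[OF fin_S linear_ode_scale[OF linear_ode_subset[OF shot(1)[OF R]]] s(2) \<mu>(1) _ _ sgn])
      fix x assume x: "x \<in> {s<..<t} - S"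
      then have x': "x \<in> {0<..<T} - S" using s tT \<tau>0 by auto
      show "- \<mu>\<^sup>2 \<le> ?q x" using pot_bound(2)[OF R x', of l ?u] \<mu> by linarith
      have "a x * trunc_square R (?u x) \<le> Ca * (?u x)\<^sup>2"
        using a_nonneg[OF x'] a_le[OF x'] Ca_nonneg by (intro mult_mono trunc_square_le_square R) auto
      moreover have "(c * ?u x)\<^sup>2 = (?u x)\<^sup>2" unfolding power_mult_distrib
        using c by (metis mult_1 one_power2 power2_abs)
      ultimately show "?q x \<le> \<Lambda> + Ca * (c * ?u x)\<^sup>2" using \<Lambda> by (simp add: pot_def)
    qed (use s tT \<tau>0 Ca_nonneg \<Lambda>0 c Ks in \<open>auto simp: abs_mult\<close>)
    then show ?thesis using c by (simp add: abs_mult)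
  qed
qed

text \<open>One of \<open>2k+1\<close> equal subintervals of an interval with \<open>a \<ge> c\<close> is free of sign changes.\<close>

lemma shot_bounded_somewhere:
  assumes R: "0 \<le> R" and A: "0 < A" and \<mu>: "0 \<le> \<mu>" "- \<mu>\<^sup>2 \<le> l"
    and pq: "p < q" "{p..q} \<subseteq> {0<..<T/2} - S" and c: "0 < c" "\<And>x. x \<in> {p..q} \<Longrightarrow> c \<le> a x"
    and \<phi>: "0 \<le> \<phi>" "\<phi> < pi" and fin: "shot_angle R \<phi> l A T = \<phi> + 2 * real k * pi"
  defines "d \<equiv> (q - p) / real (2 * k + 1)"
  defines "K0 \<equiv> \<mu> + exp (2 * \<mu> * (d / 4)) / (d / 4)"
  defines "K1 \<equiv> sqrt ((4 * K0 / d + 1 + \<mu>\<^sup>2) / c)"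
  assumes RK: "K1 < R"
  shows "\<exists>x\<in>{p..q}. \<bar>shot_u R \<phi> l A x\<bar> \<le> K1 \<and> \<bar>shot_v R \<phi> l A x\<bar> \<le> K0 * K1"
proof -
  let ?u = "shot_u R \<phi> l A" and ?v = "shot_v R \<phi> l A" and ?\<theta> = "shot_angle R \<phi> l A"
  let ?q = "pot R l ?u"
  note cross = pruefer_crossing[OF shot_angle(1)[OF R, where l = l and \<phi> = \<phi> and A = A] pot_bound(1)[OF R]]
  define s where "s i = p + real i * d" for i
  have d: "0 < d" using pq by (simp add: d_def)
  have s_mono: "s i < s (Suc i)" for i using d by (simp add: s_def algebra_simps)
  have s_end: "s (2 * k + 1) = q" by (simp add: s_def d_def)
  have s_in: "s i \<in> {p..q}" if "i \<le> 2 * k + 1" for i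
  proof -
    have "real i * d \<le> real (2 * k + 1) * d" using that d by (intro mult_right_mono) auto
    also have "\<dots> = q - p" by (simp add: d_def)
    finally show ?thesis using d by (simp add: s_def)
  qed
  have pq0: "0 < p" "q < T / 2" "q < T"
    using subsetD[OF pq(2), of p] subsetD[OF pq(2), of q] pq(1) T_pos by auto
  \<comment> \<open>If no subinterval kept the angle between two consecutive multiples of pi, the
    angle would pass a further multiple in each of them and reach (2k + 1) pi at q, beyond its final
    value phi + 2 k pi, since phi < pi.\<close>
  have "\<exists>i\<le>2 * k. \<exists>j. \<forall>x\<in>{s i..s (Suc i)}. real j * pi \<le> ?\<theta> x \<and> ?\<theta> x \<le> (real j + 1) * pi"
  proof (rule ccontr)
    assume contra: "\<not> ?thesis"
    have "real i * pi \<le> ?\<theta> (s i)" if "i \<le> 2 * k + 1" for i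
      using that
    proof (induction i)
      case 0
      have "real 0 * pi < ?\<theta> (s 0)"
        by (rule cross) (use pq0 pq(1) \<phi> shot_angle(2)[OF R] in \<open>auto simp: s_def\<close>)
      then show ?case by simp
    next
      case (Suc i)
      then have IH: "real i * pi \<le> ?\<theta> (s i)" by simp
      obtain x where x: "x \<in> {s i..s (Suc i)}" "\<not> (real i * pi \<le> ?\<theta> x \<and> ?\<theta> x \<le> (real i + 1) * pi)"
        using contra Suc.prems by (metis Suc_eq_plus1 add_le_cancel_right)
      have b: "0 \<le> s i" "s (Suc i) \<le> T" using s_in[of i] s_in[of "Suc i"] Suc.prems pq0 by auto
      have "real i * pi \<le> ?\<theta> x" using cross[of "s i" x i] IH x(1) b by (cases "x = s i") auto
      then have *: "real (Suc i) * pi < ?\<theta> x" using x(2) by (simp add: add.commute)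
      then have "real (Suc i) * pi < ?\<theta> (s (Suc i))"
        using cross[of x "s (Suc i)" "Suc i"] x(1) b by (cases "x = s (Suc i)") auto
      then show ?case by simp
    qed
    from this[of "2 * k + 1"] have "real (2 * k + 1) * pi \<le> ?\<theta> q" by (simp only: s_end order_refl)
    then have "real (2 * k + 1) * pi < ?\<theta> T" by (rule cross[rotated -1]) (use pq0 pq(1) in auto)
    then show False using fin \<phi> by (simp add: algebra_simps)
  qed
  then obtain i j where i: "i \<le> 2 * k"
    and j: "\<And>x. x \<in> {s i..s (Suc i)} \<Longrightarrow> real j * pi \<le> ?\<theta> x \<and> ?\<theta> x \<le> (real j + 1) * pi" by blast
  have sub: "{s i..s (Suc i)} \<subseteq> {p..q}" using s_in[of i] s_in[of "Suc i"] i by auto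
  have len: "s (Suc i) - s i = d" by (simp add: s_def algebra_simps)
  define e :: real where "e = (- 1) ^ j"
  have e: "\<bar>e\<bar> = 1" by (simp add: e_def power_abs)
  have inT: "x \<in> {0..T}" if "x \<in> {p..q}" for x using that pq0 by auto
  have "\<exists>x\<in>{s i<..<s (Suc i)} - S. \<bar>e * ?v x\<bar> \<le> K0 * \<bar>e * ?u x\<bar> \<and> ?q x \<le> 4 * K0 / d + 1"
    unfolding K0_def len[symmetric]
  proof (rule potential_bound_without_sign_change[OF fin_S linear_ode_scale[OF linear_ode_subset[OF shot(1)[OF R]]] s_mono \<mu>(1)])
    show "0 \<le> s i" "s (Suc i) \<le> T" using s_in[of i] s_in[of "Suc i"] i pq0 by auto
    fix x
    show "- \<mu>\<^sup>2 \<le> ?q x" if "x \<in> {s i<..<s (Suc i)} - S"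
    proof -
      have "x \<in> {0<..<T} - S" using that sub pq0 pq by force
      then show ?thesis using pot_bound(2)[OF R, of x l ?u] \<mu> by force
    qed
    assume x: "x \<in> {s i..s (Suc i)}"
    then have xT: "x \<in> {0..T}" using sub inT by blast
    obtain \<rho> where "0 < \<rho>" "?u x = \<rho> * sin (?\<theta> x)" using shot_radius[OF R A xT, of \<phi> l] by auto
    moreover have "0 \<le> e * sin (?\<theta> x)" unfolding e_def using j[OF x] by (intro sin_sign) auto
    ultimately show "0 \<le> e * ?u x" by (metis mult.left_commute mult_nonneg_nonneg less_imp_le)
    show "e * ?u x \<noteq> 0 \<or> e * ?v x \<noteq> 0" using shot_nonvanishing[OF R _ xT, of A \<phi> l] A e by auto
  qed
  then obtain x where x: "x \<in> {s i<..<s (Suc i)} - S" "\<bar>?v x\<bar> \<le> K0 * \<bar>?u x\<bar>" "?q x \<le> 4 * K0 / d + 1"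
    using e by (auto simp: abs_mult)
  have xpq: "x \<in> {p..q}" using x(1) sub by auto
  have K0: "0 \<le> K0" using \<mu> d by (simp add: K0_def)
  have K1: "0 \<le> K1" "K1\<^sup>2 = (4 * K0 / d + 1 + \<mu>\<^sup>2) / c" using K0 d c by (auto simp: K1_def)
  have "c * trunc_square R (?u x) \<le> a x * trunc_square R (?u x)"
    using c(2)[OF xpq] by (intro mult_right_mono) auto
  also have "\<dots> \<le> 4 * K0 / d + 1 + \<mu>\<^sup>2" using x(3) \<mu>(2) by (simp add: pot_def)
  \<comment> \<open>Division by c > 0 turns the bound for the weight times the truncated square into
    a bound for the minimum of |u| and R; as R exceeds K1, this minimum is |u|.\<close>
  finally have "trunc_square R (?u x) \<le> K1\<^sup>2" unfolding K1(2) using c by (simp add: pos_le_divide_eq mult.commute)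
  then have "min \<bar>?u x\<bar> R \<le> K1" unfolding trunc_square_def using K1(1) by (rule power2_le_imp_le)
  then have u: "\<bar>?u x\<bar> \<le> K1" using RK by auto
  have "K0 * \<bar>?u x\<bar> \<le> K0 * K1" by (rule mult_left_mono[OF u K0])
  then show ?thesis using x(2) u xpq by force
qed

section \<open>The bound for nodal shots, uniform in the truncation\<close>

lemma interval_of_positivity:
  obtains p q c where "p < q" "{p..q} \<subseteq> {0<..<T/2} - S" "0 < c" "\<And>x. x \<in> {p..q} \<Longrightarrow> c \<le> a x"
proof -
  obtain x0 where x0: "x0 \<in> {0<..<T/2} - S" "0 < a x0" using a_nontrivial by blast
  have op: "open ({0<..<T/2} - S)" using fin_S by (intro open_Diff finite_imp_closed) auto
  have "continuous_on ({0<..<T/2} - S) a" by (rule continuous_on_subset[OF a_cont]) auto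
  then have "open (({0<..<T/2} - S) \<inter> a -` {a x0 / 2<..})"
    by (rule continuous_open_preimage[OF _ op]) auto
  moreover have "x0 \<in> ({0<..<T/2} - S) \<inter> a -` {a x0 / 2<..}" using x0 by auto
  ultimately obtain e where e: "e > 0" "cball x0 e \<subseteq> ({0<..<T/2} - S) \<inter> a -` {a x0 / 2<..}"
    by (meson open_contains_cball)
  have I: "{x0 - e..x0 + e} \<subseteq> ({0<..<T/2} - S) \<inter> a -` {a x0 / 2<..}"
    using e by (auto simp: cball_eq_atLeastAtMost)
  show ?thesis
  proof (rule that[of "x0 - e" "x0 + e" "a x0 / 2"])
    show "{x0 - e..x0 + e} \<subseteq> {0<..<T/2} - S" using I by blast
    show "a x0 / 2 \<le> a x" if "x \<in> {x0 - e..x0 + e}" for x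
      using subsetD[OF I that] by auto
  qed (use e x0 in auto)
qed

text \<open>\<open>M\<close> and \<open>R0\<close> are chosen before \<open>R\<close>, which is the
  point of the statement. \<open>shot_bounded_somewhere\<close> gives a point of the left half where
  u and v are bounded; forward propagation reaches the whole right half, and the symmetry of the
  shot carries the bound back, in place of a backward estimate.\<close>

lemma a_priori_bound:
  assumes \<phi>: "\<phi> = 0 \<or> \<phi> = pi / 2"
  shows "\<exists>M\<ge>0. \<exists>R0\<ge>0. \<forall>R\<ge>R0. \<forall>l\<in>{l0..l1}. \<forall>A>0. shot_angle R \<phi> l A (T / 2) = \<phi> + real k * pi \<longrightarrow>
    (\<forall>x\<in>{0..T}. \<bar>shot_u R \<phi> l A x\<bar> \<le> M \<and> \<bar>shot_v R \<phi> l A x\<bar> \<le> M)"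
proof -
  obtain p q c where pq: "p < q" "{p..q} \<subseteq> {0<..<T/2} - S"
    and c: "0 < c" "\<And>x. x \<in> {p..q} \<Longrightarrow> c \<le> a x" by (rule interval_of_positivity) blast
  \<comment> \<open>Chosen so that mu^2 \<ge> |l0|; the value 1 + |l0| avoids a square root.\<close>
  define \<mu> where "\<mu> = 1 + \<bar>l0\<bar>"
  define \<Lambda> where "\<Lambda> = \<bar>l0\<bar> + \<bar>l1\<bar>"
  define d where "d = (q - p) / real (2 * k + 1)"
  define K0 where "K0 = \<mu> + exp (2 * \<mu> * (d / 4)) / (d / 4)"
  define K1 where "K1 = sqrt ((4 * K0 / d + 1 + \<mu>\<^sup>2) / c)"
  define K where "K = K1 + K0 * K1"
  \<comment> \<open>The final angle phi + 2 k pi lies below (2k + 1) pi, so 2k + 1 applications of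
    \<open>growth\<close> are enough.\<close>
  define M where "M = (growth \<mu> \<Lambda> Ca T ^^ (2 * k + 1)) K"
  have \<mu>: "0 \<le> \<mu>" by (simp add: \<mu>_def)
  have d: "0 < d" using pq by (simp add: d_def)
  have K0: "0 \<le> K0" using \<mu> d by (simp add: K0_def)
  have K1: "0 \<le> K1" using K0 d c by (auto simp: K1_def)
  have \<phi>': "0 \<le> \<phi>" "\<phi> < pi" by (rule disjE[OF \<phi>]; erule ssubst; simp)+
  have bound: "\<bar>shot_u R \<phi> l A x\<bar> \<le> M \<and> \<bar>shot_v R \<phi> l A x\<bar> \<le> M"
    if Rl: "K1 + 1 \<le> R" "l \<in> {l0..l1}" "0 < A" and half: "shot_angle R \<phi> l A (T / 2) = \<phi> + real k * pi"
      and x: "x \<in> {0..T}" for R l A x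
  proof -
    have R: "0 \<le> R" using Rl K1 by simp
    have "\<bar>l0\<bar> \<le> \<mu>\<^sup>2" unfolding \<mu>_def by (simp add: power2_eq_square algebra_simps)
    then have l\<mu>: "- \<mu>\<^sup>2 \<le> l" using Rl by auto
    have l\<Lambda>: "\<bar>l\<bar> \<le> \<Lambda>" using Rl by (auto simp: \<Lambda>_def)
    note sym = shot_symmetric[OF R \<phi> half]
    have "K1 < R" using Rl by simp
    then have "\<exists>x\<in>{p..q}. \<bar>shot_u R \<phi> l A x\<bar> \<le> K1 \<and> \<bar>shot_v R \<phi> l A x\<bar> \<le> K0 * K1"
      unfolding K1_def K0_def d_def
      by (intro shot_bounded_somewhere[OF R Rl(3) \<mu> l\<mu> pq c \<phi>' sym(3)])
    then obtain \<tau> where \<tau>: "\<tau> \<in> {p..q}" "\<bar>shot_u R \<phi> l A \<tau>\<bar> \<le> K1" "\<bar>shot_v R \<phi> l A \<tau>\<bar> \<le> K0 * K1" by blast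
    have "0 \<le> K0 * K1" using K0 K1 by simp
    with \<tau> K1 have \<tau>K: "\<bar>shot_u R \<phi> l A \<tau>\<bar> \<le> K" "\<bar>shot_v R \<phi> l A \<tau>\<bar> \<le> K" by (auto simp: K_def)
    have \<tau>0: "0 < \<tau>" "\<tau> < T / 2" using \<tau>(1) pq(2) by auto
    note cross = pruefer_crossing[OF shot_angle(1)[OF R, where l = l and \<phi> = \<phi> and A = A] pot_bound(1)[OF R]]
    have "real 0 * pi < shot_angle R \<phi> l A \<tau>"
      by (rule cross) (use \<tau>0 \<phi>' shot_angle(2)[OF R] in auto)
    then have pos: "0 \<le> shot_angle R \<phi> l A \<tau>" by simp
    have right: "\<bar>shot_u R \<phi> l A t\<bar> \<le> M \<and> \<bar>shot_v R \<phi> l A t\<bar> \<le> M" if t: "t \<in> {T/2..T}" for t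
      unfolding M_def
    proof (rule shot_forward_bound[OF R Rl(3) \<mu> l\<mu> l\<Lambda> _ pos \<tau>K])
      show "shot_angle R \<phi> l A t \<le> real (2 * k + 1) * pi"
      proof (rule ccontr)
        assume "\<not> ?thesis"
        then have *: "real (2 * k + 1) * pi < shot_angle R \<phi> l A t" by simp
        then have "real (2 * k + 1) * pi < shot_angle R \<phi> l A T"
          using cross[of t T "2 * k + 1"] t T_pos by (cases "t = T") auto
        then show False using sym(3) \<phi>' by (simp add: algebra_simps)
      qed
    qed (use \<tau>0 t T_pos in auto)
    show ?thesis
    proof (cases "T / 2 \<le> x")
      case True then show ?thesis using right[of x] x by simp
    next
      case False
      then have "\<bar>shot_u R \<phi> l A (T - x)\<bar> \<le> M \<and> \<bar>shot_v R \<phi> l A (T - x)\<bar> \<le> M"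
        using right[of "T - x"] x by simp
      then show ?thesis unfolding sym(1)[OF x] sym(2)[OF x] by (auto split: if_splits)
    qed
  qed
  show ?thesis
  proof (rule exI[of _ "\<bar>M\<bar>"], intro conjI exI[of _ "K1 + 1"] allI impI ballI)
    fix R l A x
    assume "K1 + 1 \<le> R" "l \<in> {l0..l1}" "0 < A" "shot_angle R \<phi> l A (T / 2) = \<phi> + real k * pi" "x \<in> {0..T}"
    from bound[OF this] show "\<bar>shot_u R \<phi> l A x\<bar> \<le> \<bar>M\<bar>" "\<bar>shot_v R \<phi> l A x\<bar> \<le> \<bar>M\<bar>" by auto
  qed (use K1 in auto)
qed

section \<open>Strict comparison and the signs on the edges of the parameter rectangle\<close>

lemma constant_potential_angle:
  assumes \<phi>: "\<phi> = 0 \<or> \<phi> = pi / 2" and k: "1 \<le> k"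
    and P: "pruefer_angle S 0 T (\<lambda>_. (2 * pi * real k / T)\<^sup>2) \<theta>" and init: "\<theta> 0 = \<phi>"
  shows "\<theta> (T / 2) = \<phi> + real k * pi"
  by (rule pruefer_angle_constant_potential_end[OF fin_S _ _ _ \<phi> pruefer_angle_subset[OF P] init])
     (use T_pos k in auto)

text \<open>Strict Sturm comparison with the constant potential whose angle at T/2 is exactly phi +
  k pi. Equality at T/2 would make the two angles coincide on the left half, and then the two
  potentials as well.\<close>

lemma angle_comparison:
  assumes \<phi>: "\<phi> = 0 \<or> \<phi> = pi / 2" and k: "1 \<le> k"
    and cont: "continuous_on ({0<..<T} - S) q" and B: "\<And>x. x \<in> {0<..<T} - S \<Longrightarrow> \<bar>q x\<bar> \<le> B"
    and P: "pruefer_angle S 0 T q \<theta>" and init: "\<theta> 0 = \<phi>"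
    and ne: "\<exists>x\<in>{0<..<T/2} - S. q x \<noteq> (2 * pi * real k / T)\<^sup>2"
  shows "(\<And>x. x \<in> {0<..<T} - S \<Longrightarrow> (2 * pi * real k / T)\<^sup>2 \<le> q x) \<Longrightarrow> \<phi> + real k * pi < \<theta> (T / 2)"
    and "(\<And>x. x \<in> {0<..<T} - S \<Longrightarrow> q x \<le> (2 * pi * real k / T)\<^sup>2) \<Longrightarrow> \<theta> (T / 2) < \<phi> + real k * pi"
proof -
  let ?c = "(2 * pi * real k / T)\<^sup>2"
  define \<psi> where "\<psi> = angle \<phi> (\<lambda>_. ?c)"
  have \<psi>: "pruefer_angle S 0 T (\<lambda>_. ?c) \<psi>" "\<psi> 0 = \<phi>"
    unfolding \<psi>_def by (rule angle[where B = ?c]; simp)+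
  have mid: "\<psi> (T / 2) = \<phi> + real k * pi" by (rule constant_potential_angle[OF \<phi> k \<psi>])
  have half: "pruefer_angle S 0 (T / 2) q \<theta>" "pruefer_angle S 0 (T / 2) (\<lambda>_. ?c) \<psi>"
    using P \<psi> T_pos by (auto elim!: pruefer_angle_subset)
  have contra: False if "\<And>x. x \<in> {0..T/2} \<Longrightarrow> \<theta> x = \<psi> x"
  proof -
    have "pruefer_angle S 0 (T / 2) q \<psi>"
      unfolding pruefer_angle_def
    proof (intro conjI ballI)
      show "continuous_on {0..T/2} \<psi>" using half(2) by (simp add: pruefer_angle_def)
      fix x assume x: "x \<in> {0<..<T/2} - S"
      have "(\<theta> has_real_derivative (cos (\<theta> x))\<^sup>2 + q x * (sin (\<theta> x))\<^sup>2) (at x)"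
        using half(1) x by (auto simp: pruefer_angle_def)
      moreover have "\<theta> x = \<psi> x" using that x by simp
      ultimately have "(\<theta> has_vector_derivative (cos (\<psi> x))\<^sup>2 + q x * (sin (\<psi> x))\<^sup>2) (at x)"
        by (simp add: has_real_derivative_iff_has_vector_derivative)
      then show "(\<psi> has_real_derivative (cos (\<psi> x))\<^sup>2 + q x * (sin (\<psi> x))\<^sup>2) (at x)"
        unfolding has_real_derivative_iff_has_vector_derivative
        by (rule has_vector_derivative_transform_within_open[of _ _ _ "{0<..<T/2}"]) (use x that in auto)
    qed
    moreover obtain x where x: "x \<in> {0<..<T/2} - S" "q x \<noteq> ?c" using ne by blast
    moreover have "continuous_on ({0<..<T/2} - S) q" by (rule continuous_on_subset[OF cont]) auto
    ultimately show False
      using pruefer_angle_eq_imp_potential_eq[OF fin_S _ half(2) _ _ x(1), of q] by auto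
  qed
  have T2: "0 \<le> T / 2" using T_pos by simp
  have half_sub: "x \<in> {0<..<T/2} - S \<Longrightarrow> x \<in> {0<..<T} - S" for x using T_pos by auto
  show "\<phi> + real k * pi < \<theta> (T / 2)" if ge: "\<And>x. x \<in> {0<..<T} - S \<Longrightarrow> ?c \<le> q x"
  proof (rule ccontr)
    assume "\<not> ?thesis"
    then have "\<theta> (T / 2) \<le> \<psi> (T / 2)" using mid by simp
    from pruefer_angle_mono(2)[OF fin_S half(2,1) B[OF half_sub] ge[OF half_sub] _ this] init \<psi>(2)
    show False by (intro contra) auto
  qed
  show "\<theta> (T / 2) < \<phi> + real k * pi" if le: "\<And>x. x \<in> {0<..<T} - S \<Longrightarrow> q x \<le> ?c"
  proof (rule ccontr)
    assume "\<not> ?thesis"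
    then have "\<psi> (T / 2) \<le> \<theta> (T / 2)" using mid by simp
    from pruefer_angle_mono(2)[OF fin_S half(1,2) _ le[OF half_sub] _ this, of ?c] init \<psi>(2)
    show False by (intro contra) auto
  qed
qed

text \<open>Unique continuation: if u vanished wherever the weight is positive in the left half, it
  would vanish on an interval together with v, hence everywhere. This makes the comparison with the
  linear equation strict for a nonzero shot.\<close>

lemma nontrivial_somewhere:
  assumes L: "linear_ode S 0 T q u v" and B: "\<And>x. x \<in> {0<..<T} - S \<Longrightarrow> \<bar>q x\<bar> \<le> B"
    and nz: "y \<in> {0..T}" "u y \<noteq> 0 \<or> v y \<noteq> 0"
  shows "\<exists>x\<in>{0<..<T/2} - S. 0 < a x \<and> u x \<noteq> 0"
proof (rule ccontr)
  assume contra: "\<not> ?thesis"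
  obtain p r c where pq: "p < r" "{p..r} \<subseteq> {0<..<T/2} - S"
    and c: "0 < c" "\<And>x. x \<in> {p..r} \<Longrightarrow> c \<le> a x" by (rule interval_of_positivity) blast
  have u0: "u x = 0" if "x \<in> {p..r}" for x
    using contra that pq(2) c by force
  let ?m = "(p + r) / 2"
  have m: "?m \<in> {p<..<r}" using pq by auto
  have mT: "?m \<in> {0<..<T} - S" using subsetD[OF pq(2), of ?m] m T_pos by auto
  have "(u has_real_derivative v ?m) (at ?m)" using L mT by (auto simp: linear_ode_def)
  then have "v ?m = 0" by (rule derivative_of_locally_zero[OF _ m]) (use u0 in auto)
  moreover have "u ?m = 0" using u0[of ?m] m by auto
  ultimately have "u y = 0 \<and> v y = 0"
    by (intro linear_ode_vanishing[OF fin_S L B _ _ _ nz(1)]) (use mT in auto)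
  then show False using nz by simp
qed

lemma shot_zero:
  assumes R: "0 \<le> R" and x: "x \<in> {0..T}"
  shows "shot_u R \<phi> l 0 x = 0" "shot_v R \<phi> l 0 x = 0"
proof -
  have "shot_u R \<phi> l 0 x = 0 \<and> shot_v R \<phi> l 0 x = 0"
    by (rule linear_ode_vanishing[OF fin_S shot(1)[OF R] pot_bound(1)[OF R] _ _ _ x, of 0])
       (use shot(2,3)[OF R] T_pos in auto)
  then show "shot_u R \<phi> l 0 x = 0" "shot_v R \<phi> l 0 x = 0" by auto
qed

text \<open>For A = 0 the potential is the constant \<open>l\<close>. This gives the sign on the
  bottom edge of the rectangle and the zero in its right corner.\<close>

lemma shot_angle_trivial:
  assumes \<phi>: "\<phi> = 0 \<or> \<phi> = pi / 2" and k: "1 \<le> k" and R: "0 \<le> R"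
  shows "shot_angle R \<phi> ((2 * pi * real k / T)\<^sup>2) 0 (T / 2) = \<phi> + real k * pi"
    and "l < (2 * pi * real k / T)\<^sup>2 \<Longrightarrow> shot_angle R \<phi> l 0 (T / 2) < \<phi> + real k * pi"
proof -
  have pot: "pot R l (shot_u R \<phi> l 0) x = l" if "x \<in> {0<..<T} - S" for l x
    using shot_zero(1)[OF R, of x \<phi> l] that R by (simp add: pot_def trunc_square_def)
  have P: "pruefer_angle S 0 T (\<lambda>_. l) (shot_angle R \<phi> l 0)" for l
    by (rule pruefer_angle_cong[OF shot_angle(1)[OF R] pot])
  show "shot_angle R \<phi> ((2 * pi * real k / T)\<^sup>2) 0 (T / 2) = \<phi> + real k * pi"
    by (rule constant_potential_angle[OF \<phi> k P shot_angle(2)[OF R]])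
  assume l: "l < (2 * pi * real k / T)\<^sup>2"
  have "0 < T / 2" using T_pos by simp
  from open_interval_minus_finite_nonempty[OF this fin_S]
  have "\<exists>x\<in>{0<..<T/2} - S. l \<noteq> (2 * pi * real k / T)\<^sup>2" using l by blast
  from angle_comparison(2)[OF \<phi> k _ _ P shot_angle(2)[OF R] this, of "\<bar>l\<bar>"]
  show "shot_angle R \<phi> l 0 (T / 2) < \<phi> + real k * pi" using l by auto
qed

text \<open>On the right edge q is at least the eigenvalue and exceeds it somewhere, because a
  positive truncation level keeps the truncated square of a nonzero value positive. The corner A = 0
  is thus the only zero on that edge.\<close>

lemma shot_angle_above:
  assumes \<phi>: "\<phi> = 0 \<or> \<phi> = pi / 2" and k: "1 \<le> k" and R: "0 < R" and A: "0 < A"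
  shows "\<phi> + real k * pi < shot_angle R \<phi> ((2 * pi * real k / T)\<^sup>2) A (T / 2)"
proof -
  let ?l = "(2 * pi * real k / T)\<^sup>2"
  have R0: "0 \<le> R" using R by simp
  have "\<exists>x\<in>{0<..<T/2} - S. 0 < a x \<and> shot_u R \<phi> ?l A x \<noteq> 0"
    by (rule nontrivial_somewhere[OF shot(1)[OF R0] pot_bound(1)[OF R0] _ shot_nonvanishing[OF R0], where y = 0])
       (use A T_pos in auto)
  then obtain x where x: "x \<in> {0<..<T/2} - S" "0 < a x" "shot_u R \<phi> ?l A x \<noteq> 0" by blast
  then have "trunc_square R (shot_u R \<phi> ?l A x) \<noteq> 0" using R by (simp add: trunc_square_def min_def)
  then have "\<exists>x\<in>{0<..<T/2} - S. pot R ?l (shot_u R \<phi> ?l A) x \<noteq> ?l"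
    using x by (intro bexI[OF _ x(1)]) (simp add: pot_def)
  from angle_comparison(1)[OF \<phi> k pot_cont[OF shot_cont(1)[OF R0]] pot_bound(1)[OF R0] shot_angle[OF R0] this]
  show ?thesis using pot_bound(2)[OF R0] by blast
qed

end

section \<open>Zero continua in the plane\<close>

text \<open>Brouwer's theorem for p - (h p, f p), clamped to the rectangle. At a fixed point a
  component could be nonzero only on an edge against which the map pushes, and there the sign
  conditions exclude it.\<close>

lemma poincare_miranda:
  fixes f h :: "real \<times> real \<Rightarrow> real"
  assumes ab: "a \<le> b" and cd: "c \<le> d"
    and f: "continuous_on ({a..b} \<times> {c..d}) f" and h: "continuous_on ({a..b} \<times> {c..d}) h"
    and left: "\<And>y. y \<in> {c..d} \<Longrightarrow> h (a, y) \<le> 0" and right: "\<And>y. y \<in> {c..d} \<Longrightarrow> 0 \<le> h (b, y)"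
    and bottom: "\<And>x. x \<in> {a..b} \<Longrightarrow> f (x, c) \<le> 0" and top: "\<And>x. x \<in> {a..b} \<Longrightarrow> 0 \<le> f (x, d)"
  obtains p where "p \<in> {a..b} \<times> {c..d}" "f p = 0" "h p = 0"
proof -
  let ?R = "{a..b} \<times> {c..d}"
  let ?G = "\<lambda>p. (max a (min b (fst p - h p)), max c (min d (snd p - f p)))"
  have "continuous_on ?R ?G" by (intro continuous_intros f h)
  moreover have "?G \<in> ?R \<rightarrow> ?R" using ab cd by auto
  moreover have "compact ?R" "convex ?R" "?R \<noteq> {}"
    using ab cd by (auto intro!: compact_Times convex_Times)
  ultimately obtain p where p: "p \<in> ?R" "?G p = p" using brouwer[of ?R ?G] by blast
  obtain x y where xy: "p = (x, y)" by (cases p)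
  have x: "max a (min b (x - h p)) = x" "x \<in> {a..b}" and y: "max c (min d (y - f p)) = y" "y \<in> {c..d}"
    using p by (auto simp: xy)
  have "h p = 0"
  proof (rule ccontr)
    assume "h p \<noteq> 0"
    then consider "0 < h p" "x = a" | "h p < 0" "x = b" using x by (auto simp: max_def min_def split: if_splits)
    then show False using left[OF y(2)] right[OF y(2)] by cases (auto simp: xy)
  qed
  moreover have "f p = 0"
  proof (rule ccontr)
    assume "f p \<noteq> 0"
    then consider "0 < f p" "y = c" | "f p < 0" "y = d" using y by (auto simp: max_def min_def split: if_splits)
    then show False using bottom[OF x(2)] top[OF x(2)] by cases (auto simp: xy)
  qed
  ultimately show ?thesis using that p(1) by blast
qed

text \<open>If the component of the zero set did not reach the left edge, it could be separated from it
  by a relatively clopen set; a Urysohn function for the separation contradicts the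
  Poincare--Miranda theorem.\<close>

lemma zero_continuum_in_rectangle:
  fixes f :: "real \<times> real \<Rightarrow> real"
  assumes ab: "a < b" and cd: "c \<le> d" and f: "continuous_on ({a..b} \<times> {c..d}) f"
    and bottom: "\<And>x. x \<in> {a..b} \<Longrightarrow> f (x, c) \<le> 0" and top: "\<And>x. x \<in> {a..b} \<Longrightarrow> 0 \<le> f (x, d)"
    and y0: "y0 \<in> {c..d}" "f (b, y0) = 0"
    and right: "\<And>y. y \<in> {c..d} \<Longrightarrow> f (b, y) = 0 \<Longrightarrow> y = y0"
  obtains C y where "connected C" "C \<subseteq> {a..b} \<times> {c..d}" "\<And>p. p \<in> C \<Longrightarrow> f p = 0"
    "(b, y0) \<in> C" "(a, y) \<in> C"
proof -
  let ?R = "{a..b} \<times> {c..d}"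
  define Z where "Z = {p \<in> ?R. f p = 0}"
  have cR: "compact ?R" by (intro compact_Times compact_Icc)
  have "closedin (top_of_set ?R) (?R \<inter> f -` {0})" by (rule continuous_closedin_preimage[OF f]) auto
  moreover have "?R \<inter> f -` {0} = Z" by (auto simp: Z_def)
  ultimately have cZ: "compact Z" using closedin_compact[OF cR] by metis
  define C where "C = connected_component_set Z (b, y0)"
  have pZ: "(b, y0) \<in> Z" using ab y0 by (auto simp: Z_def)
  then have CZ: "C \<in> components Z" by (auto simp: C_def components_def)
  have C: "connected C" "C \<subseteq> Z" "(b, y0) \<in> C"
    using pZ by (auto simp: C_def connected_component_subset connected_component_refl_eq)
  show ?thesis
  proof (cases "\<exists>y. (a, y) \<in> C")
    case True
    then show ?thesis using that[OF C(1) _ _ C(3)] C(2) by (force simp: Z_def)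
  next
    case False
    let ?left = "{a} \<times> {c..d}" and ?right = "{b} \<times> {c..d}"
    have "compact C" using compact_components[OF cZ CZ] .
    moreover have "open (- ?left)" by (intro open_Compl closed_Times) auto
    moreover have "C \<subseteq> - ?left" using False by auto
    \<comment> \<open>Sura-Bura: in a compact set a component has arbitrarily small relatively
      clopen compact neighbourhoods, here one that misses the left edge.\<close>
    ultimately obtain K where K: "openin (top_of_set Z) K" "compact K" "C \<subseteq> K" "K \<subseteq> - ?left"
      using Sura_Bura_clopen_subset[OF closed_imp_locally_compact[OF compact_imp_closed[OF cZ]] CZ] by metis
    have "closedin (top_of_set Z) (Z - K)"
      using closedin_diff[OF closedin_topspace[of "top_of_set Z"] K(1)] by simp
    then have cZK: "compact (Z - K)" using closedin_compact[OF cZ] by blast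
    \<comment> \<open>A function that is - 1 on \<open>?P\<close> and 1 on \<open>?Q\<close> has the
      boundary signs required of h and no zero on Z. On the right edge the two sets do not meet,
      because the only zero there belongs to C and so to K.\<close>
    let ?P = "(Z - K) \<union> ?left" and ?Q = "K \<union> ?right"
    have KZ: "K \<subseteq> Z" using K(1) openin_imp_subset by blast
    have disj: "?P \<inter> ?Q = {}"
    proof -
      have "(Z - K) \<inter> ?right = {}"
      proof (rule equals0I)
        fix p assume "p \<in> (Z - K) \<inter> ?right"
        then obtain y where "p = (b, y)" "y \<in> {c..d}" "f (b, y) = 0" "p \<notin> K" by (auto simp: Z_def)
        then show False using right[of y] C(3) K(3) by auto
      qed
      moreover have "?left \<inter> ?right = {}" using ab by auto
      ultimately show ?thesis using K(4) by blast
    qed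
    have "closed ?P" "closed ?Q"
      using compact_imp_closed[OF cZK] compact_imp_closed[OF K(2)] by (auto intro!: closed_Un closed_Times)
    then obtain h :: "real \<times> real \<Rightarrow> real" where h: "continuous_on UNIV h"
      "\<And>p. p \<in> ?P \<Longrightarrow> h p = - 1" "\<And>p. p \<in> ?Q \<Longrightarrow> h p = 1"
      using Urysohn[OF _ _ disj, of "- 1 :: real" 1] by metis
    have "continuous_on ?R h" by (rule continuous_on_subset[OF h(1)]) auto
    then obtain p where p: "p \<in> ?R" "f p = 0" "h p = 0"
      by (rule poincare_miranda[OF less_imp_le[OF ab] cd f _ _ _ bottom top]) (use h in auto)
    then have "p \<in> Z" by (simp add: Z_def)
    then have "p \<in> ?P \<or> p \<in> ?Q" by blast
    then have "h p = - 1 \<or> h p = 1" using h(2,3) by blast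
    then show ?thesis using p(3) by auto
  qed
qed

section \<open>A continuum of shooting parameters\<close>

context piecewise_weight
begin

text \<open>The rectangle is \<open>{l0..s}\<close> times \<open>{0..M + 1}\<close>. On its top edge
  the initial vector exceeds the bound M, so the function has no zero there and keeps the positive
  sign that comparison gives at the right end. The truncation level exceeds M, so every zero belongs
  to a solution of the original equation.\<close>

lemma shooting_continuum:
  assumes \<phi>: "\<phi> = 0 \<or> \<phi> = pi / 2" and k: "1 \<le> k"
  defines "s \<equiv> (2 * pi * real k / T)\<^sup>2"
  assumes l0: "l0 \<le> s"
  obtains R Z where "0 < R" "connected Z" "(s, 0) \<in> Z" "\<exists>A. (l0, A) \<in> Z"
    "\<And>l A. (l, A) \<in> Z \<Longrightarrow> 0 \<le> A \<and> shot_angle R \<phi> l A (T / 2) = \<phi> + real k * pi \<and> (A = 0 \<longrightarrow> l = s) \<and>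
      (\<forall>x\<in>{0..T}. \<bar>shot_u R \<phi> l A x\<bar> \<le> R)"
proof -
  obtain M R0 where M: "0 \<le> M" and R0: "0 \<le> R0"
    and bound: "\<forall>R\<ge>R0. \<forall>l\<in>{l0..s}. \<forall>A>0. shot_angle R \<phi> l A (T / 2) = \<phi> + real k * pi \<longrightarrow>
      (\<forall>x\<in>{0..T}. \<bar>shot_u R \<phi> l A x\<bar> \<le> M \<and> \<bar>shot_v R \<phi> l A x\<bar> \<le> M)"
    using a_priori_bound[OF \<phi>, of l0 s k] by blast
  \<comment> \<open>Above \<open>R0\<close>, so that the a priori bound applies, above
    \<open>M\<close>, so that the truncation is inactive on nodal shots, and positive.\<close>
  define R where "R = R0 + M + 1"
  have R: "0 < R" "0 \<le> R" "R0 \<le> R" "M \<le> R" using M R0 by (auto simp: R_def)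
  have M_bound: "\<bar>shot_u R \<phi> l A x\<bar> \<le> M \<and> \<bar>shot_v R \<phi> l A x\<bar> \<le> M"
    if "l \<in> {l0..s}" "0 < A" "shot_angle R \<phi> l A (T / 2) = \<phi> + real k * pi" "x \<in> {0..T}" for l A x
    using bound R(3) that by blast
  define f where "f p = shot_angle R \<phi> (fst p) (snd p) (T / 2) - (\<phi> + real k * pi)" for p
  have T2: "T / 2 \<in> {0..T}" using T_pos by auto
  have fc: "continuous_on A f" for A
    unfolding f_def using shot_angle_continuous[OF R(2) T2] by (intro continuous_intros) (rule continuous_on_subset, auto)
  have triv: "f (s, 0) = 0" "l < s \<Longrightarrow> f (l, 0) < 0" for l
    unfolding f_def s_def using shot_angle_trivial[OF \<phi> k R(2)] by auto
  have above: "0 < f (s, A)" if "0 < A" for A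
    unfolding f_def s_def using shot_angle_above[OF \<phi> k R(1) that] by simp
  have good: "0 \<le> A \<and> shot_angle R \<phi> l A (T / 2) = \<phi> + real k * pi \<and> (A = 0 \<longrightarrow> l = s) \<and>
      (\<forall>x\<in>{0..T}. \<bar>shot_u R \<phi> l A x\<bar> \<le> R)" if "l \<in> {l0..s}" "0 \<le> A" "f (l, A) = 0" for l A
  proof -
    have *: "shot_angle R \<phi> l A (T / 2) = \<phi> + real k * pi" using that by (simp add: f_def)
    moreover have "A = 0 \<longrightarrow> l = s" using triv(2)[of l] that by force
    moreover have "\<bar>shot_u R \<phi> l A x\<bar> \<le> R" if x: "x \<in> {0..T}" for x
    proof (cases "A = 0")
      case True
      then show ?thesis using shot_zero(1)[OF R(2) x] R(2) by simp
    next
      case False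
      then show ?thesis using M_bound[of l A x] that * \<open>l \<in> _\<close> \<open>0 \<le> A\<close> R(4) by force
    qed
    ultimately show ?thesis using \<open>0 \<le> A\<close> by blast
  qed
  show ?thesis
  proof (cases "l0 = s")
    case True
    show ?thesis
    proof (rule that[OF R(1), of "{(s, 0)}"])
      show "\<exists>A. (l0, A) \<in> {(s, 0)}" using True by auto
      fix l A assume "(l, A) \<in> {(s, 0 :: real)}"
      then show "0 \<le> A \<and> shot_angle R \<phi> l A (T / 2) = \<phi> + real k * pi \<and> (A = 0 \<longrightarrow> l = s) \<and>
        (\<forall>x\<in>{0..T}. \<bar>shot_u R \<phi> l A x\<bar> \<le> R)"
        by (intro good) (use True triv in auto)
    qed auto
  next
    case False
    then have lt: "l0 < s" using l0 by simp
    \<comment> \<open>One of sin phi and cos phi equals 1, so the initial vector has an entry M + 1,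
      which contradicts the bound M at the point 0.\<close>
    have nz: "f (l, M + 1) \<noteq> 0" if l: "l \<in> {l0..s}" for l
    proof
      assume "f (l, M + 1) = 0"
      then have "\<bar>shot_u R \<phi> l (M + 1) 0\<bar> \<le> M \<and> \<bar>shot_v R \<phi> l (M + 1) 0\<bar> \<le> M"
        by (intro M_bound l) (use M T_pos in \<open>auto simp: f_def\<close>)
      then have *: "\<bar>(M + 1) * sin \<phi>\<bar> \<le> M" "\<bar>(M + 1) * cos \<phi>\<bar> \<le> M"
        unfolding shot(2,3)[OF R(2)] by auto
      have "sin \<phi> = 1 \<or> cos \<phi> = 1" by (rule disjE[OF \<phi>]; erule ssubst; simp)
      then show False using * by auto
    qed
    have top: "0 \<le> f (l, M + 1)" if l: "l \<in> {l0..s}" for l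
    proof (rule ccontr)
      assume "\<not> 0 \<le> f (l, M + 1)"
      moreover have "continuous_on {l..s} (\<lambda>l. f (l, M + 1))"
        by (rule continuous_on_compose2[OF fc[of UNIV]]) (auto intro!: continuous_intros)
      ultimately have "\<exists>x\<ge>l. x \<le> s \<and> f (x, M + 1) = 0"
        using above[of "M + 1"] M l by (intro IVT') auto
      then show False using nz l by auto
    qed
    obtain C y where C: "connected C" "C \<subseteq> {l0..s} \<times> {0..M + 1}" "\<And>p. p \<in> C \<Longrightarrow> f p = 0"
      "(s, 0) \<in> C" "(l0, y) \<in> C"
    proof (rule zero_continuum_in_rectangle[OF lt _ fc _ top, where ?y0.0 = 0])
      show "f (l, 0) \<le> 0" if "l \<in> {l0..s}" for l using triv(1) triv(2)[of l] that by (cases "l = s") auto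
      show "y = 0" if "y \<in> {0..M + 1}" "f (s, y) = 0" for y using above[of y] that by force
    qed (use M triv in auto)
    show ?thesis
    proof (rule that[OF R(1) C(1) C(4)])
      show "\<exists>A. (l0, A) \<in> C" using C(5) by blast
      fix l A assume "(l, A) \<in> C"
      then show "0 \<le> A \<and> shot_angle R \<phi> l A (T / 2) = \<phi> + real k * pi \<and> (A = 0 \<longrightarrow> l = s) \<and>
        (\<forall>x\<in>{0..T}. \<bar>shot_u R \<phi> l A x\<bar> \<le> R)"
        using C(2,3) by (intro good) auto
    qed
  qed
qed

end

section \<open>Weak derivatives\<close>

lemma power2_le_of_abs_le: "\<bar>x\<bar> \<le> B \<Longrightarrow> x\<^sup>2 \<le> B\<^sup>2" for x B :: real
  by (metis abs_ge_zero power2_abs power_mono)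

lemma square_integrable_mult:
  assumes "square_integrable T u" "square_integrable T v"
  shows "integrable (lebesgue_on {0..T}) (\<lambda>t. u t * v t)"
proof (rule Bochner_Integration.integrable_bound)
  show "integrable (lebesgue_on {0..T}) (\<lambda>t. (u t)\<^sup>2 + (v t)\<^sup>2)"
    using assms by (auto simp: square_integrable_def)
  show "(\<lambda>t. u t * v t) \<in> borel_measurable (lebesgue_on {0..T})"
    using assms by (auto simp: square_integrable_def)
  show "AE t in lebesgue_on {0..T}. norm (u t * v t) \<le> norm ((u t)\<^sup>2 + (v t)\<^sup>2)"
  proof (rule AE_I2)
    fix t
    have "2 * (\<bar>u t\<bar> * \<bar>v t\<bar>) \<le> (u t)\<^sup>2 + (v t)\<^sup>2"
      using sum_squares_bound[of "\<bar>u t\<bar>" "\<bar>v t\<bar>"] by (simp add: mult.assoc)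
    moreover have "0 \<le> \<bar>u t\<bar> * \<bar>v t\<bar>" by simp
    ultimately show "norm (u t * v t) \<le> norm ((u t)\<^sup>2 + (v t)\<^sup>2)"
      unfolding real_norm_def abs_mult using abs_ge_self[of "(u t)\<^sup>2 + (v t)\<^sup>2"] by linarith
  qed
qed

lemma bounded_imp_square_integrable:
  assumes "u \<in> borel_measurable (lebesgue_on {0..T})" "AE t in lebesgue_on {0..T}. \<bar>u t\<bar> \<le> B"
  shows "square_integrable T u"
  unfolding square_integrable_def
proof
  show "integrable (lebesgue_on {0..T}) (\<lambda>t. (u t)\<^sup>2)"
  proof (rule Bochner_Integration.integrable_bound)
    show "integrable (lebesgue_on {0..T}) (\<lambda>t. B\<^sup>2)" by auto
    show "AE t in lebesgue_on {0..T}. norm ((u t)\<^sup>2) \<le> norm (B\<^sup>2)"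
      using assms(2) by eventually_elim (auto intro: power2_le_of_abs_le)
  qed (use assms in auto)
qed (rule assms)

lemma square_integrable_const: "square_integrable T (\<lambda>_. c)"
  by (rule bounded_imp_square_integrable[of _ _ "\<bar>c\<bar>"]) auto

lemma square_integrable_imp_integrable:
  "square_integrable T u \<Longrightarrow> integrable (lebesgue_on {0..T}) u"
  using square_integrable_mult[OF _ square_integrable_const[of T 1], of u] by simp

lemma square_integrable_scale:
  "square_integrable T u \<Longrightarrow> square_integrable T (\<lambda>t. c * u t)"
  unfolding square_integrable_def by (auto simp: power_mult_distrib)

lemma square_integrable_add:
  assumes "square_integrable T u" "square_integrable T v"
  shows "square_integrable T (\<lambda>t. u t + v t)"
  using assms square_integrable_mult[OF assms]
  unfolding square_integrable_def power2_sum mult.assoc by auto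

lemma square_integrable_diff:
  assumes "square_integrable T u" "square_integrable T v"
  shows "square_integrable T (\<lambda>t. u t - v t)"
  using square_integrable_add[OF assms(1) square_integrable_scale[OF assms(2), of "- 1"]] by simp

lemma square_integrable_off_finite:
  assumes "finite S" "continuous_on ({0<..<T} - S) f" "\<And>x. x \<in> {0<..<T} - S \<Longrightarrow> \<bar>f x\<bar> \<le> B"
  shows "square_integrable T f"
proof -
  have "f absolutely_integrable_on {0..T}"
    by (rule integrable_continuous_off_finite[OF assms(1,2)]) (use assms(3) in auto)
  moreover have "(\<lambda>x. (f x)\<^sup>2) absolutely_integrable_on {0..T}"
  proof (rule integrable_continuous_off_finite[OF assms(1)])
    show "continuous_on ({0<..<T} - S) (\<lambda>x. (f x)\<^sup>2)" by (intro continuous_intros assms(2))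
    show "norm ((f x)\<^sup>2) \<le> B\<^sup>2" if "x \<in> {0<..<T} - S" for x
      using assms(3)[OF that] by (auto intro: power2_le_of_abs_le)
  qed
  ultimately show ?thesis
    unfolding square_integrable_def
    by (auto dest!: absolutely_integrable_imp_integrable intro: borel_measurable_integrable)
qed

lemma continuous_square_integrable:
  assumes "continuous_on {0..T} f"
  shows "square_integrable T f"
proof -
  have "bounded (f ` {0..T})" by (intro compact_imp_bounded compact_continuous_image assms) auto
  then obtain B where "\<forall>y\<in>f ` {0..T}. norm y \<le> B" unfolding bounded_iff by blast
  then show ?thesis
    by (intro square_integrable_off_finite[of "{}"] continuous_on_subset[OF assms]) auto
qed

lemma lebesgue_integral_Icc:
  fixes f :: "real \<Rightarrow> real"
  assumes "integrable (lebesgue_on {0..T}) f"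
  shows "integral\<^sup>L (lebesgue_on {0..T}) f = integral {0..T} f" "f integrable_on {0..T}"
  using lebesgue_integral_eq_integral[OF assms] integrable_on_lebesgue_on[OF assms] by auto

section \<open>Ramps, tents and their limits\<close>

lemma has_real_derivative_max_square:
  "((\<lambda>x::real. (max 0 x)\<^sup>2) has_real_derivative 2 * max 0 x) (at x)"
proof -
  consider "x < 0" | "x = 0" | "0 < x" by linarith
  then show ?thesis
  proof cases
    case 1
    have "((\<lambda>_::real. 0) has_real_derivative 2 * max 0 x) (at x)" using 1 by simp
    then show ?thesis
      unfolding has_real_derivative_iff_has_vector_derivative
      by (rule has_vector_derivative_transform_within_open[of _ _ _ "{..<0}"]) (use 1 in auto)
  next
    case 2
    have "((\<lambda>h::real. max 0 h) \<longlongrightarrow> 0) (at 0)" by (auto intro!: tendsto_eq_intros)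
    then have "((\<lambda>h::real. ((max 0 (0 + h))\<^sup>2 - (max 0 0)\<^sup>2) / h) \<longlongrightarrow> 0) (at 0)"
      by (rule Lim_transform_eventually)
         (auto simp: max_def power2_eq_square eventually_at_filter)
    then show ?thesis using 2 by (simp add: DERIV_def)
  next
    case 3
    have "((\<lambda>x::real. x\<^sup>2) has_real_derivative 2 * max 0 x) (at x)"
      using 3 by (auto intro!: derivative_eq_intros)
    then show ?thesis
      unfolding has_real_derivative_iff_has_vector_derivative
      by (rule has_vector_derivative_transform_within_open[of _ _ _ "{0<..}"]) (use 3 in auto)
  qed
qed

text \<open>A quadratic spline that rises from 0 at \<open>s\<close> to 1 at \<open>s + e\<close>; its derivative is a tent.\<close>

definition ramp :: "real \<Rightarrow> real \<Rightarrow> real \<Rightarrow> real" where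
  "ramp s e x = 2 * ((max 0 ((x - s) / e))\<^sup>2 - 2 * (max 0 ((x - s) / e - 1 / 2))\<^sup>2 + (max 0 ((x - s) / e - 1))\<^sup>2)"

definition tent :: "real \<Rightarrow> real \<Rightarrow> real \<Rightarrow> real" where
  "tent s e x = 4 / e * (max 0 ((x - s) / e) - 2 * max 0 ((x - s) / e - 1 / 2) + max 0 ((x - s) / e - 1))"

lemma ramp_deriv: "0 < e \<Longrightarrow> (ramp s e has_real_derivative tent s e x) (at x)"
proof -
  assume e: "0 < e"
  have d: "((\<lambda>x. (x - s) / e - c) has_real_derivative 1 / e) (at x)" for c
    using e by (auto intro!: derivative_eq_intros)
  have m: "((\<lambda>x. (max 0 ((x - s) / e - c))\<^sup>2) has_real_derivative 2 * max 0 ((x - s) / e - c) * (1 / e)) (at x)" for c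
    by (rule DERIV_chain2[OF has_real_derivative_max_square d])
  have "((\<lambda>x. 2 * ((max 0 ((x - s) / e - 0))\<^sup>2 - 2 * (max 0 ((x - s) / e - 1 / 2))\<^sup>2 + (max 0 ((x - s) / e - 1))\<^sup>2))
    has_real_derivative 2 * (2 * max 0 ((x - s) / e - 0) * (1 / e) - 2 * (2 * max 0 ((x - s) / e - 1 / 2) * (1 / e))
      + 2 * max 0 ((x - s) / e - 1) * (1 / e))) (at x)"
    by (intro DERIV_cmult DERIV_add DERIV_diff m)
  moreover have "2 * (2 * max 0 ((x - s) / e - 0) * (1 / e) - 2 * (2 * max 0 ((x - s) / e - 1 / 2) * (1 / e))
      + 2 * max 0 ((x - s) / e - 1) * (1 / e)) = tent s e x"
    by (simp add: tent_def algebra_simps)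
  ultimately show ?thesis unfolding ramp_def[abs_def] by simp
qed

lemma tent_cont: "continuous_on A (tent s e)"
  unfolding tent_def[abs_def] divide_inverse by (intro continuous_intros)

lemma ramp_cont: "continuous_on A (ramp s e)"
  unfolding ramp_def[abs_def] divide_inverse by (intro continuous_intros)

lemma ramp_simps:
  assumes "0 < e"
  shows "x \<le> s \<Longrightarrow> ramp s e x = 0" "s + e \<le> x \<Longrightarrow> ramp s e x = 1"
    "0 \<le> tent s e x" "x \<le> s \<or> s + e \<le> x \<Longrightarrow> tent s e x = 0" "\<bar>ramp s e x\<bar> \<le> 1"
proof -
  define y where "y = (x - s) / e"
  have r: "ramp s e x = 2 * ((max 0 y)\<^sup>2 - 2 * (max 0 (y - 1 / 2))\<^sup>2 + (max 0 (y - 1))\<^sup>2)"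
    and t: "tent s e x = 4 / e * (max 0 y - 2 * max 0 (y - 1 / 2) + max 0 (y - 1))"
    by (auto simp: ramp_def tent_def y_def)
  have y0: "x \<le> s \<longleftrightarrow> y \<le> 0" and y1: "s + e \<le> x \<longleftrightarrow> 1 \<le> y"
    using assms by (auto simp: y_def field_simps)
  have "y \<le> 0 \<Longrightarrow> ramp s e x = 0" unfolding r by (simp add: max_def)
  then show r0: "x \<le> s \<Longrightarrow> ramp s e x = 0" by (simp add: y0)
  have "1 \<le> y \<Longrightarrow> ramp s e x = 1" unfolding r by (simp add: max_def power2_eq_square algebra_simps)
  then show r1: "s + e \<le> x \<Longrightarrow> ramp s e x = 1" by (simp add: y1)
  have "0 \<le> max 0 y - 2 * max 0 (y - 1 / 2) + max 0 (y - 1)" by (auto simp: max_def)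
  then show "0 \<le> tent s e x" unfolding t using assms by simp
  have "y \<le> 0 \<or> 1 \<le> y \<Longrightarrow> max 0 y - 2 * max 0 (y - 1 / 2) + max 0 (y - 1) = 0" by (auto simp: max_def)
  then show "x \<le> s \<or> s + e \<le> x \<Longrightarrow> tent s e x = 0" unfolding t y0 y1 by simp
  show "\<bar>ramp s e x\<bar> \<le> 1"
  proof -
    consider "y \<le> 0" | "0 \<le> y" "y \<le> 1 / 2" | "1 / 2 \<le> y" "y \<le> 1" | "1 \<le> y" by linarith
    then show ?thesis
    proof cases
      case 1 then show ?thesis using r0 y0 by simp
    next
      case 2
      then have "ramp s e x = 2 * y\<^sup>2" unfolding r by (simp add: max_def)
      moreover have "y\<^sup>2 \<le> (1 / 2)\<^sup>2" using 2 by (intro power_mono) auto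
      ultimately show ?thesis by (simp add: power2_eq_square)
    next
      case 3
      then have "ramp s e x = 1 - 2 * (1 - y)\<^sup>2" unfolding r
        by (auto simp: max_def power2_eq_square algebra_simps)
      moreover have "(1 - y)\<^sup>2 \<le> (1 / 2)\<^sup>2" using 3 by (intro power_mono) auto
      moreover have "0 \<le> (1 - y)\<^sup>2" by simp
      ultimately show ?thesis by (simp add: power2_eq_square)
    next
      case 4 then show ?thesis using r1 y1 by simp
    qed
  qed
qed

text \<open>The difference of two ramps approximates the indicator of [s, t] and lives on
  [s, t + e]; quadratic splines are smooth enough because test functions are of class C^1
  here.\<close>

lemma ramp_diff_test_function:
  assumes "0 < e" "0 < s" "s \<le> t" "t + e < T"
  shows "test_function T (\<lambda>x. ramp s e x - ramp t e x)" "deriv (\<lambda>x. ramp s e x - ramp t e x) = (\<lambda>x. tent s e x - tent t e x)"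
proof -
  have d: "((\<lambda>x. ramp s e x - ramp t e x) has_real_derivative tent s e x - tent t e x) (at x)" for x
    by (intro DERIV_diff ramp_deriv assms)
  show "deriv (\<lambda>x. ramp s e x - ramp t e x) = (\<lambda>x. tent s e x - tent t e x)"
    using DERIV_imp_deriv[OF d] by auto
  have "{x. ramp s e x - ramp t e x \<noteq> 0} \<subseteq> {s..t + e}"
  proof
    fix x assume x: "x \<in> {x. ramp s e x - ramp t e x \<noteq> 0}"
    show "x \<in> {s..t + e}"
    proof (rule ccontr)
      assume "x \<notin> {s..t + e}"
      then consider "x \<le> s" "x \<le> t" | "s + e \<le> x" "t + e \<le> x" using assms by force
      then show False using x ramp_simps[OF assms(1)] by cases auto
    qed
  qed
  then have "closure {x. ramp s e x - ramp t e x \<noteq> 0} \<subseteq> {s..t + e}" by (rule closure_minimal) auto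
  moreover have "(\<lambda>x. ramp s e x - ramp t e x) C1_differentiable_on UNIV"
    unfolding C1_differentiable_on_def
    by (intro exI[of _ "\<lambda>x. tent s e x - tent t e x"] conjI ballI continuous_intros tent_cont)
       (use d in \<open>auto simp: has_real_derivative_iff_has_vector_derivative\<close>)
  ultimately show "test_function T (\<lambda>x. ramp s e x - ramp t e x)"
    unfolding test_function_def using assms by auto
qed

lemma continuous_measurable_Icc:
  "continuous_on {0..T} f \<Longrightarrow> f \<in> borel_measurable (lebesgue_on {0..T})" for f :: "real \<Rightarrow> real"
  by (rule continuous_imp_measurable_on_sets_lebesgue) auto

lemma inverse_Suc_lt: "0 < d \<Longrightarrow> \<forall>\<^sub>F n in sequentially. 1 / real (Suc n) < d" for d :: real
  using order_tendstoD(2)[OF LIMSEQ_inverse_real_of_nat, of d] by (simp add: inverse_eq_divide)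

text \<open>The ramps rise to the right of s, so their pointwise limit is the indicator of the open
  ray; dominated convergence applies since they are bounded by 1.\<close>

lemma ramp_integral_limit:
  fixes w :: "real \<Rightarrow> real"
  assumes w: "integrable (lebesgue_on {0..T}) w"
  shows "(\<lambda>n. LINT x|lebesgue_on {0..T}. w x * ramp s (1 / real (Suc n)) x) \<longlonglongrightarrow>
    (LINT x|lebesgue_on {0..T}. w x * indicator {s<..} x)"
proof (rule integral_dominated_convergence[where w = "\<lambda>x. \<bar>w x\<bar>"])
  have [measurable]: "w \<in> borel_measurable (lebesgue_on {0..T})" using w by auto
  have [measurable]: "ramp s e \<in> borel_measurable (lebesgue_on {0..T})" for e
    by (rule continuous_measurable_Icc[OF ramp_cont])
  have [measurable]: "(\<lambda>x. indicator {s<..} x :: real) \<in> borel_measurable (lebesgue_on {0..T})"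
    by (intro measurable_restrict_space1 borel_measurable_indicator) auto
  show "(\<lambda>x. w x * indicator {s<..} x) \<in> borel_measurable (lebesgue_on {0..T})" by measurable
  show "(\<lambda>x. w x * ramp s (1 / real (Suc n)) x) \<in> borel_measurable (lebesgue_on {0..T})" for n by measurable
  show "integrable (lebesgue_on {0..T}) (\<lambda>x. \<bar>w x\<bar>)" using w by auto
  show "AE x in lebesgue_on {0..T}. norm (w x * ramp s (1 / real (Suc n)) x) \<le> \<bar>w x\<bar>" for n
    using ramp_simps(5)[of "1 / real (Suc n)" s] by (auto simp: abs_mult intro!: AE_I2 mult_left_le)
  show "AE x in lebesgue_on {0..T}. (\<lambda>n. w x * ramp s (1 / real (Suc n)) x) \<longlonglongrightarrow> w x * indicator {s<..} x"
  proof (rule AE_I2)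
    fix x
    have "\<forall>\<^sub>F n in sequentially. ramp s (1 / real (Suc n)) x = indicator {s<..} x"
    proof (cases "x \<le> s")
      case True
      then show ?thesis using ramp_simps(1)[OF _ True] by (auto intro!: always_eventually)
    next
      case False
      then have "\<forall>\<^sub>F n in sequentially. 1 / real (Suc n) < x - s" by (intro inverse_Suc_lt) auto
      then show ?thesis
      proof eventually_elim
        case (elim n)
        then have "ramp s (1 / real (Suc n)) x = 1" by (intro ramp_simps(2)) auto
        then show ?case using False by simp
      qed
    qed
    then have "(\<lambda>n. ramp s (1 / real (Suc n)) x) \<longlonglongrightarrow> indicator {s<..} x" by (rule tendsto_eventually)
    then show "(\<lambda>n. w x * ramp s (1 / real (Suc n)) x) \<longlonglongrightarrow> w x * indicator {s<..} x"
      by (intro tendsto_intros)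
  qed
qed

text \<open>The tent has integral 1 and lives on [s, s + e], so it is a one-sided approximate
  identity; continuity of u at s gives the limit.\<close>

lemma tent_integral_limit:
  fixes u :: "real \<Rightarrow> real"
  assumes u: "continuous_on {0..T} u" and s: "0 \<le> s" "s < T"
  shows "(\<lambda>n. LINT x|lebesgue_on {0..T}. u x * tent s (1 / real (Suc n)) x) \<longlonglongrightarrow> u s"
proof (rule tendstoI)
  fix r :: real assume r: "0 < r"
  have "\<exists>d>0. \<forall>x\<in>{0..T}. dist x s < d \<longrightarrow> dist (u x) (u s) < r / 2"
    using u s r unfolding continuous_on_iff by (meson atLeastAtMost_iff half_gt_zero less_imp_le)
  then obtain d where d: "0 < d" "\<And>x. x \<in> {0..T} \<Longrightarrow> dist x s < d \<Longrightarrow> dist (u x) (u s) < r / 2" by blast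
  have "\<forall>\<^sub>F n in sequentially. 1 / real (Suc n) < min d (T - s)"
    by (rule inverse_Suc_lt) (use d s in auto)
  then show "\<forall>\<^sub>F n in sequentially. dist (LINT x|lebesgue_on {0..T}. u x * tent s (1 / real (Suc n)) x) (u s) < r"
  proof eventually_elim
    case (elim n)
    define e where "e = 1 / real (Suc n)"
    have e: "0 < e" "e < d" "s + e < T" using elim by (auto simp: e_def)
    have c: "continuous_on {0..T} (\<lambda>x. u x * tent s e x)" by (intro continuous_intros u tent_cont)
    have L: "(LINT x|lebesgue_on {0..T}. u x * tent s e x) = integral {0..T} (\<lambda>x. u x * tent s e x)"
      by (rule lebesgue_integral_Icc(1)[OF square_integrable_imp_integrable[OF continuous_square_integrable[OF c]]])
    have T: "(tent s e has_integral ramp s e T - ramp s e 0) {0..T}"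
      by (rule fundamental_theorem_of_calculus)
         (use s ramp_deriv[OF e(1)] in \<open>auto simp: has_real_derivative_iff_has_vector_derivative[symmetric]
           intro: has_field_derivative_at_within\<close>)
    then have T1: "(tent s e has_integral 1) {0..T}" using ramp_simps(1,2)[OF e(1)] e s by simp
    have E: "((\<lambda>x. u s * tent s e x) has_integral u s * 1) {0..T}" by (rule has_integral_mult_right[OF T1])
    have us: "integral {0..T} (\<lambda>x. u s * tent s e x) = u s"
      using integral_unique[OF E] by (simp only: mult_1_right)
    have "integral {0..T} (\<lambda>x. u x * tent s e x) - u s
      = integral {0..T} (\<lambda>x. u x * tent s e x - u s * tent s e x)"
      unfolding Henstock_Kurzweil_Integration.integral_diff[OF integrable_continuous_real[OF c] has_integral_integrable[OF E]] us ..
    also have "norm \<dots> \<le> integral {0..T} (\<lambda>x. r / 2 * tent s e x)"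
    proof (rule integral_norm_bound_integral)
      show "(\<lambda>x. u x * tent s e x - u s * tent s e x) integrable_on {0..T}"
        "(\<lambda>x. r / 2 * tent s e x) integrable_on {0..T}"
        by (intro integrable_continuous_real continuous_intros u tent_cont)+
      fix x assume x: "x \<in> {0..T}"
      show "norm (u x * tent s e x - u s * tent s e x) \<le> r / 2 * tent s e x"
      proof (cases "x \<le> s \<or> s + e \<le> x")
        case True then show ?thesis using ramp_simps(4)[OF e(1) True] by simp
      next
        case False
        then have "dist x s < d" using e by (auto simp: dist_real_def)
        then have "\<bar>u x - u s\<bar> \<le> r / 2" using d(2)[OF x] by (simp add: dist_real_def)
        then have "\<bar>u x - u s\<bar> * \<bar>tent s e x\<bar> \<le> r / 2 * tent s e x"
          using ramp_simps(3)[OF e(1)] r by (intro mult_mono) auto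
        then show ?thesis by (simp add: abs_mult[symmetric] left_diff_distrib)
      qed
    qed
    also have "\<dots> = r / 2 * 1" by (rule integral_unique[OF has_integral_mult_right[OF T1]])
    finally show ?case using r unfolding e_def[symmetric] L by (simp add: dist_real_def)
  qed
qed

text \<open>The weak equation is tested with a difference of two ramps. As their width tends to 0,
  the tents evaluate u at s and at t, and the ramps cut out the integral of w between them.\<close>

lemma weak_derivative_ftc_interior:
  assumes W: "weak_derivative T u w" and u: "continuous_on {0..T} u" and st: "0 < s" "s \<le> t" "t < T"
  shows "integral {s..t} w = u t - u s"
proof -
  let ?M = "lebesgue_on {0..T}" and ?e = "\<lambda>n. 1 / real (Suc n)"
  have w: "integrable ?M w" using W by (auto simp: weak_derivative_def intro: square_integrable_imp_integrable)
  have t_int: "integrable ?M (\<lambda>x. u x * tent s (?e n) x)" for n s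
    by (intro square_integrable_imp_integrable continuous_square_integrable continuous_intros u tent_cont)
  have r_int: "integrable ?M (\<lambda>x. w x * ramp s (?e n) x)" for n s
    using W by (intro square_integrable_mult[OF _ continuous_square_integrable[OF ramp_cont]]) (auto simp: weak_derivative_def)
  have ev: "\<forall>\<^sub>F n in sequentially. ?e n < T - t" by (rule inverse_Suc_lt) (use st in auto)
  have "\<forall>\<^sub>F n in sequentially. (LINT x|?M. u x * tent s (?e n) x) - (LINT x|?M. u x * tent t (?e n) x)
    = - ((LINT x|?M. w x * ramp s (?e n) x) - (LINT x|?M. w x * ramp t (?e n) x))"
    using ev
  proof eventually_elim
    case (elim n)
    have e: "0 < ?e n" "t + ?e n < T" using elim st by auto
    note tf = ramp_diff_test_function[OF e(1) st(1,2) e(2)]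
    have "(LINT x|?M. u x * (tent s (?e n) x - tent t (?e n) x)) = - (LINT x|?M. w x * (ramp s (?e n) x - ramp t (?e n) x))"
      using W tf unfolding weak_derivative_def by metis
    then show ?case
      unfolding right_diff_distrib
      by (simp only: Bochner_Integration.integral_diff[OF t_int t_int] Bochner_Integration.integral_diff[OF r_int r_int])
  qed
  moreover have "(\<lambda>n. (LINT x|?M. u x * tent s (?e n) x) - (LINT x|?M. u x * tent t (?e n) x)) \<longlonglongrightarrow> u s - u t"
    using st by (intro tendsto_diff tent_integral_limit u) auto
  ultimately have "(\<lambda>n. - ((LINT x|?M. w x * ramp s (?e n) x) - (LINT x|?M. w x * ramp t (?e n) x))) \<longlonglongrightarrow> u s - u t"
    by (rule Lim_transform_eventually[rotated])
  moreover have "(\<lambda>n. - ((LINT x|?M. w x * ramp s (?e n) x) - (LINT x|?M. w x * ramp t (?e n) x)))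
    \<longlonglongrightarrow> - ((LINT x|?M. w x * indicator {s<..} x) - (LINT x|?M. w x * indicator {t<..} x))"
    by (intro tendsto_intros ramp_integral_limit w)
  ultimately have eq: "u s - u t = - ((LINT x|?M. w x * indicator {s<..} x) - (LINT x|?M. w x * indicator {t<..} x))"
    by (rule LIMSEQ_unique)
  have tail: "(LINT x|?M. w x * indicator {s<..} x) = integral {s..T} w" if "0 \<le> s" "s \<le> T" for s
  proof -
    have "integrable ?M (\<lambda>x. w x * indicator {s<..} x)"
    proof -
      have "integrable ?M (\<lambda>x. indicator ({s<..} \<inter> {0..T}) x *\<^sub>R w x)"
        by (rule integrable_mult_indicator[OF _ w]) (auto simp: sets_restrict_space_iff)
      then show ?thesis by (rule Bochner_Integration.integrable_cong[THEN iffD1, rotated -1]) (auto simp: indicator_def)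
    qed
    from lebesgue_integral_Icc(1)[OF this]
    have "(LINT x|?M. w x * indicator {s<..} x) = integral {0..T} (\<lambda>x. w x * indicator {s<..} x)" .
    also have "\<dots> = integral {0..T} (\<lambda>x. if x \<in> {s..T} then w x else 0)"
      by (rule integral_spike[of "{s}"]) (use that in \<open>auto simp: indicator_def\<close>)
    also have "\<dots> = integral {s..T} w"
      using that by (subst Henstock_Kurzweil_Integration.integral_restrict_Int) (simp add: Int_absorb2 Int_absorb1)
    finally show ?thesis .
  qed
  have "w integrable_on {s..T}"
    by (rule integrable_subinterval_real[OF lebesgue_integral_Icc(2)[OF w]]) (use st in auto)
  then have "integral {s..t} w + integral {t..T} w = integral {s..T} w"
    by (intro Henstock_Kurzweil_Integration.integral_combine) (use st in auto)
  then show ?thesis using eq tail[of s] tail[of t] st by simp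
qed

text \<open>Test functions vanish near the end points, so the formula is at first available inside
  only. There it says that u minus the integral of w is constant; both terms are continuous up to
  the ends, and the constant persists.\<close>

lemma weak_derivative_ftc:
  assumes W: "weak_derivative T u w" and u: "continuous_on {0..T} u" and st: "0 \<le> s" "s \<le> t" "t \<le> T"
  shows "integral {s..t} w = u t - u s"
proof (cases "0 < T")
  case T: True
  have w: "w integrable_on {0..T}"
    using W by (intro lebesgue_integral_Icc square_integrable_imp_integrable) (auto simp: weak_derivative_def)
  let ?F = "\<lambda>x. u x - integral {0..x} w"
  have split: "integral {0..x} w + integral {x..y} w = integral {0..y} w" if "0 \<le> x" "x \<le> y" "y \<le> T" for x y
    by (intro Henstock_Kurzweil_Integration.integral_combine integrable_subinterval_real[OF w]) (use that in auto)
  have const: "?F x = ?F (T / 2)" if x: "x \<in> {0<..<T}" for x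
  proof (cases "x \<le> T / 2")
    case True
    then show ?thesis
      using weak_derivative_ftc_interior[OF W u, of x "T / 2"] split[of x "T / 2"] x T by auto
  next
    case False
    then show ?thesis
      using weak_derivative_ftc_interior[OF W u, of "T / 2" x] split[of "T / 2" x] x T by auto
  qed
  have cl: "closure {0<..<T} = {0..T}" using T by simp
  have "continuous_on (closure {0<..<T}) ?F"
    unfolding cl by (intro continuous_intros u indefinite_integral_continuous_1 w)
  then have "?F x = ?F (T / 2)" if "x \<in> {0..T}" for x
    using continuous_constant_on_closure[of "{0<..<T}" ?F "?F (T / 2)" x] const that unfolding cl by blast
  from this[of s] this[of t] split[of s t] st show ?thesis by auto
next
  case False
  then have "s = t" using st by auto
  then show ?thesis by simp
qed

text \<open>The positive and the negative part of z are densities of two measures that are finite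
  and equal on all rays, hence equal; uniqueness of densities makes the two parts equal almost
  everywhere.\<close>

lemma AE_zero_of_interval_integrals:
  fixes z :: "real \<Rightarrow> real"
  assumes z: "integrable (lebesgue_on {0..T}) z"
    and zero: "\<And>s. 0 \<le> s \<Longrightarrow> s \<le> T \<Longrightarrow> integral {s..T} z = 0"
  shows "AE x in lebesgue_on {0..T}. z x = 0"
proof -
  define y where "y x = indicator {0..T} x *\<^sub>R z x" for x
  have y: "integrable lebesgue y"
    using z unfolding y_def by (subst (asm) integrable_restrict_space) auto
  then have "y \<in> borel_measurable (completion lborel)" by auto
  \<comment> \<open>A Borel representative is taken because densities are compared over
    \<open>lborel\<close>, whereas z is measurable for the completed measure.\<close>
  from completion_ex_borel_measurable_real[OF this]
  obtain g where g: "g \<in> borel_measurable lborel" "AE x in lborel. y x = g x" by blast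
  have ae: "AE x in lebesgue. y x = g x" using g(2) by (rule AE_completion)
  have g': "g \<in> borel_measurable lebesgue" using g(1) by (rule measurable_completion)
  have "integrable lebesgue g"
    using y ae g' by (subst integrable_cong_AE[symmetric]) auto
  then have ig: "integrable lborel g" using g(1) by (simp add: integrable_completion)
  have tail: "(LINT t|lborel. indicator {x<..} t *\<^sub>R g t) = 0" for x
  proof -
    have m: "(\<lambda>t. indicator {x<..} t *\<^sub>R g t) \<in> borel_measurable lborel" using g(1) by measurable
    have "(LINT t|lborel. indicator {x<..} t *\<^sub>R g t) = (LINT t|lebesgue. indicator {x<..} t *\<^sub>R g t)"
      by (rule integral_completion[OF m, symmetric])
    also have "\<dots> = (LINT t|lebesgue. indicator {x<..} t *\<^sub>R y t)"
    proof (rule integral_cong_AE)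
      show "(\<lambda>t. indicator {x<..} t *\<^sub>R g t) \<in> borel_measurable lebesgue" by (rule measurable_completion[OF m])
      show "(\<lambda>t. indicator {x<..} t *\<^sub>R y t) \<in> borel_measurable lebesgue"
        by (intro borel_measurable_scaleR borel_measurable_indicator borel_measurable_integrable[OF y]) auto
      show "AE t in lebesgue. indicator {x<..} t *\<^sub>R g t = indicator {x<..} t *\<^sub>R y t"
        using ae by eventually_elim auto
    qed
    also have "\<dots> = integral UNIV (\<lambda>t. indicator {x<..} t *\<^sub>R y t)"
    proof -
      have "integrable lebesgue (\<lambda>t. indicator {x<..} t *\<^sub>R y t)"
        by (rule integrable_mult_indicator[OF _ y]) auto
      then show ?thesis using lebesgue_integral_eq_integral[of UNIV "\<lambda>t. indicator {x<..} t *\<^sub>R y t"]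
        by (simp add: lebesgue_on_UNIV_eq)
    qed
    also have "\<dots> = integral UNIV (\<lambda>t. if t \<in> {max 0 x..T} then z t else 0)"
      by (rule integral_spike[of "{x}"]) (auto simp: y_def indicator_def)
    also have "\<dots> = integral {max 0 x..T} z" by (rule integral_restrict_UNIV)
    also have "\<dots> = 0" using zero[of "max 0 x"] by (cases "max 0 x \<le> T") auto
    finally show ?thesis .
  qed
  \<comment> \<open>\<open>ennreal\<close> sends negative numbers to 0, so the two densities are the
    positive and the negative part of g. Their masses on a ray differ by the integral of g over it,
    which is 0 by \<open>tail\<close>; finiteness permits the subtraction.\<close>
  have dens: "density lborel (\<lambda>t. ennreal (g t)) = density lborel (\<lambda>t. ennreal (- g t))"
  proof (rule measure_eqI_lessThan)
    fix x
    define h where "h t = indicator {x<..} t *\<^sub>R g t" for t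
    have ih: "integrable lborel h" unfolding h_def by (rule integrable_mult_indicator[OF _ ig]) auto
    have e1: "emeasure (density lborel (\<lambda>t. ennreal (g t))) {x<..} = (\<integral>\<^sup>+t. ennreal (h t) \<partial>lborel)"
      unfolding h_def using g(1)
      by (subst emeasure_density) (auto intro!: nn_integral_cong simp: indicator_def)
    have e2: "emeasure (density lborel (\<lambda>t. ennreal (- g t))) {x<..} = (\<integral>\<^sup>+t. ennreal (- h t) \<partial>lborel)"
      unfolding h_def using g(1)
      by (subst emeasure_density) (auto intro!: nn_integral_cong simp: indicator_def)
    have f1: "(\<integral>\<^sup>+t. ennreal (h t) \<partial>lborel) < \<infinity>" and f2: "(\<integral>\<^sup>+t. ennreal (- h t) \<partial>lborel) < \<infinity>"
      using ih unfolding real_integrable_def by (auto simp: less_top)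
    have "enn2real (\<integral>\<^sup>+t. ennreal (h t) \<partial>lborel) - enn2real (\<integral>\<^sup>+t. ennreal (- h t) \<partial>lborel) = 0"
      using tail[of x, folded h_def] real_lebesgue_integral_def[OF ih] by simp
    then have "(\<integral>\<^sup>+t. ennreal (h t) \<partial>lborel) = (\<integral>\<^sup>+t. ennreal (- h t) \<partial>lborel)"
      using f1 f2 by (metis eq_iff_diff_eq_0 ennreal_enn2real infinity_ennreal_def)
    then show "emeasure (density lborel (\<lambda>t. ennreal (g t))) {x<..}
        = emeasure (density lborel (\<lambda>t. ennreal (- g t))) {x<..}" unfolding e1 e2 .
    show "emeasure (density lborel (\<lambda>t. ennreal (g t))) {x<..} < \<infinity>" unfolding e1 by (rule f1)
  qed auto
  have "AE t in lborel. ennreal (g t) = ennreal (- g t)"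
    by (rule sigma_finite_measure.density_unique[OF sigma_finite_lborel _ _ dens]) (use g(1) in auto)
  then have "AE t in lborel. g t = 0"
    by eventually_elim (metis ennreal_eq_0_iff ennreal_neg le_cases neg_0_le_iff_le order_antisym neg_le_0_iff_le)
  then have "AE t in lebesgue. g t = 0" by (rule AE_completion)
  with ae have "AE t in lebesgue. y t = 0" by eventually_elim simp
  then show ?thesis
    by (subst AE_restrict_space_iff) (auto simp: y_def elim!: eventually_mono)
qed

section \<open>Uniqueness and representatives of weak derivatives; classical derivatives\<close>

lemma weak_derivative_diff:
  assumes 1: "weak_derivative T u1 v1" and 2: "weak_derivative T u2 v2"
  shows "weak_derivative T (\<lambda>t. u1 t - u2 t) (\<lambda>t. v1 t - v2 t)"
  unfolding weak_derivative_def
proof (intro conjI allI impI)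
  show "square_integrable T (\<lambda>t. u1 t - u2 t)" "square_integrable T (\<lambda>t. v1 t - v2 t)"
    using 1 2 by (auto simp: weak_derivative_def intro: square_integrable_diff)
  fix \<phi> assume \<phi>: "test_function T \<phi>"
  then obtain D where D: "\<And>x. (\<phi> has_vector_derivative D x) (at x)" "continuous_on UNIV D"
    unfolding test_function_def C1_differentiable_on_def by blast
  then have "deriv \<phi> = D"
    by (intro ext DERIV_imp_deriv) (simp add: has_real_derivative_iff_has_vector_derivative)
  then have d: "square_integrable T (deriv \<phi>)"
    using D(2) by (auto intro: continuous_square_integrable continuous_on_subset)
  have "continuous_on UNIV \<phi>"
    using D(1) by (meson continuous_at_imp_continuous_on has_vector_derivative_continuous)
  then have p: "square_integrable T \<phi>" by (auto intro: continuous_square_integrable continuous_on_subset)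
  note sq = 1[unfolded weak_derivative_def] 2[unfolded weak_derivative_def]
  have "(LINT t|lebesgue_on {0..T}. (u1 t - u2 t) * deriv \<phi> t)
    = (LINT t|lebesgue_on {0..T}. u1 t * deriv \<phi> t) - (LINT t|lebesgue_on {0..T}. u2 t * deriv \<phi> t)"
    unfolding left_diff_distrib
    by (rule Bochner_Integration.integral_diff) (use sq d in \<open>auto intro: square_integrable_mult\<close>)
  also have "\<dots> = - ((LINT t|lebesgue_on {0..T}. v1 t * \<phi> t) - (LINT t|lebesgue_on {0..T}. v2 t * \<phi> t))"
    using sq \<phi> by simp
  also have "(LINT t|lebesgue_on {0..T}. v1 t * \<phi> t) - (LINT t|lebesgue_on {0..T}. v2 t * \<phi> t)
    = (LINT t|lebesgue_on {0..T}. (v1 t - v2 t) * \<phi> t)"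
    unfolding left_diff_distrib
    by (rule Bochner_Integration.integral_diff[symmetric]) (use sq p in \<open>auto intro: square_integrable_mult\<close>)
  finally show "(LINT t|lebesgue_on {0..T}. (u1 t - u2 t) * deriv \<phi> t)
    = - (LINT t|lebesgue_on {0..T}. (v1 t - v2 t) * \<phi> t)" .
qed

text \<open>The difference of the two candidates is a weak derivative of 0, so its integrals over
  all intervals [s, T] vanish by the fundamental theorem.\<close>

lemma weak_derivative_unique:
  assumes "weak_derivative T u v1" "weak_derivative T u v2"
  shows "AE t in lebesgue_on {0..T}. v1 t = v2 t"
proof -
  have W: "weak_derivative T (\<lambda>t. 0) (\<lambda>t. v1 t - v2 t)"
    using weak_derivative_diff[OF assms] by simp
  have "AE t in lebesgue_on {0..T}. v1 t - v2 t = 0"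
  proof (rule AE_zero_of_interval_integrals)
    show "integrable (lebesgue_on {0..T}) (\<lambda>t. v1 t - v2 t)"
      using W by (auto simp: weak_derivative_def intro: square_integrable_imp_integrable)
    show "integral {s..T} (\<lambda>t. v1 t - v2 t) = 0" if "0 \<le> s" "s \<le> T" for s
      using weak_derivative_ftc[OF W _ that(1,2) order_refl] by simp
  qed
  then show ?thesis by eventually_elim simp
qed

text \<open>The chosen derivative \<open>wD T u\<close> is known up to a null set only. This allows
  it to be exchanged for a good representative before the second derivative is taken.\<close>

lemma weak_derivative_cong_left:
  assumes W: "weak_derivative T u v" and eq: "AE t in lebesgue_on {0..T}. u t = u' t"
    and u': "square_integrable T u'"
  shows "weak_derivative T u' v"
proof -
  have "(LINT t|lebesgue_on {0..T}. u' t * deriv \<phi> t) = (LINT t|lebesgue_on {0..T}. u t * deriv \<phi> t)"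
    if \<phi>: "test_function T \<phi>" for \<phi>
  proof (rule integral_cong_AE)
    obtain D where D: "\<And>x. (\<phi> has_vector_derivative D x) (at x)" "continuous_on UNIV D"
      using \<phi> unfolding test_function_def C1_differentiable_on_def by blast
    then have "deriv \<phi> = D"
      by (intro ext DERIV_imp_deriv) (simp add: has_real_derivative_iff_has_vector_derivative)
    then have [measurable]: "deriv \<phi> \<in> borel_measurable (lebesgue_on {0..T})"
      using D(2) by (auto intro: continuous_measurable_Icc continuous_on_subset)
    have [measurable]: "u \<in> borel_measurable (lebesgue_on {0..T})" "u' \<in> borel_measurable (lebesgue_on {0..T})"
      using W u' by (auto simp: weak_derivative_def square_integrable_def)
    show "(\<lambda>t. u' t * deriv \<phi> t) \<in> borel_measurable (lebesgue_on {0..T})"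
      "(\<lambda>t. u t * deriv \<phi> t) \<in> borel_measurable (lebesgue_on {0..T})" by measurable
    show "AE t in lebesgue_on {0..T}. u' t * deriv \<phi> t = u t * deriv \<phi> t"
      using eq by eventually_elim simp
  qed
  then show ?thesis using W u' unfolding weak_derivative_def by simp
qed

lemma wD_weak_derivative: "weak_derivative T u v \<Longrightarrow> weak_derivative T u (wD T u)"
  unfolding wD_def by (rule someI[of "weak_derivative T u"])

lemma wD_AE_eq: "weak_derivative T u v \<Longrightarrow> AE t in lebesgue_on {0..T}. wD T u t = v t"
  using weak_derivative_unique wD_weak_derivative by blast

lemma wD_wD_AE_eq:
  assumes "weak_derivative T u v" "weak_derivative T v w"
  shows "AE t in lebesgue_on {0..T}. wD T (wD T u) t = w t"
proof -
  have "AE t in lebesgue_on {0..T}. v t = wD T u t"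
    using wD_AE_eq[OF assms(1)] by eventually_elim simp
  moreover have "square_integrable T (wD T u)"
    using wD_weak_derivative[OF assms(1)] by (auto simp: weak_derivative_def)
  ultimately have "weak_derivative T (wD T u) w" by (rule weak_derivative_cong_left[OF assms(2)])
  then show ?thesis by (rule wD_AE_eq)
qed

text \<open>Integration by parts: the product of u with a test function is continuous,
  differentiable off \<open>S\<close>, and 0 at both ends because the support of the test function
  lies inside.\<close>

lemma classical_imp_weak_derivative:
  assumes S: "finite S" and T: "0 < T" and u: "continuous_on {0..T} u"
    and d: "\<And>x. x \<in> {0<..<T} - S \<Longrightarrow> (u has_real_derivative v x) (at x)"
    and v: "continuous_on ({0<..<T} - S) v" "\<And>x. x \<in> {0<..<T} - S \<Longrightarrow> \<bar>v x\<bar> \<le> B"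
  shows "weak_derivative T u v"
  unfolding weak_derivative_def
proof (intro conjI allI impI)
  show su: "square_integrable T u" by (rule continuous_square_integrable[OF u])
  show sv: "square_integrable T v" by (rule square_integrable_off_finite[OF S v])
  fix \<phi> assume \<phi>: "test_function T \<phi>"
  then obtain D where D: "\<And>x. (\<phi> has_vector_derivative D x) (at x)" "continuous_on UNIV D"
    unfolding test_function_def C1_differentiable_on_def by blast
  then have D': "(\<phi> has_real_derivative D x) (at x)" for x
    by (simp add: has_real_derivative_iff_has_vector_derivative)
  then have dD: "deriv \<phi> = D" using DERIV_imp_deriv by blast
  have c\<phi>: "continuous_on A \<phi>" for A
    using D(1) by (meson continuous_at_imp_continuous_on has_vector_derivative_continuous)
  have cD: "continuous_on A D" for A using D(2) continuous_on_subset by blast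
  have ends: "\<phi> 0 = 0" "\<phi> T = 0"
    using \<phi> closure_subset[of "{t. \<phi> t \<noteq> 0}"] unfolding test_function_def by force+
  let ?M = "lebesgue_on {0..T}"
  have i1: "integrable ?M (\<lambda>t. u t * D t)"
    by (rule square_integrable_mult[OF su continuous_square_integrable[OF cD]])
  have i2: "integrable ?M (\<lambda>t. v t * \<phi> t)"
    by (rule square_integrable_mult[OF sv continuous_square_integrable[OF c\<phi>]])
  have "((\<lambda>t. v t * \<phi> t + u t * D t) has_integral (u T * \<phi> T - u 0 * \<phi> 0)) {0..T}"
  proof (rule fundamental_theorem_of_calculus_interior_strong[OF S])
    show "((\<lambda>t. u t * \<phi> t) has_vector_derivative v x * \<phi> x + u x * D x) (at x)" if "x \<in> {0<..<T} - S" for x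
      unfolding has_real_derivative_iff_has_vector_derivative[symmetric]
      by (rule DERIV_cong[OF DERIV_mult[OF d[OF that] D'[of x]]]) (simp add: mult.commute)
    show "continuous_on {0..T} (\<lambda>t. u t * \<phi> t)" by (intro continuous_intros u c\<phi>)
  qed (use T in auto)
  then have "integral {0..T} (\<lambda>t. v t * \<phi> t + u t * D t) = 0" by (simp add: ends integral_unique)
  then have "integral {0..T} (\<lambda>t. v t * \<phi> t) + integral {0..T} (\<lambda>t. u t * D t) = 0"
    using Henstock_Kurzweil_Integration.integral_add[OF lebesgue_integral_Icc(2)[OF i2] lebesgue_integral_Icc(2)[OF i1]] by simp
  then show "(LINT t|?M. u t * deriv \<phi> t) = - (LINT t|?M. v t * \<phi> t)"
    unfolding dD lebesgue_integral_Icc(1)[OF i1] lebesgue_integral_Icc(1)[OF i2] by simp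
qed

lemma AE_eq_imp_eq_continuous:
  fixes f g :: "real \<Rightarrow> real"
  assumes T: "0 < T" and f: "continuous_on {0..T} f" and g: "continuous_on {0..T} g"
    and ae: "AE t in lebesgue_on {0..T}. f t = g t" and t: "t \<in> {0..T}"
  shows "f t = g t"
proof -
  let ?h = "\<lambda>t. (f t - g t)\<^sup>2"
  have h: "continuous_on {0..T} ?h" by (intro continuous_intros f g)
  have "(LINT t|lebesgue_on {0..T}. ?h t) = (LINT t|lebesgue_on {0..T}. 0)"
    by (rule integral_cong_AE) (use ae continuous_measurable_Icc[OF h] in auto)
  then have "integral {0..T} ?h = 0"
    using lebesgue_integral_Icc(1)[OF square_integrable_imp_integrable[OF continuous_square_integrable[OF h]]] by simp
  then show ?thesis using integral_eq_0_iff[OF h T] t by auto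
qed

section \<open>The metric on \<open>\<real> \<times> H\<^sup>2\<close>\<close>

definition L2norm :: "real \<Rightarrow> (real \<Rightarrow> real) \<Rightarrow> real" where
  "L2norm T u = sqrt (LINT t|lebesgue_on {0..T}. (u t)\<^sup>2)"

lemma L2norm_nonneg [simp]: "0 \<le> L2norm T u"
  by (simp add: L2norm_def)

lemma L2norm_power2: "(L2norm T u)\<^sup>2 = (LINT t|lebesgue_on {0..T}. (u t)\<^sup>2)"
  by (simp add: L2norm_def)

lemma L2_cauchy_schwarz:
  assumes u: "square_integrable T u" and v: "square_integrable T v"
  shows "\<bar>LINT t|lebesgue_on {0..T}. u t * v t\<bar> \<le> L2norm T u * L2norm T v"
proof -
  let ?M = "lebesgue_on {0..T}"
  define a where "a = (LINT t|?M. (u t)\<^sup>2)"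
  define b where "b = (LINT t|?M. (v t)\<^sup>2)"
  define c where "c = (LINT t|?M. u t * v t)"
  have iu: "integrable ?M (\<lambda>t. (u t)\<^sup>2)" and iv: "integrable ?M (\<lambda>t. (v t)\<^sup>2)"
    using u v by (auto simp: square_integrable_def)
  have iuv: "integrable ?M (\<lambda>t. u t * v t)" by (rule square_integrable_mult[OF u v])
  have a0: "0 \<le> a" and b0: "0 \<le> b" by (auto simp: a_def b_def)
  have q: "0 \<le> a - 2 * s * c + s\<^sup>2 * b" for s
  proof -
    have "0 \<le> (LINT t|?M. (u t - s * v t)\<^sup>2)" by simp
    also have "(\<lambda>t. (u t - s * v t)\<^sup>2) = (\<lambda>t. ((u t)\<^sup>2 - 2 * s * (u t * v t)) + s\<^sup>2 * (v t)\<^sup>2)"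
      by (auto simp: power2_eq_square algebra_simps)
    also have "(LINT t|?M. ((u t)\<^sup>2 - 2 * s * (u t * v t)) + s\<^sup>2 * (v t)\<^sup>2) = a - 2 * s * c + s\<^sup>2 * b"
      using iu iv iuv by (simp add: a_def b_def c_def)
    finally show ?thesis .
  qed
  have "c\<^sup>2 \<le> a * b"
  proof (cases "b = 0")
    case True
    have "c = 0"
    proof (rule ccontr)
      assume "c \<noteq> 0"
      \<comment> \<open>With b = 0 the quadratic is affine in s, and this value of s makes it equal
        to - 1.\<close>
      then have "a - 2 * ((a + 1) / (2 * c)) * c + ((a + 1) / (2 * c))\<^sup>2 * b = - 1"
        using True by (simp add: field_simps)
      then show False using q[of "(a + 1) / (2 * c)"] by linarith
    qed
    then show ?thesis using True by simp
  next
    case False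
    have "a - 2 * (c / b) * c + (c / b)\<^sup>2 * b = a - c\<^sup>2 / b"
      using False by (simp add: power2_eq_square)
    then have "c\<^sup>2 / b \<le> a" using q[of "c / b"] by linarith
    then show ?thesis using False b0 by (simp add: pos_divide_le_eq)
  qed
  then have "sqrt (c\<^sup>2) \<le> sqrt (a * b)" by (rule real_sqrt_le_mono)
  then show ?thesis by (simp add: L2norm_def real_sqrt_mult a_def b_def c_def)
qed

lemma L2norm_triangle:
  assumes u: "square_integrable T u" and v: "square_integrable T v"
  shows "L2norm T (\<lambda>t. u t + v t) \<le> L2norm T u + L2norm T v"
proof (rule power2_le_imp_le)
  let ?M = "lebesgue_on {0..T}"
  have iu: "integrable ?M (\<lambda>t. (u t)\<^sup>2)" and iv: "integrable ?M (\<lambda>t. (v t)\<^sup>2)"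
    using u v by (auto simp: square_integrable_def)
  have iuv: "integrable ?M (\<lambda>t. u t * v t)" by (rule square_integrable_mult[OF u v])
  have "(L2norm T (\<lambda>t. u t + v t))\<^sup>2 = (LINT t|?M. ((u t)\<^sup>2 + (v t)\<^sup>2) + 2 * (u t * v t))"
    unfolding L2norm_power2 power2_sum mult.assoc ..
  also have "\<dots> = (L2norm T u)\<^sup>2 + (L2norm T v)\<^sup>2 + 2 * (LINT t|?M. u t * v t)"
    unfolding L2norm_power2 using iu iv iuv by simp
  also have "\<dots> \<le> (L2norm T u)\<^sup>2 + (L2norm T v)\<^sup>2 + 2 * (L2norm T u * L2norm T v)"
    using L2_cauchy_schwarz[OF u v] by linarith
  also have "\<dots> = (L2norm T u + L2norm T v)\<^sup>2" by (simp add: power2_sum)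
  finally show "(L2norm T (\<lambda>t. u t + v t))\<^sup>2 \<le> (L2norm T u + L2norm T v)\<^sup>2" .
qed simp

lemma L2norm_uminus [simp]: "L2norm T (\<lambda>t. - u t) = L2norm T u"
  by (simp add: L2norm_def)

lemma L2norm_le:
  assumes u: "square_integrable T u" and ae: "AE t in lebesgue_on {0..T}. \<bar>u t\<bar> \<le> B" and "0 \<le> B" "0 \<le> T"
  shows "L2norm T u \<le> B * sqrt T"
proof -
  have "(LINT t|lebesgue_on {0..T}. (u t)\<^sup>2) \<le> (LINT t|lebesgue_on {0..T}. B\<^sup>2)"
  proof (rule integral_mono_AE)
    show "AE t in lebesgue_on {0..T}. (u t)\<^sup>2 \<le> B\<^sup>2"
      using ae by eventually_elim (rule power2_le_of_abs_le)
  qed (use u in \<open>auto simp: square_integrable_def\<close>)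
  also have "\<dots> = B\<^sup>2 * T"
    using lebesgue_integral_Icc(1)[OF square_integrable_imp_integrable[OF square_integrable_const], of T "B\<^sup>2"] assms(4)
    by simp
  finally have "L2norm T u \<le> sqrt (B\<^sup>2 * T)" unfolding L2norm_def by (rule real_sqrt_le_mono)
  then show ?thesis using assms(3) by (simp add: real_sqrt_mult)
qed

lemma L2norm_cong_AE:
  assumes "square_integrable T u" "square_integrable T v" "AE t in lebesgue_on {0..T}. u t = v t"
  shows "L2norm T u = L2norm T v"
  unfolding L2norm_def
  by (intro arg_cong[where f = sqrt] integral_cong_AE) (use assms in \<open>auto simp: square_integrable_def\<close>)

text \<open>Explicit representatives of the first two weak derivatives, with which norms and
  differences are computed without reference to the choice made by \<open>wD\<close>.\<close>

definition h2_jet :: "real \<Rightarrow> (real \<Rightarrow> real) \<Rightarrow> (real \<Rightarrow> real) \<Rightarrow> (real \<Rightarrow> real) \<Rightarrow> bool" where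
  "h2_jet T u v w \<longleftrightarrow> weak_derivative T u v \<and> weak_derivative T v w"

lemma h2_jet_square_integrable:
  assumes "h2_jet T u v w"
  shows "square_integrable T u" "square_integrable T v" "square_integrable T w"
  using assms by (auto simp: h2_jet_def weak_derivative_def)

lemma sobolev_norm_h2_jet:
  assumes J: "h2_jet T u v w"
  shows "sobolev_norm T 2 u = sqrt ((L2norm T u)\<^sup>2 + (L2norm T v)\<^sup>2 + (L2norm T w)\<^sup>2)"
proof -
  have 1: "weak_derivative T u v" and 2: "weak_derivative T v w" using J by (auto simp: h2_jet_def)
  have s1: "square_integrable T (wD T u)"
    using wD_weak_derivative[OF 1] by (auto simp: weak_derivative_def)
  have W: "weak_derivative T (wD T u) w"
    by (rule weak_derivative_cong_left[OF 2 _ s1]) (use wD_AE_eq[OF 1] in eventually_elim, simp)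
  have s2: "square_integrable T (wD T (wD T u))"
    using wD_weak_derivative[OF W] by (auto simp: weak_derivative_def)
  have e: "{..2::nat} = {0, 1, 2}" by auto
  have "sobolev_norm T 2 u = sqrt ((L2norm T u)\<^sup>2 + (L2norm T (wD T u))\<^sup>2 + (L2norm T (wD T (wD T u)))\<^sup>2)"
    unfolding sobolev_norm_def e L2norm_power2 by (simp add: numeral_2_eq_2)
  also have "L2norm T (wD T u) = L2norm T v"
    by (rule L2norm_cong_AE[OF s1 _ wD_AE_eq[OF 1]]) (use 1 in \<open>auto simp: weak_derivative_def\<close>)
  also have "L2norm T (wD T (wD T u)) = L2norm T w"
    by (rule L2norm_cong_AE[OF s2 _ wD_wD_AE_eq[OF 1 2]]) (use 2 in \<open>auto simp: weak_derivative_def\<close>)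
  finally show ?thesis .
qed

lemma h2_jet_diff:
  "h2_jet T u v w \<Longrightarrow> h2_jet T u' v' w' \<Longrightarrow> h2_jet T (\<lambda>t. u t - u' t) (\<lambda>t. v t - v' t) (\<lambda>t. w t - w' t)"
  unfolding h2_jet_def by (auto intro: weak_derivative_diff)

lemma L2norm_le_sobolev_norm:
  assumes "h2_jet T u v w"
  shows "L2norm T u \<le> sobolev_norm T 2 u"
  unfolding sobolev_norm_h2_jet[OF assms] by (rule real_le_rsqrt) simp

lemma sobolev_norm_le:
  assumes "h2_jet T u v w"
  shows "sobolev_norm T 2 u \<le> L2norm T u + L2norm T v + L2norm T w"
  unfolding sobolev_norm_h2_jet[OF assms]
proof (rule real_le_lsqrt)
  have "x\<^sup>2 + y\<^sup>2 + z\<^sup>2 \<le> (x + y + z)\<^sup>2" if "0 \<le> x" "0 \<le> y" "0 \<le> z" for x y z :: real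
  proof -
    have e: "(x + y + z)\<^sup>2 = x\<^sup>2 + y\<^sup>2 + z\<^sup>2 + 2 * (x * y + y * z + x * z)"
      by (simp add: power2_eq_square algebra_simps)
    have "0 \<le> x * y + y * z + x * z" using that by simp
    then show ?thesis unfolding e by simp
  qed
  then show "(L2norm T u)\<^sup>2 + (L2norm T v)\<^sup>2 + (L2norm T w)\<^sup>2 \<le> (L2norm T u + L2norm T v + L2norm T w)\<^sup>2"
    by simp
qed (intro add_nonneg_nonneg L2norm_nonneg)

text \<open>The norm is the Euclidean norm of three L^2 norms, so the triangle inequality in three
  dimensions is combined with the one for L^2 in each entry.\<close>

lemma sobolev_norm_triangle:
  assumes "h2_jet T u v w" "h2_jet T u' v' w'" "h2_jet T (\<lambda>t. u t + u' t) (\<lambda>t. v t + v' t) (\<lambda>t. w t + w' t)"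
  shows "sobolev_norm T 2 (\<lambda>t. u t + u' t) \<le> sobolev_norm T 2 u + sobolev_norm T 2 u'"
proof -
  let ?f = "\<lambda>u v w (i::nat). if i = 0 then L2norm T u else if i = 1 then L2norm T v else L2norm T w"
  have L: "sobolev_norm T 2 u = L2_set (?f u v w) {0, 1, 2}" if "h2_jet T u v w" for u v w
    unfolding sobolev_norm_h2_jet[OF that] L2_set_def by (simp add: add.assoc)
  note sq = h2_jet_square_integrable[OF assms(1)] h2_jet_square_integrable[OF assms(2)]
  have "sobolev_norm T 2 (\<lambda>t. u t + u' t)
    = L2_set (?f (\<lambda>t. u t + u' t) (\<lambda>t. v t + v' t) (\<lambda>t. w t + w' t)) {0, 1, 2}" by (rule L[OF assms(3)])
  also have "\<dots> \<le> L2_set (\<lambda>i. ?f u v w i + ?f u' v' w' i) {0, 1, 2}"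
    by (rule L2_set_mono) (auto intro!: L2norm_triangle sq)
  also have "\<dots> \<le> L2_set (?f u v w) {0, 1, 2} + L2_set (?f u' v' w') {0, 1, 2}"
    by (rule L2_set_triangle_ineq)
  finally show ?thesis using L[OF assms(1)] L[OF assms(2)] by simp
qed

section \<open>Periodic functions in H^2 and their metric\<close>

lemma sobolev_per_2D:
  assumes "u \<in> sobolev_per T 2"
  obtains v w where "h2_jet T u v w" "continuous_on {0..T} u" "continuous_on {0..T} v"
    "u 0 = u T" "v 0 = v T" "\<And>t. t \<notin> {0..T} \<Longrightarrow> u t = 0"
proof -
  obtain w where w: "w 0 = u" "sobolev_jet T 2 w" "\<forall>\<alpha><2. w \<alpha> 0 = w \<alpha> T" and out: "\<forall>t. t \<notin> {0..T} \<longrightarrow> u t = 0"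
    using assms by (auto simp: sobolev_per_def)
  have "weak_derivative T (w 0) (w (Suc 0)) \<and> continuous_on {0..T} (w 0)"
    "weak_derivative T (w (Suc 0)) (w (Suc (Suc 0))) \<and> continuous_on {0..T} (w (Suc 0))"
    using w(2) unfolding sobolev_jet_def by (blast intro: less_2_cases_iff[THEN iffD2])+
  then show ?thesis
    using w(1,3) out by (intro that[of "w 1" "w 2"]) (auto simp: h2_jet_def numeral_2_eq_2)
qed

lemma sobolev_per_2I:
  assumes "h2_jet T u v w" "continuous_on {0..T} u" "continuous_on {0..T} v"
    "u 0 = u T" "v 0 = v T" "\<And>t. t \<notin> {0..T} \<Longrightarrow> u t = 0"
  shows "u \<in> sobolev_per T 2"
proof -
  define W where "W i = (if i = 0 then u else if i = 1 then v else w)" for i :: nat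
  have "sobolev_jet T 2 W"
    unfolding sobolev_jet_def
    using h2_jet_square_integrable[OF assms(1)] assms(1-3)
    by (auto simp: W_def h2_jet_def less_2_cases_iff)
  moreover have "\<forall>\<alpha><2. W \<alpha> 0 = W \<alpha> T" using assms(4,5) by (auto simp: W_def less_2_cases_iff)
  moreover have "W 0 = u" by (simp add: W_def)
  ultimately show ?thesis using assms(6) unfolding sobolev_per_def by blast
qed

lemma weak_derivative_uminus:
  assumes "weak_derivative T u v" shows "weak_derivative T (\<lambda>t. - u t) (\<lambda>t. - v t)"
proof -
  have "weak_derivative T (\<lambda>t. 0) (\<lambda>t. 0)"
    using weak_derivative_diff[OF assms assms] by simp
  from weak_derivative_diff[OF this assms] show ?thesis by simp
qed

text \<open>Symmetry of the distance has to hold for arbitrary functions. If there is no weak derivative,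
  then \<open>wD\<close> picks the same element of the empty predicate for \<open>g\<close> and for \<open>- g\<close>.\<close>

lemma wD_uminus_cases:
  assumes sq: "square_integrable T g" "square_integrable T g'" and ae: "AE t in lebesgue_on {0..T}. g' t = - g t"
  shows "wD T g' = wD T g \<or> (square_integrable T (wD T g) \<and> square_integrable T (wD T g') \<and>
    (AE t in lebesgue_on {0..T}. wD T g' t = - wD T g t))"
proof (cases "\<exists>z. weak_derivative T g z")
  case True
  then obtain z where z: "weak_derivative T g z" by blast
  have z': "weak_derivative T g' (\<lambda>t. - z t)"
    by (rule weak_derivative_cong_left[OF weak_derivative_uminus[OF z] _ sq(2)]) (use ae in eventually_elim, simp)
  have "AE t in lebesgue_on {0..T}. wD T g' t = - wD T g t"
    using wD_AE_eq[OF z] wD_AE_eq[OF z'] by eventually_elim simp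
  then show ?thesis using wD_weak_derivative[OF z] wD_weak_derivative[OF z'] by (simp add: weak_derivative_def)
next
  case False
  have "\<not> weak_derivative T g' z" for z
  proof
    assume W: "weak_derivative T g' z"
    have "weak_derivative T g (\<lambda>t. - z t)"
      by (rule weak_derivative_cong_left[OF weak_derivative_uminus[OF W] _ sq(1)]) (use ae in eventually_elim, simp)
    then show False using False by blast
  qed
  then have "weak_derivative T g' = weak_derivative T g" using False by (intro ext) blast
  then show ?thesis by (simp add: wD_def)
qed

lemma sobolev_norm_uminus: "sobolev_norm T 2 (\<lambda>t. - u t) = sobolev_norm T 2 u"
proof -
  have e: "{..2::nat} = {0, 1, 2}" by auto
  have N: "sobolev_norm T 2 u = sqrt ((L2norm T u)\<^sup>2 + (L2norm T (wD T u))\<^sup>2 + (L2norm T (wD T (wD T u)))\<^sup>2)" for u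
    unfolding sobolev_norm_def e L2norm_power2 by (simp add: numeral_2_eq_2)
  have L2: "L2norm T g' = L2norm T g"
    if "g' = g \<or> (square_integrable T g \<and> square_integrable T g' \<and> (AE t in lebesgue_on {0..T}. g' t = - g t))" for g g'
  proof -
    have "L2norm T g' = L2norm T (\<lambda>t. - g t)"
      if "square_integrable T g" "square_integrable T g'" "AE t in lebesgue_on {0..T}. g' t = - g t"
      using square_integrable_scale[OF that(1), of "- 1"] that by (intro L2norm_cong_AE) auto
    then show ?thesis using that by auto
  qed
  show ?thesis
  proof (cases "square_integrable T u")
    case True
    then have "square_integrable T (\<lambda>t. - u t)" using square_integrable_scale[OF True, of "- 1"] by simp
    from wD_uminus_cases[OF True this] have 1: "wD T (\<lambda>t. - u t) = wD T u \<or> (square_integrable T (wD T u) \<and>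
      square_integrable T (wD T (\<lambda>t. - u t)) \<and> (AE t in lebesgue_on {0..T}. wD T (\<lambda>t. - u t) t = - wD T u t))" by simp
    have "wD T (wD T (\<lambda>t. - u t)) = wD T (wD T u) \<or> (square_integrable T (wD T (wD T u)) \<and>
      square_integrable T (wD T (wD T (\<lambda>t. - u t))) \<and>
      (AE t in lebesgue_on {0..T}. wD T (wD T (\<lambda>t. - u t)) t = - wD T (wD T u) t))"
    proof (rule disjE[OF 1])
      assume "wD T (\<lambda>t. - u t) = wD T u"
      then show ?thesis by simp
    next
      assume A: "square_integrable T (wD T u) \<and> square_integrable T (wD T (\<lambda>t. - u t)) \<and>
        (AE t in lebesgue_on {0..T}. wD T (\<lambda>t. - u t) t = - wD T u t)"
      show ?thesis by (rule wD_uminus_cases) (use A in blast)+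
    qed
    then show ?thesis unfolding N using L2[OF 1] L2[of "wD T (wD T (\<lambda>t. - u t))" "wD T (wD T u)"] by simp
  next
    case False
    then have "\<not> square_integrable T (\<lambda>t. - u t)" using square_integrable_scale[of T "\<lambda>t. - u t" "- 1"] by auto
    \<comment> \<open>Outside L^2 both predicates are empty, so the choice operator returns the same
      function for u and for - u.\<close>
    then have "weak_derivative T (\<lambda>t. - u t) = weak_derivative T u"
      using False by (intro ext) (simp add: weak_derivative_def)
    then have "wD T (\<lambda>t. - u t) = wD T u" by (simp add: wD_def)
    then show ?thesis unfolding N by simp
  qed
qed

lemma h2_jet_zero: "0 < T \<Longrightarrow> h2_jet T (\<lambda>_. 0) (\<lambda>_. 0) (\<lambda>_. 0)"
  unfolding h2_jet_def
  by (auto intro!: classical_imp_weak_derivative[where S = "{}" and B = 0] derivative_eq_intros)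

text \<open>Distance 0 gives equality almost everywhere, hence everywhere on [0, T] by continuity;
  outside, both functions are 0 by the convention for representatives.\<close>

lemma sobolev_metric:
  assumes T: "0 < T"
  shows "Metric_space (sobolev_sym p T 2) (sobolev_dist T 2)"
proof
  show "0 \<le> sobolev_dist T 2 x y" for x y
    unfolding sobolev_dist_def sobolev_norm_def by (intro real_sqrt_ge_zero sum_nonneg integral_nonneg) auto
  show "sobolev_dist T 2 x y = sobolev_dist T 2 y x" for x y
    unfolding sobolev_dist_def using sobolev_norm_uminus[of T "\<lambda>t. y t - x t"] by simp
next
  fix x y assume x: "x \<in> sobolev_sym p T 2" and y: "y \<in> sobolev_sym p T 2"
  obtain v w where J: "h2_jet T x v w" "continuous_on {0..T} x" "\<And>t. t \<notin> {0..T} \<Longrightarrow> x t = 0"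
    using x unfolding sobolev_sym_def by (auto elim: sobolev_per_2D)
  obtain v' w' where J': "h2_jet T y v' w'" "continuous_on {0..T} y" "\<And>t. t \<notin> {0..T} \<Longrightarrow> y t = 0"
    using y unfolding sobolev_sym_def by (auto elim: sobolev_per_2D)
  note D = h2_jet_diff[OF J(1) J'(1)]
  show "sobolev_dist T 2 x y = 0 \<longleftrightarrow> x = y"
  proof
    assume "sobolev_dist T 2 x y = 0"
    then have "L2norm T (\<lambda>t. x t - y t) = 0"
      using L2norm_le_sobolev_norm[OF D] L2norm_nonneg[of T "\<lambda>t. x t - y t"] by (simp add: sobolev_dist_def)
    then have "(LINT t|lebesgue_on {0..T}. (x t - y t)\<^sup>2) = 0" by (simp add: L2norm_def)
    then have "AE t in lebesgue_on {0..T}. (x t - y t)\<^sup>2 = 0"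
      using h2_jet_square_integrable(1)[OF D]
      by (subst (asm) integral_nonneg_eq_0_iff_AE) (auto simp: square_integrable_def)
    then have ae: "AE t in lebesgue_on {0..T}. x t = y t" by eventually_elim simp
    show "x = y"
    proof
      fix t show "x t = y t"
        using AE_eq_imp_eq_continuous[OF T J(2) J'(2) ae, of t] J(3)[of t] J'(3)[of t] by (cases "t \<in> {0..T}") auto
    qed
  next
    assume "x = y"
    then show "sobolev_dist T 2 x y = 0"
      using sobolev_norm_h2_jet[OF h2_jet_zero[OF T]] by (simp add: sobolev_dist_def L2norm_def)
  qed
  fix z assume z: "z \<in> sobolev_sym p T 2"
  obtain v'' w'' where J'': "h2_jet T z v'' w''" using z unfolding sobolev_sym_def by (auto elim: sobolev_per_2D)
  have "sobolev_norm T 2 (\<lambda>t. (x t - y t) + (y t - z t))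
    \<le> sobolev_norm T 2 (\<lambda>t. x t - y t) + sobolev_norm T 2 (\<lambda>t. y t - z t)"
    by (rule sobolev_norm_triangle[OF D h2_jet_diff[OF J'(1) J'']]) (use h2_jet_diff[OF J(1) J''] in simp)
  then show "sobolev_dist T 2 x z \<le> sobolev_dist T 2 x y + sobolev_dist T 2 y z"
    by (simp add: sobolev_dist_def)
qed

lemma ambient_metric:
  assumes T: "0 < T"
  shows "Metric_space (ambient p T) (ambient_dist T)"
proof -
  interpret Metric_space12 "UNIV :: real set" dist "sobolev_sym p T 2" "sobolev_dist T 2"
    unfolding Metric_space12_def using Met_TC.Metric_space_axioms sobolev_metric[OF T] by blast
  show ?thesis by (rule prod_metric)
qed

section \<open>Solutions, shots and components\<close>

text \<open>The line u cos phi = v sin phi is v = 0 in the even case and u = 0 in the odd case;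
  these are the conditions that symmetry and periodicity impose at 0 and at T/2.\<close>

fun phase :: "symmetry \<Rightarrow> real" where
  "phase Ev = pi / 2"
| "phase Odd = 0"

lemma phase_cases: "phase p = 0 \<or> phase p = pi / 2"
  by (cases p) auto

section \<open>From almost everywhere to pointwise statements\<close>

lemma AE_off_finite:
  fixes T :: real
  assumes "finite S"
  shows "AE t in lebesgue_on {0..T}. t \<in> {0<..<T} - S"
proof -
  have "negligible (S \<union> {0, T})" using assms by (auto intro: negligible_finite)
  then have ae: "AE t in lebesgue. t \<notin> S \<union> {0, T}"
    unfolding negligible_iff_null_sets by (rule AE_not_in)
  have "AE t in lebesgue. t \<in> {0..T} \<longrightarrow> t \<in> {0<..<T} - S"
    by (rule eventually_mono[OF ae]) auto
  then show ?thesis by (subst AE_restrict_space_iff) auto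
qed

lemma AE_negligible:
  assumes "AE t in lebesgue_on {0..T}. P t"
  shows "negligible {t \<in> {0..T::real}. \<not> P t}"
proof -
  have "AE t in lebesgue. t \<in> {0..T} \<longrightarrow> P t"
    using assms by (subst (asm) AE_restrict_space_iff) auto
  then have "\<exists>N\<in>null_sets lebesgue. {t \<in> space lebesgue. \<not> (t \<in> {0..T} \<longrightarrow> P t)} \<subseteq> N"
    unfolding eventually_ae_filter .
  then obtain N where N: "N \<in> null_sets lebesgue" "{t \<in> space lebesgue. \<not> (t \<in> {0..T} \<longrightarrow> P t)} \<subseteq> N"
    by (elim bexE)
  have "negligible N" using N(1) unfolding negligible_iff_null_sets .
  moreover have "{t \<in> {0..T}. \<not> P t} \<subseteq> N"
  proof
    fix t assume "t \<in> {t \<in> {0..T}. \<not> P t}"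
    then have "t \<in> {t \<in> space lebesgue. \<not> (t \<in> {0..T} \<longrightarrow> P t)}" by simp
    then show "t \<in> N" by (rule subsetD[OF N(2)])
  qed
  ultimately show ?thesis by (rule negligible_subset)
qed

text \<open>By continuity a violation would persist on a nonempty open set, and such a set is not
  negligible.\<close>

lemma AE_le_imp_le_on_open:
  fixes g :: "real \<Rightarrow> real"
  assumes U: "open U" "U \<subseteq> {0..T}" and g: "continuous_on U g"
    and ae: "AE t in lebesgue_on {0..T}. g t \<le> 0" and x: "x \<in> U"
  shows "g x \<le> 0"
proof (rule ccontr)
  assume "\<not> g x \<le> 0"
  let ?V = "U \<inter> g -` {0<..}"
  have "open ?V" by (rule continuous_open_preimage[OF g U(1)]) auto
  moreover have "x \<in> ?V" using x \<open>\<not> g x \<le> 0\<close> by auto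
  moreover have "negligible ?V"
    by (rule negligible_subset[OF AE_negligible[OF ae]]) (use U(2) in auto)
  ultimately show False using open_not_negligible by blast
qed

lemma piecewise_weight_exists:
  assumes T: "0 < T" and loc: "HLoc T a" and glob: "HGlob T a" and ev: "has_symmetry Ev T a"
  shows "\<exists>S Ca. piecewise_weight T S a Ca"
proof -
  obtain N t where t: "t 0 = 0" "t N = T" "\<And>i. i < N \<Longrightarrow> t i < t (Suc i)"
    "\<And>i. i < N \<Longrightarrow> continuous_on {t i<..<t (Suc i)} a"
    using glob unfolding HGlob_def by blast
  define S0 where "S0 = t ` {..N}"
  \<comment> \<open>Reflecting the partition points makes \<open>S\<close> symmetric. The midpoint
    is added so that a point off \<open>S\<close> with positive weight lies strictly in one half and
    can be reflected into the left one.\<close>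
  define S where "S = S0 \<union> (\<lambda>x. T - x) ` S0 \<union> {T / 2}"
  have finS: "finite S" by (simp add: S_def S0_def)
  have reflS: "T - x \<in> S" if "x \<in> S" for x
    using that by (auto simp: S_def image_iff)
  let ?U = "{0<..<T} - S"
  have opU: "open ?U" using finS by (intro open_Diff finite_imp_closed) auto
  have subU: "?U \<subseteq> {0..T}" by auto
  have reflU: "T - x \<in> ?U" if "x \<in> ?U" for x using that reflS[of "T - x"] by auto
  have contU: "continuous_on ?U a"
  proof (rule continuous_at_imp_continuous_on, rule ballI)
    fix x assume x: "x \<in> ?U"
    have "n \<le> N \<Longrightarrow> x < t n \<Longrightarrow> \<exists>i<n. t i \<le> x \<and> x < t (Suc i)" for n
    proof (induction n)
      case 0 then show ?case using t(1) x by auto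
    next
      case (Suc n)
      then show ?case by (cases "x < t n") (auto intro: less_SucI)
    qed
    from this[of N] obtain i where i: "i < N" "t i \<le> x" "x < t (Suc i)" using x t(2) by auto
    have "t i \<noteq> x" using x i(1) by (auto simp: S_def S0_def)
    then have "x \<in> {t i<..<t (Suc i)}" using i by auto
    then show "isCont a x" using t(4)[OF i(1)] by (simp add: continuous_on_eq_continuous_at)
  qed
  have contR: "continuous_on ?U (\<lambda>x. a (T - x))"
    by (rule continuous_on_compose2[OF contU]) (use reflU in \<open>auto intro!: continuous_intros\<close>)
  obtain C where C: "AE x in lebesgue_on {0..T}. \<bar>a x\<bar> \<le> C"
    using loc unfolding HLoc_def L_infinity_def by blast
  have nn: "AE x in lebesgue_on {0..T}. 0 \<le> a x" using loc unfolding HLoc_def by blast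
  have ev': "AE x in lebesgue_on {0..T}. a (T - x) = a x" using ev by simp
  have 1: "0 \<le> a x" if "x \<in> ?U" for x
  proof -
    have "- a x \<le> 0"
      by (rule AE_le_imp_le_on_open[OF opU subU _ _ that]) (use nn in \<open>auto intro!: continuous_intros contU\<close>)
    then show ?thesis by simp
  qed
  have 2: "a x \<le> \<bar>C\<bar>" if "x \<in> ?U" for x
  proof -
    have "a x - C \<le> 0"
    proof (rule AE_le_imp_le_on_open[OF opU subU _ _ that])
      show "AE x in lebesgue_on {0..T}. a x - C \<le> 0" using C by eventually_elim auto
    qed (auto intro!: continuous_intros contU)
    then show ?thesis by simp
  qed
  have 3: "a (T - x) = a x" if "x \<in> ?U" for x
  proof (rule antisym)
    have "a (T - x) - a x \<le> 0"
    proof (rule AE_le_imp_le_on_open[OF opU subU _ _ that])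
      show "AE x in lebesgue_on {0..T}. a (T - x) - a x \<le> 0" using ev' by eventually_elim auto
    qed (intro continuous_intros contU contR)
    then show "a (T - x) \<le> a x" by simp
    have "a x - a (T - x) \<le> 0"
    proof (rule AE_le_imp_le_on_open[OF opU subU _ _ that])
      show "AE x in lebesgue_on {0..T}. a x - a (T - x) \<le> 0" using ev' by eventually_elim auto
    qed (intro continuous_intros contU contR)
    then show "a x \<le> a (T - x)" by simp
  qed
  have 4: "\<exists>x\<in>{0<..<T/2} - S. 0 < a x"
  proof -
    have "\<exists>x\<in>?U. a x \<noteq> 0"
    proof (rule ccontr)
      assume "\<not> ?thesis"
      then have "AE x in lebesgue_on {0..T}. a x = 0"
        by (intro eventually_mono[OF AE_off_finite[OF finS, of T]]) blast
      then show False using loc unfolding HLoc_def by blast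
    qed
    then obtain x where x: "x \<in> ?U" "0 < a x" using 1 by force
    have "x \<noteq> T / 2" using x by (auto simp: S_def)
    then consider "x < T / 2" | "T / 2 < x" by linarith
    then show ?thesis
    proof cases
      case 1 then show ?thesis using x by (intro bexI[of _ x]) auto
    next
      case 2 then show ?thesis using x reflU[of x] 3[of x] by (intro bexI[of _ "T - x"]) auto
    qed
  qed
  have "piecewise_weight T S a \<bar>C\<bar>"
    by unfold_locales (use T finS reflS contU 1 2 3 4 in auto)
  then show ?thesis by blast
qed

section \<open>Classical and weak solutions\<close>

context piecewise_weight
begin

definition sqpot :: "real \<Rightarrow> (real \<Rightarrow> real) \<Rightarrow> real \<Rightarrow> real" where
  "sqpot l u t = l + a t * (u t)\<^sup>2"

lemma sqpot_cont:
  assumes "continuous_on {0..T} u"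
  shows "continuous_on ({0<..<T} - S) (sqpot l u)"
proof -
  have "continuous_on ({0<..<T} - S) u" by (rule continuous_on_subset[OF assms]) auto
  then show ?thesis unfolding sqpot_def by (intro continuous_intros a_cont)
qed

lemma sqpot_bound:
  assumes "x \<in> {0<..<T} - S" "\<bar>u x\<bar> \<le> M"
  shows "\<bar>sqpot l u x\<bar> \<le> \<bar>l\<bar> + Ca * M\<^sup>2" "l \<le> sqpot l u x"
proof -
  have "0 \<le> a x * (u x)\<^sup>2" using a_nonneg[OF assms(1)] by simp
  moreover have "a x * (u x)\<^sup>2 \<le> Ca * M\<^sup>2"
    using a_nonneg[OF assms(1)] a_le[OF assms(1)] Ca_nonneg power2_le_of_abs_le[OF assms(2)]
    by (intro mult_mono) auto
  ultimately show "\<bar>sqpot l u x\<bar> \<le> \<bar>l\<bar> + Ca * M\<^sup>2" "l \<le> sqpot l u x" by (auto simp: sqpot_def)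
qed

text \<open>Elements of \<open>sobolev_per\<close> vanish outside [0, T], whereas shots are
  arbitrary there.\<close>

definition restr :: "(real \<Rightarrow> real) \<Rightarrow> real \<Rightarrow> real" where
  "restr u t = (if t \<in> {0..T} then u t else 0)"

lemma restr_cont: "continuous_on {0..T} u \<Longrightarrow> continuous_on {0..T} (restr u)"
  by (rule continuous_on_eq) (auto simp: restr_def)

lemma restr_jet:
  assumes L: "linear_ode S 0 T q u v" and c: "continuous_on ({0<..<T} - S) q"
    and B: "\<And>x. x \<in> {0<..<T} - S \<Longrightarrow> \<bar>q x\<bar> \<le> B"
  shows "h2_jet T (restr u) v (\<lambda>x. - q x * u x)"
proof -
  have cu: "continuous_on {0..T} u" and cv: "continuous_on {0..T} v" using L by (auto simp: linear_ode_def)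
  obtain M where M: "0 \<le> M" "\<And>x. x \<in> {0..T} \<Longrightarrow> \<bar>u x\<bar> \<le> M" using continuous_on_Icc_bounded[OF cu] by metis
  obtain M' where M': "\<And>x. x \<in> {0..T} \<Longrightarrow> \<bar>v x\<bar> \<le> M'" using continuous_on_Icc_bounded[OF cv] by metis
  have "weak_derivative T u v"
  proof (rule classical_imp_weak_derivative[OF fin_S T_pos cu])
    show "continuous_on ({0<..<T} - S) v" by (rule continuous_on_subset[OF cv]) auto
    show "\<bar>v x\<bar> \<le> M'" if "x \<in> {0<..<T} - S" for x using M' that by auto
  qed (use L in \<open>auto simp: linear_ode_def\<close>)
  then have "weak_derivative T (restr u) v"
  proof (rule weak_derivative_cong_left)
    show "AE t in lebesgue_on {0..T}. u t = restr u t" by (rule AE_I2) (auto simp: restr_def)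
    show "square_integrable T (restr u)" by (rule continuous_square_integrable[OF restr_cont[OF cu]])
  qed
  moreover have "weak_derivative T v (\<lambda>x. - q x * u x)"
  proof (rule classical_imp_weak_derivative[OF fin_S T_pos cv])
    have "continuous_on ({0<..<T} - S) u" by (rule continuous_on_subset[OF cu]) auto
    then show "continuous_on ({0<..<T} - S) (\<lambda>x. - q x * u x)" by (intro continuous_intros c)
    show "\<bar>- q x * u x\<bar> \<le> \<bar>B\<bar> * M" if "x \<in> {0<..<T} - S" for x
      unfolding abs_mult abs_minus_cancel using B[OF that] M that by (intro mult_mono) auto
  qed (use L in \<open>auto simp: linear_ode_def\<close>)
  ultimately show ?thesis by (simp add: h2_jet_def)
qed

lemma restr_solution:
  assumes L: "linear_ode S 0 T q u v" and q: "\<And>x. x \<in> {0<..<T} - S \<Longrightarrow> q x = sqpot l u x"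
    and per: "u 0 = u T" "v 0 = v T"
  shows "restr u \<in> sobolev_per T 2" "AE t in lebesgue_on {0..T}. \<FF> T a (l, restr u) t = 0"
    "is_solution T a l (restr u)"
proof -
  have cu: "continuous_on {0..T} u" and cv: "continuous_on {0..T} v" using L by (auto simp: linear_ode_def)
  obtain M where M: "0 \<le> M" "\<And>x. x \<in> {0..T} \<Longrightarrow> \<bar>u x\<bar> \<le> M" using continuous_on_Icc_bounded[OF cu] by metis
  have L': "linear_ode S 0 T (sqpot l u) u v" by (rule linear_ode_cong[OF L q])
  have J: "h2_jet T (restr u) v (\<lambda>x. - sqpot l u x * u x)"
  proof (rule restr_jet[OF L' sqpot_cont[OF cu]])
    show "\<bar>sqpot l u x\<bar> \<le> \<bar>l\<bar> + Ca * M\<^sup>2" if "x \<in> {0<..<T} - S" for x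
      using sqpot_bound(1)[OF that, of u M l] M that by auto
  qed
  show per2: "restr u \<in> sobolev_per T 2"
    by (rule sobolev_per_2I[OF J restr_cont[OF cu] cv _ per(2)]) (use per T_pos in \<open>auto simp: restr_def\<close>)
  have "AE t in lebesgue_on {0..T}. wD T (wD T (restr u)) t = - sqpot l u t * u t"
    using J by (intro wD_wD_AE_eq) (auto simp: h2_jet_def)
  moreover have "AE t in lebesgue_on {0..T}. u t = restr u t" by (rule AE_I2) (auto simp: restr_def)
  ultimately have *: "AE t in lebesgue_on {0..T}. - wD T (wD T (restr u)) t = l * restr u t + a t * (restr u t) ^ 3"
    by eventually_elim (simp add: sqpot_def power2_eq_square power3_eq_cube algebra_simps)
  then show "is_solution T a l (restr u)" using per2 by (simp add: is_solution_def)
  show "AE t in lebesgue_on {0..T}. \<FF> T a (l, restr u) t = 0"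
    using * by eventually_elim (simp add: \<FF>_def)
qed

text \<open>Regularity: u is an integral of the continuous v, and v is an integral of - q u, which
  is continuous off \<open>S\<close>. The boundary conditions use symmetry and periodicity together:
  an even u has v (T - x) = - v x, which gives v = 0 at T/2, and with v 0 = v T also v 0 = 0; in the
  odd case the same argument applies to u itself.\<close>

lemma zeros_imp_ode:
  assumes Z: "(l, u) \<in> \<FF>_zeros p T a"
  obtains v where "linear_ode S 0 T (sqpot l u) u v"
    "u 0 * cos (phase p) = v 0 * sin (phase p)" "u (T / 2) * cos (phase p) = v (T / 2) * sin (phase p)"
proof -
  have u: "u \<in> sobolev_per T 2" "has_symmetry p T u"
    and ae: "AE t in lebesgue_on {0..T}. \<FF> T a (l, u) t = 0"
    using Z by (auto simp: \<FF>_zeros_def sobolev_sym_def)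
  obtain v w where J: "h2_jet T u v w" and cu: "continuous_on {0..T} u" and cv: "continuous_on {0..T} v"
    and per: "u 0 = u T" "v 0 = v T" using sobolev_per_2D[OF u(1)] by metis
  have W: "weak_derivative T u v" "weak_derivative T v w" using J by (auto simp: h2_jet_def)
  have w_eq: "AE t in lebesgue_on {0..T}. w t = - sqpot l u t * u t"
    using wD_wD_AE_eq[OF W] ae
    by eventually_elim (simp add: \<FF>_def sqpot_def power2_eq_square power3_eq_cube algebra_simps)
  have opA: "open ({0<..<T} - S)" using fin_S by (intro open_Diff finite_imp_closed) auto
  have du: "(u has_real_derivative v x) (at x)" if x: "x \<in> {0<..<T}" for x
  proof -
    have "((\<lambda>t. integral {0..t} v) has_vector_derivative v x) (at x within {0..T})"
      by (rule integral_has_vector_derivative[OF cv]) (use x in auto)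
    then have "((\<lambda>t. integral {0..t} v) has_vector_derivative v x) (at x)"
      using x by (simp add: at_within_interior[of x "{0..T}"])
    then have "((\<lambda>t. u 0 + integral {0..t} v) has_vector_derivative v x) (at x)"
      by (auto intro!: derivative_eq_intros)
    then have "(u has_vector_derivative v x) (at x)"
      by (rule has_vector_derivative_transform_within_open[of _ _ _ "{0<..<T}"])
         (use x weak_derivative_ftc[OF W(1) cu, of 0] in auto)
    then show ?thesis by (simp add: has_real_derivative_iff_has_vector_derivative)
  qed
  obtain M where M: "0 \<le> M" "\<And>x. x \<in> {0..T} \<Longrightarrow> \<bar>u x\<bar> \<le> M" using continuous_on_Icc_bounded[OF cu] by metis
  define r where "r x = - sqpot l u x * u x" for x
  have cr: "continuous_on ({0<..<T} - S) r"
  proof -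
    have "continuous_on ({0<..<T} - S) u" by (rule continuous_on_subset[OF cu]) auto
    then show ?thesis unfolding r_def by (intro continuous_intros sqpot_cont cu)
  qed
  have r_int: "r integrable_on {0..T}"
  proof -
    have "r absolutely_integrable_on {0..T}"
    proof (rule integrable_continuous_off_finite[OF fin_S cr])
      show "norm (r x) \<le> (\<bar>l\<bar> + Ca * M\<^sup>2) * M" if x: "x \<in> {0<..<T} - S" for x
        unfolding r_def real_norm_def abs_mult abs_minus_cancel
        using sqpot_bound(1)[OF x, of u M l] M x Ca_nonneg by (intro mult_mono) auto
    qed
    then show ?thesis by (simp add: absolutely_integrable_on_def)
  qed
  have v_int: "v x = v 0 + integral {0..x} r" if x: "x \<in> {0..T}" for x
  proof -
    have "integral {0..x} w = integral {0..x} r"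
      by (rule integral_spike[OF AE_negligible[OF w_eq]]) (use x in \<open>auto simp: r_def\<close>)
    then show ?thesis using weak_derivative_ftc[OF W(2) cv, of 0 x] x by simp
  qed
  have dv: "(v has_real_derivative - sqpot l u x * u x) (at x)" if x: "x \<in> {0<..<T} - S" for x
  proof -
    have A: "{0..T} - (S \<union> {0, T}) = {0<..<T} - S" by auto
    have "continuous (at x within {0<..<T} - S) r"
      using cr x by (simp add: continuous_on_eq_continuous_within)
    then have "((\<lambda>t. integral {0..t} r) has_vector_derivative r x) (at x within {0<..<T} - S)"
      using integral_has_vector_derivative_continuous_at[OF r_int, of x "S \<union> {0, T}"] fin_S x
      unfolding A by auto
    then have "((\<lambda>t. integral {0..t} r) has_vector_derivative r x) (at x)"
      by (simp only: at_within_open[OF x opA])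
    from has_vector_derivative_add[OF has_vector_derivative_const[of "v 0"] this]
    have "((\<lambda>t. v 0 + integral {0..t} r) has_vector_derivative r x) (at x)" by simp
    then have "(v has_vector_derivative r x) (at x)"
      by (rule has_vector_derivative_transform_within_open[OF _ opA x]) (rule v_int[symmetric], auto)
    then show ?thesis by (simp add: has_real_derivative_iff_has_vector_derivative r_def)
  qed
  have L: "linear_ode S 0 T (sqpot l u) u v"
    unfolding linear_ode_def using cu cv du dv by auto
  have T2: "T / 2 \<in> {0<..<T}" "T - T / 2 = T / 2" using T_pos by auto
  have crefl: "continuous_on {0..T} (\<lambda>x. f (T - x))" if "continuous_on {0..T} f" for f :: "real \<Rightarrow> real"
    by (rule continuous_on_compose2[OF that]) (auto intro!: continuous_intros)
  have "u 0 * cos (phase p) = v 0 * sin (phase p) \<and> u (T / 2) * cos (phase p) = v (T / 2) * sin (phase p)"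
  proof (cases p)
    case Ev
    have sym: "u (T - x) = u x" if "x \<in> {0..T}" for x
      using AE_eq_imp_eq_continuous[OF T_pos crefl[OF cu] cu _ that] u(2) Ev by simp
    have vanti: "v (T - x) + v x = 0" if x: "x \<in> {0<..<T}" for x
    proof -
      have d: "((\<lambda>x. T - x) has_real_derivative - 1) (at x)" by (auto intro!: derivative_eq_intros)
      have "(u has_real_derivative v (T - x)) (at (T - x))" by (rule du) (use x in auto)
      from DERIV_chain2[OF this d] have "((\<lambda>x. u (T - x)) has_vector_derivative - v (T - x)) (at x)"
        by (simp add: has_real_derivative_iff_has_vector_derivative)
      then have "(u has_vector_derivative - v (T - x)) (at x)"
        by (rule has_vector_derivative_transform_within_open[of _ _ _ "{0<..<T}"]) (use x sym in auto)
      then have "(u has_real_derivative - v (T - x)) (at x)"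
        by (simp add: has_real_derivative_iff_has_vector_derivative)
      from DERIV_unique[OF this du[OF x]] show ?thesis by simp
    qed
    have cl: "closure {0<..<T} = {0..T}" using T_pos by simp
    \<comment> \<open>The derivative of u is known in the open interval only, so the relation
      between v at 0 and at T is reached by continuity.\<close>
    have "v (T - 0) + v 0 = 0"
      by (rule continuous_constant_on_closure[of "{0<..<T}" "\<lambda>x. v (T - x) + v x" 0 0])
         (use vanti T_pos in \<open>auto simp: cl intro!: continuous_intros crefl cv\<close>)
    then have "v 0 = 0" using per(2) by simp
    moreover have "v (T / 2) = 0" using vanti[OF T2(1)] T2(2) by simp
    ultimately show ?thesis using Ev by simp
  next
    case Odd
    have sym: "u (T - x) = - u x" if "x \<in> {0..T}" for x
      using AE_eq_imp_eq_continuous[OF T_pos crefl[OF cu] continuous_on_minus[OF cu] _ that] u(2) Odd by simp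
    have "u (T / 2) = 0" using sym[of "T / 2"] T2 by simp
    moreover have "u 0 = 0" using sym[of 0] per(1) T_pos by simp
    ultimately show ?thesis using Odd by simp
  qed
  then show ?thesis using that[OF L] by blast
qed

text \<open>At T/2 the nonzero vector (u, v) lies on the line of direction phi by \<open>bc\<close>,
  and on the line given by the angle by the polar relation. The lines coincide, so their directions
  differ by a multiple of pi.\<close>

lemma angle_multiple_of_pi:
  assumes L: "linear_ode S 0 T q u v" and c: "continuous_on ({0<..<T} - S) q"
    and B: "\<And>x. x \<in> {0<..<T} - S \<Longrightarrow> \<bar>q x\<bar> \<le> B"
    and nz: "y \<in> {0..T}" "u y \<noteq> 0 \<or> v y \<noteq> 0"
    and bc: "u 0 * cos \<phi> = v 0 * sin \<phi>" "u (T / 2) * cos \<phi> = v (T / 2) * sin \<phi>"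
  shows "\<exists>j::int. angle \<phi> q (T / 2) = \<phi> + of_int j * pi"
proof -
  let ?\<theta> = "angle \<phi> q (T / 2)"
  have P: "pruefer_angle S 0 T q (angle \<phi> q)" "angle \<phi> q 0 = \<phi>" using angle[OF c B] by auto
  have T2: "T / 2 \<in> {0..T}" using T_pos by auto
  have pol: "u (T / 2) * cos ?\<theta> = v (T / 2) * sin ?\<theta>"
    by (rule pruefer_polar[OF fin_S L P(1) B T2]) (use P(2) bc in auto)
  note rep = polar_representation[OF pol]
  define \<rho> where "\<rho> = u (T / 2) * sin ?\<theta> + v (T / 2) * cos ?\<theta>"
  have \<rho>: "u (T / 2) = \<rho> * sin ?\<theta>" "v (T / 2) = \<rho> * cos ?\<theta>" using rep by (auto simp: \<rho>_def)
  have "\<rho> \<noteq> 0"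
  proof
    assume "\<rho> = 0"
    then have "u y = 0 \<and> v y = 0"
      using \<rho> by (intro linear_ode_vanishing[OF fin_S L B T2 _ _ nz(1)]) auto
    then show False using nz by simp
  qed
  moreover have "\<rho> * sin (?\<theta> - \<phi>) = 0" using bc(2) unfolding \<rho> by (simp add: sin_diff algebra_simps)
  ultimately have "sin (?\<theta> - \<phi>) = 0" by simp
  then obtain j :: int where "?\<theta> - \<phi> = of_int j * pi" by (auto simp: sin_zero_iff_int2)
  then show ?thesis by (intro exI[of _ j]) simp
qed

end

section \<open>The midpoint angle on the solution set\<close>

lemma ambient_dist_ge:
  "dist (fst x) (fst y) \<le> ambient_dist T x y" "0 \<le> sobolev_dist T 2 (snd x) (snd y) \<Longrightarrow> sobolev_dist T 2 (snd x) (snd y) \<le> ambient_dist T x y"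
  by (auto simp: prod_dist_def case_prod_unfold intro!: real_le_rsqrt)

lemma ambient_dist_le:
  "0 \<le> sobolev_dist T 2 (snd x) (snd y) \<Longrightarrow> ambient_dist T x y \<le> dist (fst x) (fst y) + sobolev_dist T 2 (snd x) (snd y)"
  by (auto simp: prod_dist_def case_prod_unfold intro!: sqrt_sum_squares_le_sum)

lemma sobolev_dist_nonneg: "0 < T \<Longrightarrow> 0 \<le> sobolev_dist T 2 u v"
  using Metric_space.nonneg[OF sobolev_metric] by blast

lemma connected_subset_countable_eq:
  fixes A :: "real set"
  assumes "connected A" "countable A" "x \<in> A" "y \<in> A"
  shows "x = y"
proof (rule ccontr)
  assume "x \<noteq> y"
  then obtain p q where "p < q" "p \<in> A" "q \<in> A" using assms(3,4) by (metis linorder_neq_iff)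
  then have "{p..q} \<subseteq> A" using assms(1) connected_contains_Icc by blast
  then have "countable {p..q}" using assms(2) countable_subset by blast
  then show False using \<open>p < q\<close> uncountable_closed_interval by blast
qed

context piecewise_weight
begin

text \<open>Built from the untruncated potential and meaningful on the whole ambient space, so that
  one continuous function serves all solutions and the points (\<sigma>_k, 0).\<close>

definition midpoint_angle :: "symmetry \<Rightarrow> real \<times> (real \<Rightarrow> real) \<Rightarrow> real" where
  "midpoint_angle p x = angle (phase p) (sqpot (fst x) (snd x)) (T / 2)"

text \<open>The potentials differ by (l - l') + a (u - u') (u + u'). Cauchy-Schwarz bounds the
  integral of this by L^2 norms, so the H^2 distance controls the angle with no embedding into
  continuous functions; the bound \<open>M\<close> concerns the fixed function u.\<close>

lemma midpoint_angle_estimate: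
  assumes u: "u \<in> sobolev_sym p T 2" and u': "u' \<in> sobolev_sym p T 2"
    and M: "\<And>t. t \<in> {0..T} \<Longrightarrow> \<bar>u t\<bar> \<le> M"
    and d: "\<bar>l - l'\<bar> \<le> d" "sobolev_dist T 2 u u' \<le> d"
  shows "\<bar>midpoint_angle p (l, u) - midpoint_angle p (l', u')\<bar>
    \<le> d * (T + Ca * (2 * L2norm T u + d)) * exp ((\<bar>l\<bar> + Ca * M\<^sup>2 + 1) * (T / 2 - 0))"
proof -
  let ?M = "lebesgue_on {0..T}"
  obtain v w where J: "h2_jet T u v w" and cu: "continuous_on {0..T} u"
    using u unfolding sobolev_sym_def by (auto elim: sobolev_per_2D)
  obtain v' w' where J': "h2_jet T u' v' w'" and cu': "continuous_on {0..T} u'"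
    using u' unfolding sobolev_sym_def by (auto elim: sobolev_per_2D)
  obtain M' where M': "\<And>t. t \<in> {0..T} \<Longrightarrow> \<bar>u' t\<bar> \<le> M'" using continuous_on_Icc_bounded[OF cu'] by metis
  have d0: "0 \<le> d" using d(1) by linarith
  have M0: "0 \<le> M" using M[of 0] T_pos by force
  have sq: "square_integrable T u" "square_integrable T u'"
    by (intro continuous_square_integrable cu cu')+
  have diff: "L2norm T (\<lambda>t. u t - u' t) \<le> d"
    using L2norm_le_sobolev_norm[OF h2_jet_diff[OF J J']] d(2) by (simp add: sobolev_dist_def)
  have P: "pruefer_angle S 0 T (sqpot l u) (angle (phase p) (sqpot l u))" "angle (phase p) (sqpot l u) 0 = phase p"
  proof -
    have "\<bar>sqpot l u x\<bar> \<le> \<bar>l\<bar> + Ca * M\<^sup>2" if "x \<in> {0<..<T} - S" for x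
      by (rule sqpot_bound(1)[OF that]) (use M that in auto)
    from angle[OF sqpot_cont[OF cu] this]
    show "pruefer_angle S 0 T (sqpot l u) (angle (phase p) (sqpot l u))" "angle (phase p) (sqpot l u) 0 = phase p" by auto
  qed
  have P': "pruefer_angle S 0 T (sqpot l' u') (angle (phase p) (sqpot l' u'))" "angle (phase p) (sqpot l' u') 0 = phase p"
  proof -
    have "\<bar>sqpot l' u' x\<bar> \<le> \<bar>l'\<bar> + Ca * M'\<^sup>2" if "x \<in> {0<..<T} - S" for x
      by (rule sqpot_bound(1)[OF that]) (use M' that in auto)
    from angle[OF sqpot_cont[OF cu'] this]
    show "pruefer_angle S 0 T (sqpot l' u') (angle (phase p) (sqpot l' u'))" "angle (phase p) (sqpot l' u') 0 = phase p" by auto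
  qed
  define e where "e t = \<bar>l - l'\<bar> + Ca * (\<bar>u t - u' t\<bar> * \<bar>u t + u' t\<bar>)" for t
  have ce: "continuous_on {0..T} (\<lambda>t. \<bar>u t - u' t\<bar> * \<bar>u t + u' t\<bar>)" by (intro continuous_intros cu cu')
  have e_int: "e integrable_on {0..T}"
    unfolding e_def by (intro integrable_continuous_real continuous_intros cu cu')
  have "integral {0..T} (\<lambda>t. \<bar>u t - u' t\<bar> * \<bar>u t + u' t\<bar>) = (LINT t|?M. \<bar>u t - u' t\<bar> * \<bar>u t + u' t\<bar>)"
    by (rule lebesgue_integral_Icc(1)[OF square_integrable_imp_integrable[OF continuous_square_integrable[OF ce]], symmetric])
  also have "\<dots> \<le> L2norm T (\<lambda>t. \<bar>u t - u' t\<bar>) * L2norm T (\<lambda>t. \<bar>u t + u' t\<bar>)"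
    by (rule order_trans[OF abs_ge_self L2_cauchy_schwarz])
       (intro continuous_square_integrable continuous_intros cu cu')+
  also have "L2norm T (\<lambda>t. \<bar>u t - u' t\<bar>) = L2norm T (\<lambda>t. u t - u' t)" by (simp add: L2norm_def)
  \<comment> \<open>The sum is written as 2 u - (u - u'), so that its norm is bounded by the norm of
    u and by \<open>d\<close>.\<close>
  also have "L2norm T (\<lambda>t. \<bar>u t + u' t\<bar>) = L2norm T (\<lambda>t. (u t + u t) + - (u t - u' t))" by (simp add: L2norm_def)
  also have "L2norm T (\<lambda>t. u t - u' t) * L2norm T (\<lambda>t. (u t + u t) + - (u t - u' t)) \<le> d * (2 * L2norm T u + d)"
  proof (rule mult_mono[OF diff _ d0])
    have "L2norm T (\<lambda>t. (u t + u t) + - (u t - u' t)) \<le> L2norm T (\<lambda>t. u t + u t) + L2norm T (\<lambda>t. - (u t - u' t))"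
      by (rule L2norm_triangle) (intro continuous_square_integrable continuous_intros cu cu')+
    also have "L2norm T (\<lambda>t. u t + u t) \<le> L2norm T u + L2norm T u" by (rule L2norm_triangle[OF sq(1) sq(1)])
    also have "L2norm T (\<lambda>t. - (u t - u' t)) \<le> d" unfolding L2norm_uminus by (rule diff)
    finally show "L2norm T (\<lambda>t. (u t + u t) + - (u t - u' t)) \<le> 2 * L2norm T u + d" by simp
  qed simp
  finally have I: "integral {0..T} (\<lambda>t. \<bar>u t - u' t\<bar> * \<bar>u t + u' t\<bar>) \<le> d * (2 * L2norm T u + d)" .
  have "integral {0..T} e = \<bar>l - l'\<bar> * T + Ca * integral {0..T} (\<lambda>t. \<bar>u t - u' t\<bar> * \<bar>u t + u' t\<bar>)"
  proof -
    have "integral {0..T} e = integral {0..T} (\<lambda>_. \<bar>l - l'\<bar>) + integral {0..T} (\<lambda>t. Ca * (\<bar>u t - u' t\<bar> * \<bar>u t + u' t\<bar>))"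
      unfolding e_def by (intro Henstock_Kurzweil_Integration.integral_add integrable_continuous_real continuous_intros cu cu')
    then show ?thesis using T_pos by (simp add: mult.commute)
  qed
  also have "\<dots> \<le> d * T + Ca * (d * (2 * L2norm T u + d))"
    using I d(1) T_pos Ca_nonneg by (intro add_mono mult_right_mono mult_left_mono) auto
  also have "\<dots> = d * (T + Ca * (2 * L2norm T u + d))" by (simp add: algebra_simps)
  finally have E: "integral {0..T} e \<le> d * (T + Ca * (2 * L2norm T u + d))" .
  have "\<bar>midpoint_angle p (l, u) - midpoint_angle p (l', u')\<bar>
    \<le> (\<bar>angle (phase p) (sqpot l u) 0 - angle (phase p) (sqpot l' u') 0\<bar> + integral {0..T} e)
      * exp ((\<bar>l\<bar> + Ca * M\<^sup>2 + 1) * (T / 2 - 0))"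
    unfolding midpoint_angle_def fst_conv snd_conv
  proof (rule pruefer_angle_diff_bound[OF fin_S P(1) P'(1)])
    show "\<bar>sqpot l u x\<bar> \<le> \<bar>l\<bar> + Ca * M\<^sup>2" if "x \<in> {0<..<T} - S" for x
      by (rule sqpot_bound(1)[OF that]) (use M that in auto)
    show "\<bar>sqpot l u x - sqpot l' u' x\<bar> \<le> e x" if x: "x \<in> {0<..<T} - S" for x
    proof -
      have "sqpot l u x - sqpot l' u' x = (l - l') + a x * ((u x - u' x) * (u x + u' x))"
        by (simp add: sqpot_def power2_eq_square algebra_simps)
      also have "\<bar>\<dots>\<bar> \<le> \<bar>l - l'\<bar> + \<bar>a x\<bar> * (\<bar>u x - u' x\<bar> * \<bar>u x + u' x\<bar>)"
        unfolding abs_mult[symmetric] by (rule abs_triangle_ineq)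
      also have "\<dots> \<le> e x"
        unfolding e_def using a_nonneg[OF x] a_le[OF x] by (intro add_left_mono mult_right_mono) auto
      finally show ?thesis .
    qed
  qed (use e_int Ca_nonneg T_pos in \<open>auto simp: e_def\<close>)
  also have "\<dots> \<le> d * (T + Ca * (2 * L2norm T u + d)) * exp ((\<bar>l\<bar> + Ca * M\<^sup>2 + 1) * (T / 2 - 0))"
    using E unfolding P(2) P'(2) by (intro mult_right_mono) auto
  finally show ?thesis .
qed

lemma topspace_ambient: "topspace (ambient_topology p T) = ambient p T"
  unfolding ambient_topology_def by (rule Metric_space.topspace_mtopology[OF ambient_metric[OF T_pos]])

lemma midpoint_angle_continuous:
  "continuous_map (ambient_topology p T) euclideanreal (midpoint_angle p)"
proof -
  interpret A: Metric_space "ambient p T" "ambient_dist T" by (rule ambient_metric[OF T_pos])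
  have "continuous_map A.mtopology Met_TC.mtopology (midpoint_angle p)"
    unfolding A.metric_continuous_map[OF Met_TC.Metric_space_axioms]
  proof (intro conjI ballI allI impI)
    fix x and \<epsilon> :: real assume x: "x \<in> ambient p T" and \<epsilon>: "0 < \<epsilon>"
    obtain l u where lu: "x = (l, u)" "u \<in> sobolev_sym p T 2" using x by (cases x) auto
    have "continuous_on {0..T} u" using lu(2) unfolding sobolev_sym_def by (auto elim: sobolev_per_2D)
    then obtain M where M: "\<And>t. t \<in> {0..T} \<Longrightarrow> \<bar>u t\<bar> \<le> M" using continuous_on_Icc_bounded by metis
    define K where "K = (T + Ca * (2 * L2norm T u + 1)) * exp ((\<bar>l\<bar> + Ca * M\<^sup>2 + 1) * (T / 2 - 0))"
    have K: "0 < K" unfolding K_def using T_pos Ca_nonneg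
      by (intro mult_pos_pos add_pos_nonneg mult_nonneg_nonneg add_nonneg_nonneg) auto
    show "\<exists>\<delta>>0. \<forall>y. y \<in> ambient p T \<and> ambient_dist T x y < \<delta> \<longrightarrow> dist (midpoint_angle p x) (midpoint_angle p y) < \<epsilon>"
    proof (intro exI[of _ "min 1 (\<epsilon> / K)"] conjI allI impI)
      show "0 < min 1 (\<epsilon> / K)" using \<epsilon> K by simp
      fix y assume y: "y \<in> ambient p T \<and> ambient_dist T x y < min 1 (\<epsilon> / K)"
      obtain l' u' where lu': "y = (l', u')" "u' \<in> sobolev_sym p T 2" using y by (cases y) auto
      define d where "d = ambient_dist T x y"
      have d: "\<bar>l - l'\<bar> \<le> d" "sobolev_dist T 2 u u' \<le> d"
        using ambient_dist_ge(1)[of x y T] ambient_dist_ge(2)[of T x y] sobolev_dist_nonneg[OF T_pos, of u u']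
        by (auto simp: d_def lu lu' dist_real_def)
      have d1: "d < 1" "d < \<epsilon> / K" "0 \<le> d" using y d(1) by (auto simp: d_def[symmetric])
      have "\<bar>midpoint_angle p (l, u) - midpoint_angle p (l', u')\<bar>
        \<le> d * (T + Ca * (2 * L2norm T u + d)) * exp ((\<bar>l\<bar> + Ca * M\<^sup>2 + 1) * (T / 2 - 0))"
        by (rule midpoint_angle_estimate[OF lu(2) lu'(2) M d])
      also have "\<dots> \<le> d * (T + Ca * (2 * L2norm T u + 1)) * exp ((\<bar>l\<bar> + Ca * M\<^sup>2 + 1) * (T / 2 - 0))"
        using d1 Ca_nonneg by (intro mult_right_mono mult_left_mono add_left_mono) auto
      also have "\<dots> = d * K" by (simp add: K_def mult.assoc)
      also have "\<dots> < \<epsilon>" using d1(2) K by (simp add: pos_less_divide_eq)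
      finally show "dist (midpoint_angle p x) (midpoint_angle p y) < \<epsilon>" by (simp add: lu lu' dist_real_def)
    qed
  qed auto
  then show ?thesis by (simp add: ambient_topology_def)
qed

lemma zero_in_sobolev_sym: "(\<lambda>_. 0) \<in> sobolev_sym p T 2"
proof -
  have "(\<lambda>_. 0) \<in> sobolev_per T 2" by (rule sobolev_per_2I[OF h2_jet_zero[OF T_pos]]) auto
  then show ?thesis by (cases p) (auto simp: sobolev_sym_def)
qed

lemma \<FF>_zeros_nonzero:
  assumes "x \<in> \<FF>_zeros p T a - trivial_solutions"
  obtains y where "y \<in> {0..T}" "snd x y \<noteq> 0"
proof -
  obtain l u where x: "x = (l, u)" by (cases x)
  then have "u \<noteq> (\<lambda>_. 0)" using assms by (auto simp: trivial_solutions_def)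
  then obtain y where y: "u y \<noteq> 0" by auto
  moreover have "y \<in> {0..T}"
  proof (rule ccontr)
    assume "y \<notin> {0..T}"
    moreover have "u \<in> sobolev_per T 2" using assms x by (auto simp: \<FF>_zeros_def sobolev_sym_def)
    ultimately show False using y by (auto simp: sobolev_per_def)
  qed
  ultimately show ?thesis using that x by simp
qed

lemma \<SS>_midpoint_angle:
  assumes x: "x \<in> \<SS> p T a"
  shows "\<exists>j::int. midpoint_angle p x = phase p + of_int j * pi"
proof (cases "x \<in> \<FF>_zeros p T a - trivial_solutions")
  case True
  obtain l u where lu: "x = (l, u)" by (cases x)
  obtain y where y: "y \<in> {0..T}" "u y \<noteq> 0" using \<FF>_zeros_nonzero[OF True] lu by auto
  have Z: "(l, u) \<in> \<FF>_zeros p T a" using True lu by simp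
  obtain v where v: "linear_ode S 0 T (sqpot l u) u v"
    "u 0 * cos (phase p) = v 0 * sin (phase p)" "u (T / 2) * cos (phase p) = v (T / 2) * sin (phase p)"
    using zeros_imp_ode[OF Z] by blast
  have cu: "continuous_on {0..T} u" using v(1) by (simp add: linear_ode_def)
  obtain M where M: "\<And>t. t \<in> {0..T} \<Longrightarrow> \<bar>u t\<bar> \<le> M" using continuous_on_Icc_bounded[OF cu] by metis
  have b: "\<bar>sqpot l u t\<bar> \<le> \<bar>l\<bar> + Ca * M\<^sup>2" if "t \<in> {0<..<T} - S" for t
    by (rule sqpot_bound(1)[OF that]) (use M that in auto)
  show ?thesis unfolding midpoint_angle_def lu fst_conv snd_conv
    by (rule angle_multiple_of_pi[OF v(1) sqpot_cont[OF cu] b y(1) disjI1[OF y(2)] v(2,3)])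
next
  case False
  then obtain j where j: "x = (\<sigma> T j, \<lambda>_. 0)" "first_index p \<le> j" using x by (auto simp: \<SS>_def)
  define \<omega> where "\<omega> = 2 * pi * real j / T"
  have \<sigma>: "\<sigma> T j = \<omega>\<^sup>2" by (simp add: \<sigma>_def \<omega>_def)
  have half: "phase p + \<omega> * (T / 2) = phase p + real j * pi" using T_pos by (simp add: \<omega>_def)
  \<comment> \<open>The zero function determines no direction, so a nonzero solution of the linear
    equation takes its place. For j = 0, which occurs in the even case only, it is the constant
    1.\<close>
  let ?u = "\<lambda>t. sin (phase p + \<omega> * t)" and ?v = "\<lambda>t. \<omega> * cos (phase p + \<omega> * t)"
  have L: "linear_ode S 0 T (\<lambda>_. \<omega>\<^sup>2) ?u ?v"
    unfolding linear_ode_def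
    by (auto intro!: continuous_intros derivative_eq_intros simp: power2_eq_square)
  have sc: "sin (phase p) * cos (phase p) = 0" by (cases p) auto
  have nz: "?u 0 \<noteq> 0 \<or> ?v 0 \<noteq> 0"
    using j(2) T_pos by (cases p) (auto simp: \<omega>_def)
  have "\<exists>i::int. angle (phase p) (\<lambda>_. \<omega>\<^sup>2) (T / 2) = phase p + of_int i * pi"
  proof (rule angle_multiple_of_pi[OF L])
    show "0 \<in> {0..T}" using T_pos by simp
    show "?u 0 * cos (phase p) = ?v 0 * sin (phase p)" using sc by (simp add: mult_ac)
    have "sin (phase p + real j * pi) * cos (phase p) = 0" "cos (phase p + real j * pi) * sin (phase p) = 0"
      using sc by (auto simp: sin_add cos_add mult_ac)
    then show "?u (T / 2) * cos (phase p) = ?v (T / 2) * sin (phase p)" unfolding half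
      by (simp only: mult.assoc mult_zero_right)
  qed (use nz in auto)
  then show ?thesis by (simp add: midpoint_angle_def j(1) sqpot_def[abs_def] \<sigma>)
qed

lemma bifurcation_point:
  assumes k: "1 \<le> k"
  shows "(\<sigma> T k, \<lambda>_. 0) \<in> \<SS> p T a" "(\<sigma> T k, \<lambda>_. 0) \<in> ambient p T"
    "midpoint_angle p (\<sigma> T k, \<lambda>_. 0) = phase p + real k * pi"
proof -
  have "first_index p \<le> k" using k by (cases p) auto
  then show "(\<sigma> T k, \<lambda>_. 0) \<in> \<SS> p T a" by (auto simp: \<SS>_def)
  show "(\<sigma> T k, \<lambda>_. 0) \<in> ambient p T" using zero_in_sobolev_sym by simp
  have "pruefer_angle S 0 T (\<lambda>_. \<sigma> T k) (angle (phase p) (\<lambda>_. \<sigma> T k))" "angle (phase p) (\<lambda>_. \<sigma> T k) 0 = phase p"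
    using angle[of "\<lambda>_. \<sigma> T k" "\<bar>\<sigma> T k\<bar>" "phase p"] by auto
  then show "midpoint_angle p (\<sigma> T k, \<lambda>_. 0) = phase p + real k * pi"
    using constant_potential_angle[OF phase_cases k] by (simp add: midpoint_angle_def sqpot_def[abs_def] \<sigma>_def)
qed

lemma component_subset: "\<C> p T a k \<subseteq> \<SS> p T a \<inter> ambient p T"
  using connected_component_of_subset_topspace[of "subtopology (ambient_topology p T) (\<SS> p T a)"]
  unfolding \<C>_def topspace_subtopology topspace_ambient by blast

lemma component_midpoint_angle:
  assumes k: "1 \<le> k" and x: "x \<in> \<C> p T a k"
  shows "midpoint_angle p x = phase p + real k * pi"
proof -
  let ?X = "subtopology (ambient_topology p T) (\<SS> p T a)"
  have pC: "(\<sigma> T k, \<lambda>_. 0) \<in> \<C> p T a k"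
    unfolding \<C>_def using bifurcation_point[OF k, of p]
    by (simp add: connected_component_of_refl topspace_ambient)
  have "connectedin ?X (\<C> p T a k)" unfolding \<C>_def by (rule connectedin_connected_component_of)
  moreover have "continuous_map ?X euclideanreal (midpoint_angle p)"
    by (rule continuous_map_from_subtopology[OF midpoint_angle_continuous])
  ultimately have "connectedin euclideanreal (midpoint_angle p ` \<C> p T a k)"
    by (rule connectedin_continuous_map_image[rotated])
  then have "connected (midpoint_angle p ` \<C> p T a k)" by simp
  moreover have "midpoint_angle p ` \<C> p T a k \<subseteq> range (\<lambda>j::int. phase p + of_int j * pi)"
    using component_subset \<SS>_midpoint_angle by blast
  then have "countable (midpoint_angle p ` \<C> p T a k)"
    by (rule countable_subset) auto
  ultimately have "midpoint_angle p x = midpoint_angle p (\<sigma> T k, \<lambda>_. 0)"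
    by (rule connected_subset_countable_eq) (use x pC in auto)
  then show ?thesis using bifurcation_point(3)[OF k] by simp
qed

text \<open>Along a solution q \<ge> \<lambda>, so for \<lambda> > \<sigma>_k strict comparison puts
  the angle at T/2 above the value that it has on the whole component.\<close>

lemma component_le:
  assumes k: "1 \<le> k" and x: "x \<in> \<C> p T a k"
  shows "fst x \<le> \<sigma> T k"
proof (rule ccontr)
  assume gt: "\<not> fst x \<le> \<sigma> T k"
  obtain l u where lu: "x = (l, u)" by (cases x)
  have "u \<in> sobolev_sym p T 2" using component_subset x lu by blast
  then have cu: "continuous_on {0..T} u" unfolding sobolev_sym_def by (auto elim: sobolev_per_2D)
  obtain M where M: "\<And>t. t \<in> {0..T} \<Longrightarrow> \<bar>u t\<bar> \<le> M" using continuous_on_Icc_bounded[OF cu] by metis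
  have b: "\<bar>sqpot l u t\<bar> \<le> \<bar>l\<bar> + Ca * M\<^sup>2" "l \<le> sqpot l u t" if "t \<in> {0<..<T} - S" for t
    by (rule sqpot_bound[OF that]; use M that in auto)+
  have "0 < T / 2" using T_pos by simp
  from open_interval_minus_finite_nonempty[OF this fin_S]
  obtain t where t: "t \<in> {0<..<T/2} - S" by blast
  then have "l \<le> sqpot l u t" using b(2)[of t] by auto
  then have ne: "\<exists>t\<in>{0<..<T/2} - S. sqpot l u t \<noteq> (2 * pi * real k / T)\<^sup>2"
    using t gt lu by (intro bexI[OF _ t]) (auto simp: \<sigma>_def)
  have "phase p + real k * pi < angle (phase p) (sqpot l u) (T / 2)"
  proof (rule angle_comparison(1)[OF phase_cases k sqpot_cont[OF cu] b(1) angle[OF sqpot_cont[OF cu] b(1)] ne])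
    show "(2 * pi * real k / T)\<^sup>2 \<le> sqpot l u t" if "t \<in> {0<..<T} - S" for t
      using b(2)[OF that] gt lu by (simp add: \<sigma>_def)
  qed
  then show False using component_midpoint_angle[OF k x] by (simp add: midpoint_angle_def lu)
qed

section \<open>Shots as points of the component\<close>

lemma shot_restr_symmetry:
  assumes R: "0 \<le> R" and half: "shot_angle R (phase p) l A (T / 2) = phase p + real k * pi"
  defines "u \<equiv> shot_u R (phase p) l A" and "v \<equiv> shot_v R (phase p) l A"
  shows "has_symmetry p T (restr u)" "has_symmetry p T (restr (\<lambda>t. - u t))" "u 0 = u T" "v 0 = v T"
proof -
  note sym = shot_symmetric[OF R phase_cases half]
  have e: "(if phase p = 0 then - 1 else 1 :: real) = (case p of Ev \<Rightarrow> 1 | Odd \<Rightarrow> - 1)" by (cases p) auto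
  have us: "u (T - x) = (case p of Ev \<Rightarrow> 1 | Odd \<Rightarrow> - 1) * u x"
    and vs: "v (T - x) = - (case p of Ev \<Rightarrow> 1 | Odd \<Rightarrow> - 1) * v x" if "x \<in> {0..T}" for x
    using sym(1,2)[OF that] unfolding u_def v_def e by auto
  show "has_symmetry p T (restr u)" "has_symmetry p T (restr (\<lambda>t. - u t))"
    using us by (cases p; auto intro!: AE_I2 simp: restr_def)+
  have "u 0 = A * sin (phase p)" "v 0 = A * cos (phase p)" using shot(2,3)[OF R] by (auto simp: u_def v_def)
  then show "u 0 = u T" "v 0 = v T"
    using us[of 0] vs[of 0] T_pos by (cases p; simp)+
qed

definition shot_point :: "real \<Rightarrow> symmetry \<Rightarrow> real \<times> real \<Rightarrow> real \<times> (real \<Rightarrow> real)" where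
  "shot_point R p z = (fst z, restr (shot_u R (phase p) (fst z) (snd z)))"

lemma shot_point_solution:
  assumes R: "0 \<le> R" and half: "shot_angle R (phase p) l A (T / 2) = phase p + real k * pi"
    and bound: "\<forall>x\<in>{0..T}. \<bar>shot_u R (phase p) l A x\<bar> \<le> R"
  defines "u \<equiv> shot_u R (phase p) l A"
  shows "shot_point R p (l, A) \<in> \<FF>_zeros p T a"
    "is_solution T a l (restr u)" "is_solution T a l (restr (\<lambda>t. - u t))"
proof -
  note sym = shot_restr_symmetry[OF R half]
  note L = shot(1)[OF R, where l = l and A = A and \<phi> = "phase p"]
  have q: "pot R l (shot_u R (phase p) l A) x = sqpot l (shot_u R (phase p) l A) x" if "x \<in> {0<..<T} - S" for x
    using bound that by (simp add: pot_def sqpot_def trunc_square_eq)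
  note s1 = restr_solution[OF L q sym(3,4)]
  show "shot_point R p (l, A) \<in> \<FF>_zeros p T a"
    using s1 sym(1) by (simp add: shot_point_def \<FF>_zeros_def sobolev_sym_def)
  show "is_solution T a l (restr u)" unfolding u_def by (rule s1(3))
  show "is_solution T a l (restr (\<lambda>t. - u t))"
    unfolding u_def
    by (rule restr_solution(3)[OF linear_ode_uminus[OF L]]) (use q sym(3,4) in \<open>auto simp: sqpot_def\<close>)
qed

lemma shot_u_nonzero:
  assumes "0 \<le> R" "A \<noteq> 0"
  obtains x where "x \<in> {0..T}" "shot_u R \<phi> l A x \<noteq> 0"
proof -
  have "\<exists>x\<in>{0<..<T/2} - S. 0 < a x \<and> shot_u R \<phi> l A x \<noteq> 0"
    by (rule nontrivial_somewhere[OF shot(1) pot_bound(1) _ shot_nonvanishing, where y = 0])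
       (use assms T_pos in auto)
  then obtain x where "x \<in> {0<..<T/2}" "shot_u R \<phi> l A x \<noteq> 0" by blast
  then show ?thesis using T_pos by (intro that[of x]) auto
qed

text \<open>The two solutions are u and - u: both have the zeros of the sine of the angle, as the
  polar radius is positive, and they differ since u is not 0.\<close>

lemma shot_point_nodal:
  assumes R: "0 \<le> R" and A: "0 < A"
    and half: "shot_angle R (phase p) l A (T / 2) = phase p + real k * pi"
    and bound: "\<forall>x\<in>{0..T}. \<bar>shot_u R (phase p) l A x\<bar> \<le> R"
  shows "\<exists>u v. u \<noteq> v \<and> u \<in> nodal_solutions p T a l (2 * k) \<and> v \<in> nodal_solutions p T a l (2 * k)"
proof -
  let ?u = "shot_u R (phase p) l A" and ?\<theta> = "shot_angle R (phase p) l A"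
  have "card {x \<in> {0..<T}. sin (?\<theta> x) = 0} = 2 * k"
  proof (rule card_pruefer_zeros[OF fin_S shot_angle(1)[OF R] T_pos pot_bound(1)[OF R]])
    show "?\<theta> 0 = 0 \<or> ?\<theta> 0 = pi / 2" using phase_cases[of p] by (simp add: shot_angle(2)[OF R])
    show "?\<theta> T = ?\<theta> 0 + 2 * real k * pi"
      using shot_symmetric(3)[OF R phase_cases half] by (simp add: shot_angle(2)[OF R])
  qed
  moreover have "sin (?\<theta> x) = 0 \<longleftrightarrow> ?u x = 0" if "x \<in> {0..T}" for x
    using shot_radius[OF R A that, of "phase p" l] by auto
  then have "{x \<in> {0..<T}. sin (?\<theta> x) = 0} = {x \<in> {0..<T}. restr ?u x = 0}"
    "{x \<in> {0..<T}. sin (?\<theta> x) = 0} = {x \<in> {0..<T}. restr (\<lambda>t. - ?u t) x = 0}"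
    by (auto simp: restr_def)
  ultimately have card: "card {x \<in> {0..<T}. restr ?u x = 0} = 2 * k" "card {x \<in> {0..<T}. restr (\<lambda>t. - ?u t) x = 0} = 2 * k"
    by simp_all
  obtain x where x: "x \<in> {0..T}" "?u x \<noteq> 0" using shot_u_nonzero[OF R, of A] A by blast
  have "restr ?u \<noteq> restr (\<lambda>t. - ?u t)"
  proof
    assume "restr ?u = restr (\<lambda>t. - ?u t)"
    from fun_cong[OF this, of x] show False using x by (simp add: restr_def)
  qed
  then show ?thesis
    using shot_point_solution(2,3)[OF R half bound] shot_restr_symmetry(1,2)[OF R half] card
    unfolding nodal_solutions_def by blast
qed

text \<open>Closeness of u, v and the parameter passes to the second derivative through the
  equation, whose right-hand side is Lipschitz; uniform convergence of shots thus becomes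
  convergence in H^2. In the constant, M + 1 bounds the neighbouring shot, since e \<le> 1.\<close>

lemma shot_point_dist:
  assumes R: "0 \<le> R" and e: "0 \<le> e" "e \<le> 1"
    and M: "\<And>x. x \<in> {0..T} \<Longrightarrow> \<bar>shot_u R \<phi> l A x\<bar> \<le> M"
    and l: "\<bar>l - l'\<bar> \<le> e"
    and close: "\<And>x. x \<in> {0..T} \<Longrightarrow> \<bar>shot_u R \<phi> l' A' x - shot_u R \<phi> l A x\<bar> \<le> e \<and> \<bar>shot_v R \<phi> l' A' x - shot_v R \<phi> l A x\<bar> \<le> e"
  shows "sobolev_dist T 2 (restr (shot_u R \<phi> l A)) (restr (shot_u R \<phi> l' A'))
    \<le> e * ((2 + ((1 + \<bar>l\<bar> + 3 * R\<^sup>2 * Ca) * 2 + (M + 1))) * sqrt T)"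
proof -
  let ?u = "shot_u R \<phi> l A" and ?v = "shot_v R \<phi> l A" and ?u' = "shot_u R \<phi> l' A'" and ?v' = "shot_v R \<phi> l' A'"
  let ?w = "\<lambda>x. - pot R l ?u x * ?u x" and ?w' = "\<lambda>x. - pot R l' ?u' x * ?u' x"
  define K where "K = 1 + \<bar>l\<bar> + 3 * R\<^sup>2 * Ca"
  have K: "0 \<le> K" using Ca_nonneg by (simp add: K_def)
  have M0: "0 \<le> M" using M[of 0] T_pos by force
  have J: "h2_jet T (restr (shot_u R \<phi> l A)) (shot_v R \<phi> l A) (\<lambda>x. - pot R l (shot_u R \<phi> l A) x * shot_u R \<phi> l A x)" for l A
    by (rule restr_jet[OF shot(1)[OF R] pot_cont[OF shot_cont(1)[OF R]] pot_bound(1)[OF R]])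
  note D = h2_jet_diff[OF J J, of l A l' A']
  have w: "\<bar>?w x - ?w' x\<bar> \<le> K * (2 * e) + e * (M + 1)" if x: "x \<in> {0<..<T} - S" for x
  proof -
    have xT: "x \<in> {0..T}" using x by auto
    have eq: "rhs R l x (?u x, ?v x) - rhs R l' x (?u' x, ?v' x) = (?v x - ?v' x, ?w x - ?w' x)"
      by (simp add: rhs_def pot_def algebra_simps)
    have "\<bar>?w x - ?w' x\<bar> \<le> norm (rhs R l x (?u x, ?v x) - rhs R l' x (?u' x, ?v' x))"
      unfolding eq using norm_snd_le[of "?w x - ?w' x" "?v x - ?v' x"] by simp
    also have "\<dots> \<le> K * norm ((?u x, ?v x) - (?u' x, ?v' x)) + \<bar>l - l'\<bar> * \<bar>fst (?u' x, ?v' x)\<bar>"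
      unfolding K_def by (rule rhs_diff[OF R x])
    also have "\<dots> \<le> K * (2 * e) + e * (M + 1)"
    proof (intro add_mono mult_left_mono mult_mono l)
      have "norm ((?u x, ?v x) - (?u' x, ?v' x)) \<le> norm (?u x - ?u' x) + norm (?v x - ?v' x)"
        using norm_Pair_le[of "?u x - ?u' x" "?v x - ?v' x"] by simp
      then show "norm ((?u x, ?v x) - (?u' x, ?v' x)) \<le> 2 * e"
        using close[OF xT] by (simp add: abs_minus_commute)
      show "\<bar>fst (?u' x, ?v' x)\<bar> \<le> M + 1" 
        using close[OF xT] M[OF xT] e unfolding fst_conv by linarith
    qed (use K e in auto)
    finally show ?thesis .
  qed
  have "sobolev_dist T 2 (restr ?u) (restr ?u') \<le> L2norm T (\<lambda>x. restr ?u x - restr ?u' x)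
      + L2norm T (\<lambda>x. ?v x - ?v' x) + L2norm T (\<lambda>x. ?w x - ?w' x)"
    unfolding sobolev_dist_def by (rule sobolev_norm_le[OF D])
  also have "\<dots> \<le> e * sqrt T + e * sqrt T + (K * (2 * e) + e * (M + 1)) * sqrt T"
  proof (intro add_mono L2norm_le h2_jet_square_integrable[OF D])
    show "AE x in lebesgue_on {0..T}. \<bar>restr ?u x - restr ?u' x\<bar> \<le> e"
      using close by (intro AE_I2) (auto simp: restr_def abs_minus_commute)
    show "AE x in lebesgue_on {0..T}. \<bar>?v x - ?v' x\<bar> \<le> e"
      using close by (intro AE_I2) (auto simp: abs_minus_commute)
    show "AE x in lebesgue_on {0..T}. \<bar>?w x - ?w' x\<bar> \<le> K * (2 * e) + e * (M + 1)"
      by (rule eventually_mono[OF AE_off_finite[OF fin_S] w])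
  qed (use e K M0 T_pos in auto)
  also have "\<dots> = e * ((2 + (K * 2 + (M + 1))) * sqrt T)" by (simp add: algebra_simps)
  finally show ?thesis unfolding K_def .
qed

lemma shot_point_continuous:
  assumes R: "0 \<le> R" and Z: "\<And>z. z \<in> Z \<Longrightarrow> shot_point R p z \<in> ambient p T"
  shows "continuous_map (top_of_set Z) (ambient_topology p T) (shot_point R p)"
proof -
  interpret A: Metric_space "ambient p T" "ambient_dist T" by (rule ambient_metric[OF T_pos])
  have "continuous_map (top_of_set Z) A.mtopology (shot_point R p)"
    unfolding A.continuous_map_to_metric
  proof (intro ballI allI impI)
    fix z and \<epsilon> :: real assume z: "z \<in> topspace (top_of_set Z)" and \<epsilon>: "0 < \<epsilon>"
    obtain l A where lA: "z = (l, A)" by (cases z)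
    let ?u = "shot_u R (phase p) l A"
    obtain M where M: "\<And>x. x \<in> {0..T} \<Longrightarrow> \<bar>?u x\<bar> \<le> M"
      using continuous_on_Icc_bounded[OF shot_cont(1)[OF R]] by metis
    have M0: "0 \<le> M" using M[of 0] T_pos by force
    \<comment> \<open>The leading 1 accounts for the distance of the parameters; the rest is the
      constant of \<open>shot_point_dist\<close>.\<close>
    define C where "C = 1 + (2 + ((1 + \<bar>l\<bar> + 3 * R\<^sup>2 * Ca) * 2 + (M + 1))) * sqrt T"
    have C: "1 \<le> C" unfolding C_def using M0 Ca_nonneg T_pos by simp
    define e where "e = min 1 (\<epsilon> / (2 * C))"
    have e: "0 < e" "e \<le> 1" using \<epsilon> C by (auto simp: e_def)
    have eC: "e * C < \<epsilon>"
    proof -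
      have "e * C \<le> \<epsilon> / (2 * C) * C" using C by (intro mult_right_mono) (auto simp: e_def)
      also have "\<dots> = \<epsilon> / 2" using C by simp
      finally show ?thesis using \<epsilon> by simp
    qed
    obtain d where d: "0 < d" "\<And>l' A' t. \<bar>l' - l\<bar> < d \<Longrightarrow> \<bar>A' - A\<bar> < d \<Longrightarrow> t \<in> {0..T} \<Longrightarrow>
      \<bar>shot_u R (phase p) l' A' t - shot_u R (phase p) l A t\<bar> \<le> e \<and> \<bar>shot_v R (phase p) l' A' t - shot_v R (phase p) l A t\<bar> \<le> e"
      using shot_continuous[OF R e(1)] by metis
    show "\<exists>U. openin (top_of_set Z) U \<and> z \<in> U \<and> (\<forall>y\<in>U. shot_point R p y \<in> A.mball (shot_point R p z) \<epsilon>)"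
    proof (intro exI[of _ "Z \<inter> ball z (min d e)"] conjI ballI)
      show "openin (top_of_set Z) (Z \<inter> ball z (min d e))" by (rule openin_open_Int) auto
      show "z \<in> Z \<inter> ball z (min d e)" using z d(1) e(1) by auto
      fix y assume y: "y \<in> Z \<inter> ball z (min d e)"
      obtain l' A' where lA': "y = (l', A')" by (cases y)
      have "dist z y < min d e" using y by simp
      then have close: "\<bar>l' - l\<bar> < d" "\<bar>A' - A\<bar> < d" "\<bar>l - l'\<bar> \<le> e"
        using dist_fst_le[of z y] dist_snd_le[of z y] by (auto simp: lA lA' dist_real_def abs_minus_commute)
      have "ambient_dist T (shot_point R p z) (shot_point R p y)
        \<le> dist l l' + sobolev_dist T 2 (restr ?u) (restr (shot_u R (phase p) l' A'))"
        using ambient_dist_le[of T "shot_point R p z" "shot_point R p y"] sobolev_dist_nonneg[OF T_pos]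
        by (simp add: shot_point_def lA lA')
      also have "\<dots> \<le> e + e * ((2 + ((1 + \<bar>l\<bar> + 3 * R\<^sup>2 * Ca) * 2 + (M + 1))) * sqrt T)"
        by (intro add_mono shot_point_dist R M) (use e close d(2)[OF close(1,2)] in \<open>auto simp: dist_real_def\<close>)
      also have "\<dots> = e * C" by (simp add: C_def distrib_left)
      finally have "ambient_dist T (shot_point R p z) (shot_point R p y) < \<epsilon>" using eC by simp
      moreover have "shot_point R p z \<in> ambient p T" using Z z by simp
      moreover have "shot_point R p y \<in> ambient p T" using Z y by simp
      ultimately show "shot_point R p y \<in> A.mball (shot_point R p z) \<epsilon>" unfolding A.in_mball by blast
    qed
  qed
  then show ?thesis by (simp add: ambient_topology_def)
qed

text \<open>The continuum of shooting parameters is mapped into the solution space. Its only point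
  with A = 0 goes to (\<sigma>_k, 0) itself, so the image avoids the rest of the trivial line; being
  connected, it lies in the component.\<close>

lemma component_reaches:
  assumes k: "1 \<le> k" and l0: "l0 \<le> \<sigma> T k"
  shows "\<exists>x\<in>\<C> p T a k. fst x = l0"
    and "l0 < \<sigma> T k \<Longrightarrow> \<exists>u v. u \<noteq> v \<and> u \<in> nodal_solutions p T a l0 (2 * k) \<and> v \<in> nodal_solutions p T a l0 (2 * k)"
proof -
  let ?\<phi> = "phase p"
  obtain R Z where R: "0 < R" and Z: "connected Z" "(\<sigma> T k, 0) \<in> Z" "\<exists>A. (l0, A) \<in> Z"
    and good: "\<And>l A. (l, A) \<in> Z \<Longrightarrow> 0 \<le> A \<and> shot_angle R ?\<phi> l A (T / 2) = ?\<phi> + real k * pi \<and> (A = 0 \<longrightarrow> l = \<sigma> T k) \<and>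
      (\<forall>x\<in>{0..T}. \<bar>shot_u R ?\<phi> l A x\<bar> \<le> R)"
    using shooting_continuum[OF phase_cases k, folded \<sigma>_def, OF l0] by metis
  have R0: "0 \<le> R" using R by simp
  obtain A0 where A0: "(l0, A0) \<in> Z" using Z(3) by blast
  have start: "shot_point R p (\<sigma> T k, 0) = (\<sigma> T k, \<lambda>_. 0)"
    by (auto simp: shot_point_def restr_def shot_zero(1)[OF R0])
  have inSS: "shot_point R p z \<in> \<SS> p T a \<and> shot_point R p z \<in> ambient p T" if z: "z \<in> Z" for z
  proof -
    obtain l A where lA: "z = (l, A)" by (cases z)
    note g = good[OF z[unfolded lA]]
    show ?thesis
    proof (cases "A = 0")
      case True
      then have "shot_point R p z = (\<sigma> T k, \<lambda>_. 0)" using g start lA by simp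
      then show ?thesis using bifurcation_point(1,2)[OF k] by simp
    next
      case False
      then have A: "0 < A" using g by simp
      have F: "shot_point R p z \<in> \<FF>_zeros p T a"
        unfolding lA by (rule shot_point_solution(1)[OF R0]) (use g in auto)
      obtain x where x: "x \<in> {0..T}" "shot_u R ?\<phi> l A x \<noteq> 0"
        using shot_u_nonzero[OF R0, of A] A by blast
      have "shot_point R p z \<notin> trivial_solutions"
      proof
        assume "shot_point R p z \<in> trivial_solutions"
        then have "restr (shot_u R ?\<phi> l A) = (\<lambda>_. 0)" by (auto simp: trivial_solutions_def shot_point_def lA)
        from fun_cong[OF this, of x] show False using x by (simp add: restr_def)
      qed
      then show ?thesis using F by (auto simp: \<SS>_def \<FF>_zeros_def)
    qed
  qed
  have cont: "continuous_map (top_of_set Z) (subtopology (ambient_topology p T) (\<SS> p T a)) (shot_point R p)"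
    unfolding continuous_map_in_subtopology
    using shot_point_continuous[OF R0, of Z p] inSS by auto
  have "connectedin (subtopology (ambient_topology p T) (\<SS> p T a)) (shot_point R p ` Z)"
    by (rule connectedin_continuous_map_image[OF cont])
       (use Z(1) in \<open>simp add: connectedin_subtopology\<close>)
  moreover have "(\<sigma> T k, \<lambda>_. 0) \<in> shot_point R p ` Z" using Z(2) start by force
  ultimately have "shot_point R p ` Z \<subseteq> \<C> p T a k"
    unfolding \<C>_def by (rule connected_component_of_maximal)
  then have "shot_point R p (l0, A0) \<in> \<C> p T a k" using A0 by blast
  then show "\<exists>x\<in>\<C> p T a k. fst x = l0" by (intro bexI[of _ "shot_point R p (l0, A0)"]) (auto simp: shot_point_def)
  assume lt: "l0 < \<sigma> T k"
  note g = good[OF A0]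
  have "A0 \<noteq> 0" using g lt by auto
  then show "\<exists>u v. u \<noteq> v \<and> u \<in> nodal_solutions p T a l0 (2 * k) \<and> v \<in> nodal_solutions p T a l0 (2 * k)"
    by (intro shot_point_nodal[OF R0, of A0]) (use g in auto)
qed

lemma component_fst:
  assumes "1 \<le> k"
  shows "fst ` \<C> p T a k = {..\<sigma> T k}"
  using component_le[OF assms] component_reaches(1)[OF assms] by force

text \<open>Already the projection to \<lambda> is unbounded: the component has points over every
  \<lambda> \<le> \<sigma>_k, two of which are farther apart than any proposed diameter.\<close>

lemma component_unbounded:
  assumes k: "1 \<le> k"
  shows "\<not> ambient_bounded p T (\<C> p T a k)"
proof
  interpret A: Metric_space "ambient p T" "ambient_dist T" by (rule ambient_metric[OF T_pos])
  assume "ambient_bounded p T (\<C> p T a k)"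
  then have "A.mbounded (\<C> p T a k)" by (simp add: ambient_bounded_def)
  then obtain B where B: "\<And>x y. x \<in> \<C> p T a k \<Longrightarrow> y \<in> \<C> p T a k \<Longrightarrow> ambient_dist T x y \<le> B"
    unfolding A.mbounded_alt by blast
  obtain x where x: "x \<in> \<C> p T a k" "fst x = \<sigma> T k" using component_reaches(1)[OF k order_refl] by blast
  have "\<sigma> T k - \<bar>B\<bar> - 1 \<le> \<sigma> T k" by simp
  from component_reaches(1)[OF k this]
  obtain y where y: "y \<in> \<C> p T a k" "fst y = \<sigma> T k - \<bar>B\<bar> - 1" by blast
  have "dist (fst x) (fst y) \<le> B"
    using ambient_dist_ge(1)[of x y T] B[OF x(1) y(1)] by linarith
  then show False using x(2) y(2) by (simp add: dist_real_def)
qed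

end

theorem theorem4p6:
  fixes T :: real and a :: "real \<Rightarrow> real" and k :: nat
  assumes "T > 0"
    and "HLoc T a"
    and "HGlob T a"
    and "has_symmetry Ev T a"
    and "k \<ge> 1"
  shows
    "(\<not> ambient_bounded Ev T (\<C> Ev T a k) \<and>
      fst ` \<C> Ev T a k = {..\<sigma> T k} \<and>
      (\<forall>l<\<sigma> T k. \<exists>u v. u \<noteq> v \<and>
         u \<in> nodal_solutions Ev T a l (2 * k) \<and> v \<in> nodal_solutions Ev T a l (2 * k))) \<and>
     (\<not> ambient_bounded Odd T (\<C> Odd T a k) \<and>
      fst ` \<C> Odd T a k = {..\<sigma> T k} \<and>
      (\<forall>l<\<sigma> T k. \<exists>u v. u \<noteq> v \<and>
         u \<in> nodal_solutions Odd T a l (2 * k) \<and> v \<in> nodal_solutions Odd T a l (2 * k)))"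
proof -
  obtain S Ca where "piecewise_weight T S a Ca"
    using piecewise_weight_exists[OF assms(1-4)] by blast
  then interpret piecewise_weight T S a Ca .
  show ?thesis
    using component_unbounded[OF assms(5)] component_fst[OF assms(5)] component_reaches(2)[OF assms(5)]
    by simp
qed

end
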